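(* Let $\Phi:D\rightarrow\mathbb{R}$ be a warping function with associated weights $w=(\Phi^{-1})'$ and $v$, let $\theta\in\mathbf{L}^2_{\sqrt v}(\mathbb{R})$, fix an arbitrary $\epsilon>0$, and let $w_1,w_2$ denote the weights $$w_1=(1+|\cdot|)^{1+\epsilon}\quad\text{and}\quad w_2=(1+|V(0,\cdot)|)^{1+\epsilon},\qquad V(\tau_0,\tau_1):=\int_{\tau_0}^{\tau_1}v(\tau)\,d\tau .$$ If $$\theta\in\mathbf{L}^\infty_{w_1}(\mathbb{R})\cap\mathbf{L}^\infty_{w_2}(\mathbb{R})\quad\text{and}\quad a_m\le\tilde a/w(m)\ \text{ for all } m\in\mathbb{Z}\text{ and some }\tilde a>0,\qquad(\ast)$$ then $\mathcal{G}(\Phi,\theta,\mathbf{a})$, $\mathbf{a}=(a_m)_{m\in\mathbb{Z}}\subset\mathbb{R}^+$, is a Bessel sequence. If $(\ast)$ holds and $$0<A_1\le\sum_{m\in\mathbb{Z}}|\theta(\cdot-m)|^2\quad\text{almost everywhere}$$ for some constant $A_1$, then there is a constant $\tilde a_0>0$ such that $\mathcal{G}(\Phi,\theta,\mathbf{a})$ is a frame for $\mathcal{F}^{-1}(\mathbf{L}^2(D))$ whenever $a_m\le\tilde a_0/w(m)$ for all $m\in\mathbb{Z}$.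
   Context: Weights are continuous positive functions $\mathbb{R}\to\mathbb{R}^+$. A weight $v$ is submultiplicative if $v(x+y)\le v(x)v(y)$ for all $x,y\in\mathbb{R}$; a weight $w$ is $v$-moderate if $w(x+y)\le v(x)w(y)$ for all $x,y\in\mathbb{R}$. For a weight $u$ and $1\le p\le\infty$, $\mathbf{L}^p_u(\mathbb{R})=\{f:\mathbb{R}\to\mathbb{C} : uf\in\mathbf{L}^p(\mathbb{R})\}$. Warping function: for an open interval $D\subseteq\mathbb{R}$, a $\mathcal{C}^1$-diffeomorphism $\Phi:D\to\mathbb{R}$ with $\Phi'>0$ such that there is a submultiplicative weight $v$ for which $w:=(\Phi^{-1})'$ is $v$-moderate. Given $\Phi$, $w$ and $v$ always denote these weights. $\mathbf{L}^2(D)$ denotes the functions in $\mathbf{L}^2(\mathbb{R})$ vanishing almost everywhere outside $D$. The Fourier transform is $\mathcal{F}f(\xi)=\int_{\mathbb{R}} f(t)e^{-2\pi i t\xi}\,dt$, extended to $\mathbf{L}^2(\mathbb{R})$; $\mathcal{F}^{-1}(\mathbf{L}^2(D))\subseteq\mathbf{L}^2(\mathbb{R})$ is the space of functions with Fourier transform in $\mathbf{L}^2(D)$. $\mathbf{T}_xf=f(\cdot-x)$. Warped filter bank: for a warping function $\Phi$, $\theta\in\mathbf{L}^2_{\sqrt v}(\mathbb{R})$ (complex-valued) and $\mathbf{a}=(a_m)_{m\in\mathbb{Z}}\subset\mathbb{R}^+$, $\mathcal{G}(\Phi,\theta,\mathbf{a})=(g_{m,n})_{m,n\in\mathbb{Z}}$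 with $g_{m,n}=\mathbf{T}_{na_m}\mathcal{F}^{-1}(g_m)$, where $g_m(\xi)=\sqrt{a_m}\,\theta(\Phi(\xi)-m)$ for $\xi\in D$ and $g_m(\xi)=0$ otherwise. The system is a frame for $\mathcal{F}^{-1}(\mathbf{L}^2(D))$ if there are $0<A\le B<\infty$ with $A\|f\|_2^2\le\sum_{m,n}|\langle f,g_{m,n}\rangle|^2\le B\|f\|_2^2$ for all $f\in\mathcal{F}^{-1}(\mathbf{L}^2(D))$; it is a Bessel sequence if the upper inequality holds for some $B<\infty$. *)

theory Defs
  imports "HOL-Analysis.Analysis"
begin

section \<open>Lebesgue spaces on the real line\<close>

text \<open>Elements of the spaces below are functions, not classes modulo equality almost everywhere;
  identities between elements are therefore stated almost everywhere.\<close>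

definition L1_space :: "(real \<Rightarrow> complex) set" where
  "L1_space = {f. integrable lebesgue f}"

definition L2_space :: "(real \<Rightarrow> complex) set" where
  "L2_space = {f. f \<in> borel_measurable lebesgue \<and> integrable lebesgue (\<lambda>t. (norm (f t))\<^sup>2)}"

definition Linf_space :: "(real \<Rightarrow> complex) set" where
  "Linf_space = {f. f \<in> borel_measurable lebesgue \<and> (\<exists>C. AE t in lebesgue. norm (f t) \<le> C)}"

definition weighted :: "(real \<Rightarrow> complex) set \<Rightarrow> (real \<Rightarrow> real) \<Rightarrow> (real \<Rightarrow> complex) set" where
  "weighted X u = {f. (\<lambda>t. complex_of_real (u t) * f t) \<in> X}"

definition L2_on :: "real set \<Rightarrow> (real \<Rightarrow> complex) set" where
  "L2_on D = {f \<in> L2_space. AE t in lebesgue. t \<notin> D \<longrightarrow> f t = 0}"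

definition L2_norm :: "(real \<Rightarrow> complex) \<Rightarrow> real" where
  "L2_norm f = sqrt (LINT t|lebesgue. (norm (f t))\<^sup>2)"

definition L2_inner :: "(real \<Rightarrow> complex) \<Rightarrow> (real \<Rightarrow> complex) \<Rightarrow> complex" where
  "L2_inner f g = (LINT t|lebesgue. f t * cnj (g t))"

definition L2_converges :: "(nat \<Rightarrow> real \<Rightarrow> complex) \<Rightarrow> (real \<Rightarrow> complex) \<Rightarrow> bool" where
  "L2_converges s f \<longleftrightarrow>
     f \<in> L2_space \<and> (\<forall>k. s k \<in> L2_space) \<and> (\<lambda>k. L2_norm (\<lambda>t. s k t - f t)) \<longlonglongrightarrow> 0"


section \<open>Fourier transform\<close>

definition fourier :: "(real \<Rightarrow> complex) \<Rightarrow> real \<Rightarrow> complex" where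
  "fourier f \<xi> = (LINT t|lebesgue. f t * exp (- 2 * pi * \<i> * t * \<xi>))"

text \<open>The extension by continuity of the Fourier integral from the dense subspace of functions
  that are both integrable and square-integrable. By the Plancherel theorem the transform exists
  for every square-integrable function and is unique up to null sets, so that the choices made
  below only select representatives.\<close>

definition has_fourier_L2 :: "(real \<Rightarrow> complex) \<Rightarrow> (real \<Rightarrow> complex) \<Rightarrow> bool" where
  "has_fourier_L2 f F \<longleftrightarrow>
     (\<exists>s. (\<forall>k. s k \<in> L1_space) \<and> L2_converges s f \<and> L2_converges (\<lambda>k. fourier (s k)) F)"

definition fourier_L2 :: "(real \<Rightarrow> complex) \<Rightarrow> real \<Rightarrow> complex" where
  "fourier_L2 f = (SOME F. has_fourier_L2 f F)"

definition inv_fourier_L2 :: "(real \<Rightarrow> complex) \<Rightarrow> real \<Rightarrow> complex" where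
  "inv_fourier_L2 g = (SOME f. f \<in> L2_space \<and> (AE \<xi> in lebesgue. fourier_L2 f \<xi> = g \<xi>))"

definition inv_fourier_space :: "real set \<Rightarrow> (real \<Rightarrow> complex) set" where
  "inv_fourier_space D = {f \<in> L2_space. fourier_L2 f \<in> L2_on D}"

definition translate :: "real \<Rightarrow> (real \<Rightarrow> complex) \<Rightarrow> real \<Rightarrow> complex" where
  "translate x f = (\<lambda>t. f (t - x))"


section \<open>Bessel sequences and frames\<close>

text \<open>The sums are taken in the extended nonnegative reals, where they always exist.\<close>

definition bessel_for :: "(real \<Rightarrow> complex) set \<Rightarrow> ('i \<Rightarrow> real \<Rightarrow> complex) \<Rightarrow> bool" where
  "bessel_for H g \<longleftrightarrow>
     (\<exists>B::real. \<forall>f\<in>H.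
        (\<Sum>\<^sub>\<infinity>i. ennreal ((norm (L2_inner f (g i)))\<^sup>2)) \<le> ennreal (B * (L2_norm f)\<^sup>2))"

definition frame_for :: "(real \<Rightarrow> complex) set \<Rightarrow> ('i \<Rightarrow> real \<Rightarrow> complex) \<Rightarrow> bool" where
  "frame_for H g \<longleftrightarrow>
     (\<exists>A B::real. 0 < A \<and> A \<le> B \<and> (\<forall>f\<in>H.
        ennreal (A * (L2_norm f)\<^sup>2) \<le> (\<Sum>\<^sub>\<infinity>i. ennreal ((norm (L2_inner f (g i)))\<^sup>2)) \<and>
        (\<Sum>\<^sub>\<infinity>i. ennreal ((norm (L2_inner f (g i)))\<^sup>2)) \<le> ennreal (B * (L2_norm f)\<^sup>2)))"


section \<open>Weights and warping functions\<close>

definition weight :: "(real \<Rightarrow> real) \<Rightarrow> bool" where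
  "weight u \<longleftrightarrow> continuous_on UNIV u \<and> (\<forall>x. 0 < u x)"

definition submultiplicative_weight :: "(real \<Rightarrow> real) \<Rightarrow> bool" where
  "submultiplicative_weight v \<longleftrightarrow> weight v \<and> (\<forall>x y. v (x + y) \<le> v x * v y)"

definition moderate_weight :: "(real \<Rightarrow> real) \<Rightarrow> (real \<Rightarrow> real) \<Rightarrow> bool" where
  "moderate_weight v w \<longleftrightarrow> weight w \<and> (\<forall>x y. w (x + y) \<le> v x * w y)"

definition C1_on :: "real set \<Rightarrow> (real \<Rightarrow> real) \<Rightarrow> bool" where
  "C1_on S f \<longleftrightarrow> (\<forall>x\<in>S. f differentiable (at x)) \<and> continuous_on S (deriv f)"

definition C1_diffeo_onto_reals :: "real set \<Rightarrow> (real \<Rightarrow> real) \<Rightarrow> bool" where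
  "C1_diffeo_onto_reals D \<Phi> \<longleftrightarrow>
     bij_betw \<Phi> D UNIV \<and> C1_on D \<Phi> \<and> C1_on UNIV (inv_into D \<Phi>)"

definition warp_weight :: "real set \<Rightarrow> (real \<Rightarrow> real) \<Rightarrow> real \<Rightarrow> real" where
  "warp_weight D \<Phi> = deriv (inv_into D \<Phi>)"

definition warping_function :: "real set \<Rightarrow> (real \<Rightarrow> real) \<Rightarrow> bool" where
  "warping_function D \<Phi> \<longleftrightarrow>
     open D \<and> is_interval D \<and> C1_diffeo_onto_reals D \<Phi> \<and> (\<forall>\<xi>\<in>D. 0 < deriv \<Phi> \<xi>) \<and>
     (\<exists>v. submultiplicative_weight v \<and> moderate_weight v (warp_weight D \<Phi>))"

definition weight_integral :: "(real \<Rightarrow> real) \<Rightarrow> real \<Rightarrow> real \<Rightarrow> real" where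
  "weight_integral v \<tau>0 \<tau>1 = (LBINT \<tau>=ereal \<tau>0..ereal \<tau>1. v \<tau>)"


section \<open>Warped filter banks\<close>

definition warped_filter ::
    "real set \<Rightarrow> (real \<Rightarrow> real) \<Rightarrow> (real \<Rightarrow> complex) \<Rightarrow> (int \<Rightarrow> real) \<Rightarrow> int \<Rightarrow> real \<Rightarrow> complex" where
  "warped_filter D \<Phi> \<theta> a m \<xi> =
     (if \<xi> \<in> D then complex_of_real (sqrt (a m)) * \<theta> (\<Phi> \<xi> - real_of_int m) else 0)"

definition warped_filter_bank ::
    "real set \<Rightarrow> (real \<Rightarrow> real) \<Rightarrow> (real \<Rightarrow> complex) \<Rightarrow> (int \<Rightarrow> real) \<Rightarrow> int \<times> int \<Rightarrow> real \<Rightarrow> complex"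
  where
  "warped_filter_bank D \<Phi> \<theta> a =
     (\<lambda>(m, n). translate (real_of_int n * a m) (inv_fourier_L2 (warped_filter D \<Phi> \<theta> a m)))"

end

theory Submission
  imports Defs "HOL-Probability.Probability"
begin

text \<open>By the Plancherel theorem the coefficients of a function with Fourier transform \<open>F\<close> are the samples, at the
  points \<open>n a\<^sub>m\<close>, of the inverse Fourier transform of \<open>F g\<^sub>m\<close> (with \<open>g\<^sub>m\<close> conjugated). For fixed \<open>m\<close> the sum over \<open>n\<close>
  is, by the Parseval identity applied to the \<open>1/a\<^sub>m\<close>-periodization, a diagonal term \<open>\<integral> |F|\<^sup>2 |\<theta>(\<Phi> - m)|\<^sup>2\<close> plus
  terms pairing \<open>\<xi>\<close> with \<open>\<xi> + k/a\<^sub>m\<close> for \<open>k \<noteq> 0\<close>, and the latter are dominated by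
  \<open>\<integral> |F|\<^sup>2 \<Sum>\<^sub>m |\<theta>(\<Phi> - m)| \<Sum>\<^bsub>k\<noteq>0\<^esub> |\<theta>(\<Phi>(\<cdot> + k/a\<^sub>m) - m)|\<close>. Moderateness gives
  \<open>|\<Phi>\<inverse>(m + y) - \<Phi>\<inverse>(m)| \<le> w(m) |V(0, y)|\<close>, so that decay of \<open>\<theta>\<close> in \<open>V(0, \<cdot>)\<close> controls the sum over \<open>k\<close>,
  whose nodes have spacing \<open>1/(a\<^sub>m w(m))\<close> after rescaling by \<open>w(m)\<close>, while decay of \<open>\<theta>\<close> itself controls the sum over
  \<open>m\<close>. The off-diagonal part is bounded, and it tends to zero with \<open>sup\<^sub>m a\<^sub>m w(m)\<close>: the terms with
  \<open>|\<Phi>(\<xi>) - m| > M\<close> are uniformly small for large \<open>M\<close>, and for the others the nodes with \<open>k \<noteq> 0\<close> are far away.\<close>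

section \<open>The space of square-integrable functions\<close>

text \<open>The estimates take place in the extended nonnegative reals, where sums and integrals may
  be interchanged without summability conditions but nothing can be subtracted. Hence the lower
  bound is not derived as diagonal minus remainder. With S the coefficient energy, X the diagonal
  energy and T the overlap energy over all k, including k = 0, the two facts carried through the
  proof are S <= T and 2 X <= S + T; the second rests on 2 sum |z|^2 <= |sum z|^2 + (sum |z|)^2.
  Once T <= X + A1/2 times the energy of f, cancelling the finite X leaves the lower frame bound
  A1/2.

  The transform on L2 is defined as a closure, so Plancherel and inversion come before any
  coefficient can be computed. Gaussian means first give a contraction; equality is checked on
  continuous functions of bounded support and passes to the rest by density. Surjectivity needs no
  study of the range: the reflected transform of g is a preimage of g, by the equality case of
  Cauchy-Schwarz.\<close>

abbreviation enorm :: "complex \<Rightarrow> ennreal" where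
  "enorm z \<equiv> ennreal (norm z)"

abbreviation enorm2 :: "complex \<Rightarrow> ennreal" where
  "enorm2 z \<equiv> ennreal ((norm z)\<^sup>2)"

abbreviation nn_integral_lebesgue :: "(real \<Rightarrow> ennreal) \<Rightarrow> ennreal" (binder \<open>\<integral>\<^sub>\<lambda>\<close> 61) where
  "nn_integral_lebesgue f \<equiv> nn_integral lebesgue f"

lemma borel_measurable_cnj [measurable]:
  "f \<in> borel_measurable M \<Longrightarrow> (\<lambda>x. cnj (f x)) \<in> borel_measurable M"
  by (rule borel_measurable_continuous_on) (intro continuous_intros)

lemma borel_measurable_lebesgue_ident [measurable]: "(\<lambda>x::real. x) \<in> borel_measurable lebesgue"
  by (rule measurable_completion) simp

lemma L2_space_iff_nn_integral:
  "f \<in> L2_space \<longleftrightarrow> f \<in> borel_measurable lebesgue \<and> (\<integral>\<^sub>\<lambda> t. enorm2 (f t)) < \<infinity>"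
  unfolding L2_space_def by (auto simp: integrable_iff_bounded)

lemma L2_space_measurable: "f \<in> L2_space \<Longrightarrow> f \<in> borel_measurable lebesgue"
  by (simp add: L2_space_def)

lemma L2_space_integrable: "f \<in> L2_space \<Longrightarrow> integrable lebesgue (\<lambda>t. (norm (f t))\<^sup>2)"
  by (simp add: L2_space_def)

abbreviation L2_dist :: "(real \<Rightarrow> complex) \<Rightarrow> (real \<Rightarrow> complex) \<Rightarrow> real" where
  "L2_dist f g \<equiv> L2_norm (\<lambda>t. f t - g t)"

lemma L2_norm_nonneg [simp]: "0 \<le> L2_norm f"
  by (simp add: L2_norm_def)

lemma L2_norm_power2: "(L2_norm f)\<^sup>2 = (LINT t|lebesgue. (norm (f t))\<^sup>2)"
  by (simp add: L2_norm_def)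

lemma ennreal_L2_norm_power2:
  assumes "f \<in> L2_space"
  shows "ennreal ((L2_norm f)\<^sup>2) = (\<integral>\<^sub>\<lambda> t. enorm2 (f t))"
  unfolding L2_norm_power2 using L2_space_integrable[OF assms] by (simp add: nn_integral_eq_integral)

lemma power2_norm_add_le: "(norm (a + b :: complex))\<^sup>2 \<le> 2 * (norm a)\<^sup>2 + 2 * (norm b)\<^sup>2"
proof -
  have "(norm (a + b))\<^sup>2 \<le> (norm a + norm b)\<^sup>2"
    by (intro power_mono norm_triangle_ineq norm_ge_zero)
  also have "\<dots> \<le> 2 * (norm a)\<^sup>2 + 2 * (norm b)\<^sup>2"
    using zero_le_power2[of "norm a - norm b"] by (simp add: power2_eq_square algebra_simps)
  finally show ?thesis .
qed

lemma L2_space_add: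
  assumes f: "f \<in> L2_space" and g: "g \<in> L2_space"
  shows "(\<lambda>t. f t + g t) \<in> L2_space"
proof -
  note [measurable] = L2_space_measurable[OF f] L2_space_measurable[OF g]
  have "integrable lebesgue (\<lambda>t. (norm (f t + g t))\<^sup>2)"
  proof (rule Bochner_Integration.integrable_bound)
    show "integrable lebesgue (\<lambda>t. 2 * (norm (f t))\<^sup>2 + 2 * (norm (g t))\<^sup>2)"
      using f g by (auto simp: L2_space_def)
    show "AE x in lebesgue. norm ((norm (f x + g x))\<^sup>2) \<le> norm (2 * (norm (f x))\<^sup>2 + 2 * (norm (g x))\<^sup>2)"
      using power2_norm_add_le by (intro AE_I2) (simp del: abs_of_nonneg add: abs_of_nonneg[OF add_nonneg_nonneg])
  qed measurable
  then show ?thesis by (simp add: L2_space_def)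
qed

lemma L2_space_mult_bounded:
  assumes f: "f \<in> L2_space" and u: "u \<in> borel_measurable lebesgue" and B: "AE t in lebesgue. norm (u t) \<le> B"
  shows "(\<lambda>t. u t * f t) \<in> L2_space"
proof -
  have [measurable]: "f \<in> borel_measurable lebesgue" "u \<in> borel_measurable lebesgue"
    using f u by (auto simp: L2_space_def)
  have "integrable lebesgue (\<lambda>t. (norm (u t * f t))\<^sup>2)"
  proof (rule Bochner_Integration.integrable_bound)
    show "integrable lebesgue (\<lambda>t. B\<^sup>2 * (norm (f t))\<^sup>2)"
      using f by (auto simp: L2_space_def)
    show "AE x in lebesgue. norm ((norm (u x * f x))\<^sup>2) \<le> norm (B\<^sup>2 * (norm (f x))\<^sup>2)"
      using B
    proof eventually_elim
      case (elim x)
      then have "(norm (u x))\<^sup>2 \<le> B\<^sup>2" by (intro power_mono) auto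
      then show ?case by (simp add: norm_mult power_mult_distrib mult_right_mono)
    qed
  qed measurable
  then show ?thesis by (simp add: L2_space_def)
qed

lemma L2_space_cmult: "f \<in> L2_space \<Longrightarrow> (\<lambda>t. c * f t) \<in> L2_space"
  by (rule L2_space_mult_bounded[where B = "norm c"]) auto

lemma L2_space_diff:
  assumes "f \<in> L2_space" "g \<in> L2_space"
  shows "(\<lambda>t. f t - g t) \<in> L2_space"
  using L2_space_add[OF assms(1) L2_space_cmult[OF assms(2), of "-1"]] by simp

lemma L2_norm_cmult: "L2_norm (\<lambda>t. c * f t) = norm c * L2_norm f"
  by (simp add: L2_norm_def norm_mult power_mult_distrib real_sqrt_mult)

lemma L2_norm_minus_commute: "L2_dist f g = L2_dist g f"
  by (simp add: L2_norm_def norm_minus_commute)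

lemma L2_inner_integrable:
  assumes f: "f \<in> L2_space" and g: "g \<in> L2_space"
  shows "integrable lebesgue (\<lambda>t. f t * cnj (g t))"
proof (rule Bochner_Integration.integrable_bound)
  note [measurable] = L2_space_measurable[OF f] L2_space_measurable[OF g]
  show "integrable lebesgue (\<lambda>t. (norm (f t))\<^sup>2 + (norm (g t))\<^sup>2)"
    using f g by (auto simp: L2_space_def)
  show "(\<lambda>t. f t * cnj (g t)) \<in> borel_measurable lebesgue" by measurable
  have "a * b \<le> a\<^sup>2 + b\<^sup>2" for a b :: real
    using zero_le_power2[of "a - b"] zero_le_power2[of "a + b"]
    by (simp add: power2_eq_square algebra_simps)
  then show "AE x in lebesgue. norm (f x * cnj (g x)) \<le> norm ((norm (f x))\<^sup>2 + (norm (g x))\<^sup>2)"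
    by (intro AE_I2) (simp add: norm_mult)
qed

text \<open>For positive A and B, (A + B)(p^2/A + r^2/B) - (p + r)^2 = (B p - A r)^2/(A B) >= 0.
  Integrating this with A and B slightly above the two norms gives (A + B)^2. The strict excess
  keeps A and B positive when a norm is 0, and it is removed at the end.\<close>

lemma L2_norm_triangle:
  assumes f: "f \<in> L2_space" and g: "g \<in> L2_space"
  shows "L2_norm (\<lambda>t. f t + g t) \<le> L2_norm f + L2_norm g"
proof -
  note [simp] = L2_space_integrable[OF f] L2_space_integrable[OF g] L2_space_integrable[OF L2_space_add[OF f g]]
  have key: "(L2_norm (\<lambda>t. f t + g t))\<^sup>2 \<le> (A + B)\<^sup>2"
    if A: "A > L2_norm f" and B: "B > L2_norm g" for A B
  proof -
    have pos: "A > 0" "B > 0"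
      using A B L2_norm_nonneg[of f] L2_norm_nonneg[of g] by linarith+
    have pw: "(norm (f t + g t))\<^sup>2 \<le> (A + B) / A * (norm (f t))\<^sup>2 + (A + B) / B * (norm (g t))\<^sup>2" for t
    proof -
      have "(norm (f t + g t))\<^sup>2 \<le> (norm (f t) + norm (g t))\<^sup>2"
        by (intro power_mono norm_triangle_ineq norm_ge_zero)
      also have "\<dots> \<le> (A + B) / A * (norm (f t))\<^sup>2 + (A + B) / B * (norm (g t))\<^sup>2"
      proof -
        have "0 \<le> (B * norm (f t) - A * norm (g t))\<^sup>2 / (A * B)" using pos by simp
        also have "\<dots> = (A + B) / A * (norm (f t))\<^sup>2 + (A + B) / B * (norm (g t))\<^sup>2 - (norm (f t) + norm (g t))\<^sup>2"
          using pos by (simp add: field_simps power2_eq_square)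
        finally show ?thesis by simp
      qed
      finally show ?thesis .
    qed
    have "(L2_norm (\<lambda>t. f t + g t))\<^sup>2 \<le> (LINT t|lebesgue. (A + B) / A * (norm (f t))\<^sup>2 + (A + B) / B * (norm (g t))\<^sup>2)"
      unfolding L2_norm_power2 by (rule integral_mono[OF _ _ pw]) simp_all
    also have "\<dots> = (A + B) / A * (L2_norm f)\<^sup>2 + (A + B) / B * (L2_norm g)\<^sup>2"
      unfolding L2_norm_power2 by simp
    also have "\<dots> \<le> (A + B) / A * A\<^sup>2 + (A + B) / B * B\<^sup>2"
      using A B pos by (intro add_mono mult_left_mono power_mono) auto
    also have "\<dots> = (A + B)\<^sup>2" using pos by (simp add: field_simps power2_eq_square)
    finally show ?thesis .
  qed
  show ?thesis
  proof (rule field_le_epsilon)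
    fix e :: real assume "e > 0"
    then have "(L2_norm (\<lambda>t. f t + g t))\<^sup>2 \<le> ((L2_norm f + e/2) + (L2_norm g + e/2))\<^sup>2"
      by (intro key) auto
    then have "L2_norm (\<lambda>t. f t + g t) \<le> (L2_norm f + e/2) + (L2_norm g + e/2)"
      by (rule power2_le_imp_le) (use \<open>e > 0\<close> in \<open>auto intro!: add_nonneg_nonneg\<close>)
    then show "L2_norm (\<lambda>t. f t + g t) \<le> L2_norm f + L2_norm g + e" by simp
  qed
qed

lemma L2_norm_triangle_diff:
  assumes "f \<in> L2_space" "g \<in> L2_space" "h \<in> L2_space"
  shows "L2_dist f h \<le> L2_dist f g + L2_dist g h"
  using L2_norm_triangle[OF L2_space_diff[OF assms(1,2)] L2_space_diff[OF assms(2,3)]] by simp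

lemma L2_norm_abs_diff:
  assumes f: "f \<in> L2_space" and g: "g \<in> L2_space"
  shows "\<bar>L2_norm f - L2_norm g\<bar> \<le> L2_dist f g"
  using L2_norm_triangle[OF L2_space_diff[OF f g] g] L2_norm_triangle[OF L2_space_diff[OF g f] f]
  by (simp add: L2_norm_minus_commute[of g f])

lemma L2_norm_tendsto:
  assumes "L2_converges s f"
  shows "(\<lambda>k. L2_norm (s k)) \<longlonglongrightarrow> L2_norm f"
proof -
  have "(\<lambda>k. L2_norm (s k) - L2_norm f) \<longlonglongrightarrow> 0"
    by (rule Lim_null_comparison[OF _ conjunct2[OF conjunct2[OF assms[unfolded L2_converges_def]]]])
       (use assms L2_norm_abs_diff in \<open>auto simp: L2_converges_def\<close>)
  then show ?thesis by (simp add: LIM_zero_iff)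
qed

lemma L2_norm_eq_0_iff:
  assumes "f \<in> L2_space"
  shows "L2_norm f = 0 \<longleftrightarrow> (AE t in lebesgue. f t = 0)"
proof -
  have "L2_norm f = 0 \<longleftrightarrow> (LINT t|lebesgue. (norm (f t))\<^sup>2) = 0" by (simp add: L2_norm_def)
  also have "\<dots> \<longleftrightarrow> (AE t in lebesgue. (norm (f t))\<^sup>2 = 0)"
    by (intro integral_nonneg_eq_0_iff_AE L2_space_integrable assms) auto
  finally show ?thesis by simp
qed

lemma L2_converges_add_cmult:
  assumes s: "L2_converges s f" and r: "L2_converges r g"
  shows "L2_converges (\<lambda>k t. s k t + c * r k t) (\<lambda>t. f t + c * g t)"
proof -
  have mem: "f \<in> L2_space" "s k \<in> L2_space" "g \<in> L2_space" "r k \<in> L2_space" for k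
    using s r by (auto simp: L2_converges_def)
  have lim: "(\<lambda>k. L2_dist (s k) f + norm c * L2_dist (r k) g) \<longlonglongrightarrow> 0 + norm c * 0"
    using s r unfolding L2_converges_def by (intro tendsto_intros) auto
  have "L2_norm (\<lambda>t. (s k t + c * r k t) - (f t + c * g t))
      \<le> L2_dist (s k) f + norm c * L2_dist (r k) g" for k
    using L2_norm_triangle[OF L2_space_diff[OF mem(2,1)] L2_space_cmult[OF L2_space_diff[OF mem(4,3)]], of k c k]
    unfolding L2_norm_cmult[symmetric] by (simp add: algebra_simps)
  then have "(\<lambda>k. L2_norm (\<lambda>t. (s k t + c * r k t) - (f t + c * g t))) \<longlonglongrightarrow> 0"
    by (intro Lim_null_comparison[OF _ lim[simplified]]) auto
  then show ?thesis
    using mem by (auto simp: L2_converges_def intro!: L2_space_add L2_space_cmult)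
qed

text \<open>This turns statements about norms into statements about inner products: isometry into
  preservation of \<open>L2_inner\<close>, and convergence in norm into convergence of
  \<open>L2_inner\<close>. The factors \<open>1 *\<close> and \<open>(-1) *\<close> are kept so that
  all four norms have the shape \<open>f t + c * g t\<close> of the lemmas on linear
  combinations.\<close>

lemma L2_inner_polarization:
  assumes f: "f \<in> L2_space" and g: "g \<in> L2_space"
  shows "4 * L2_inner f g =
    of_real ((L2_norm (\<lambda>t. f t + 1 * g t))\<^sup>2) - of_real ((L2_norm (\<lambda>t. f t + (-1) * g t))\<^sup>2)
    + \<i> * of_real ((L2_norm (\<lambda>t. f t + \<i> * g t))\<^sup>2) - \<i> * of_real ((L2_norm (\<lambda>t. f t + (-\<i>) * g t))\<^sup>2)"
proof -
  have int: "integrable lebesgue (\<lambda>t. complex_of_real ((norm (f t + c * g t))\<^sup>2))" for c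
    using L2_space_integrable[OF L2_space_add[OF f L2_space_cmult[OF g, of c]]] by (rule integrable_of_real)
  have L: "complex_of_real ((L2_norm (\<lambda>t. f t + c * g t))\<^sup>2) = (LINT t|lebesgue. complex_of_real ((norm (f t + c * g t))\<^sup>2))" for c
    unfolding L2_norm_power2 by (rule integral_complex_of_real[symmetric])
  have pt: "4 * (a * cnj b) = of_real ((norm (a + 1 * b))\<^sup>2) - of_real ((norm (a + (-1) * b))\<^sup>2)
    + \<i> * of_real ((norm (a + \<i> * b))\<^sup>2) - \<i> * of_real ((norm (a + (-\<i>) * b))\<^sup>2)" for a b :: complex
    unfolding complex_norm_square by (simp add: algebra_simps)
  have "4 * L2_inner f g = (LINT t|lebesgue. 4 * (f t * cnj (g t)))"
    unfolding L2_inner_def by simp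
  also have "\<dots> = (LINT t|lebesgue. of_real ((norm (f t + 1 * g t))\<^sup>2) - of_real ((norm (f t + (-1) * g t))\<^sup>2)
    + \<i> * of_real ((norm (f t + \<i> * g t))\<^sup>2) - \<i> * of_real ((norm (f t + (-\<i>) * g t))\<^sup>2))"
    by (simp only: pt)
  also have "\<dots> = of_real ((L2_norm (\<lambda>t. f t + 1 * g t))\<^sup>2) - of_real ((L2_norm (\<lambda>t. f t + (-1) * g t))\<^sup>2)
    + \<i> * of_real ((L2_norm (\<lambda>t. f t + \<i> * g t))\<^sup>2) - \<i> * of_real ((L2_norm (\<lambda>t. f t + (-\<i>) * g t))\<^sup>2)"
    unfolding L using int[of 1] int[of "-1"] int[of \<i>] int[of "-\<i>"]
    by (simp del: of_real_power)
  finally show ?thesis .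
qed

section \<open>Completeness and dense classes of functions\<close>

lemma L2_Fatou:
  assumes g: "\<And>j. g j \<in> L2_space" and lim: "AE t in lebesgue. (\<lambda>j. g j t) \<longlonglongrightarrow> G t"
    and bd: "eventually (\<lambda>j. L2_norm (g j) \<le> c) sequentially"
    and G [measurable]: "G \<in> borel_measurable lebesgue"
  shows "G \<in> L2_space" "L2_norm G \<le> c"
proof -
  note [measurable] = L2_space_measurable[OF g]
  obtain j where "L2_norm (g j) \<le> c" using bd by (auto simp: eventually_sequentially)
  then have c: "0 \<le> c" using L2_norm_nonneg[of "g j"] by linarith
  have "(\<integral>\<^sub>\<lambda> t. enorm2 (G t)) = (\<integral>\<^sub>\<lambda> t. liminf (\<lambda>j. enorm2 (g j t)))"
  proof (rule nn_integral_cong_AE)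
    show "AE t in lebesgue. enorm2 (G t) = liminf (\<lambda>j. enorm2 (g j t))"
      using lim
    proof eventually_elim
      case (elim t)
      then have "(\<lambda>j. enorm2 (g j t)) \<longlonglongrightarrow> enorm2 (G t)"
        by (intro tendsto_ennrealI tendsto_power tendsto_norm)
      from lim_imp_Liminf[OF trivial_limit_sequentially this] show ?case by (rule sym)
    qed
  qed
  also have "\<dots> \<le> liminf (\<lambda>j. \<integral>\<^sub>\<lambda> t. enorm2 (g j t))"
    by (intro nn_integral_liminf) measurable
  also have "\<dots> \<le> ennreal (c\<^sup>2)"
  proof (rule Liminf_le)
    show "eventually (\<lambda>j. (\<integral>\<^sub>\<lambda> t. enorm2 (g j t)) \<le> ennreal (c\<^sup>2)) sequentially"
      using bd
    proof eventually_elim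
      case (elim j)
      then have "(L2_norm (g j))\<^sup>2 \<le> c\<^sup>2" by (intro power_mono) auto
      then show ?case unfolding ennreal_L2_norm_power2[OF g, symmetric] by (rule ennreal_leI)
    qed
  qed simp
  finally have *: "(\<integral>\<^sub>\<lambda> t. enorm2 (G t)) \<le> ennreal (c\<^sup>2)" .
  then show G2: "G \<in> L2_space"
    unfolding L2_space_iff_nn_integral using G le_less_trans[OF * ennreal_less_top] by simp
  show "L2_norm G \<le> c"
  proof (rule power2_le_imp_le)
    show "(L2_norm G)\<^sup>2 \<le> c\<^sup>2"
      using * unfolding ennreal_L2_norm_power2[OF G2, symmetric] by (simp add: ennreal_le_iff)
  qed (rule c)
qed

text \<open>The weights 2^k replace an infinite Minkowski inequality. The sum of 2^k |D k|^2 has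
  integral at most C^2 sum 8^(-k), so it is finite almost everywhere; there |D k| is at most a
  constant times 2^(-k/2), and the telescoping series converges absolutely. Fatou's lemma then turns
  the pointwise limit into a limit in norm.\<close>

lemma L2_complete_geometric:
  assumes F: "\<And>k. F k \<in> L2_space" and C: "\<And>k. L2_dist (F (Suc k)) (F k) \<le> C * (1/4)^k"
  shows "\<exists>G. L2_converges F G"
proof -
  note [measurable] = L2_space_measurable[OF F]
  define D where "D k t = F (Suc k) t - F k t" for k t
  have D: "D k \<in> L2_space" for k unfolding D_def by (intro L2_space_diff F)
  note [measurable] = L2_space_measurable[OF D]
  have Cpos: "0 \<le> C" using order_trans[OF L2_norm_nonneg C, of 0] by simp
  have "(\<integral>\<^sub>\<lambda> t. (\<Sum>k. ennreal (2^k * (norm (D k t))\<^sup>2)))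
      = (\<Sum>k. \<integral>\<^sub>\<lambda> t. ennreal (2^k) * enorm2 (D k t))"
    by (subst nn_integral_suminf) (auto simp: ennreal_mult)
  also have "\<dots> = (\<Sum>k. ennreal (2^k) * ennreal ((L2_norm (D k))\<^sup>2))"
    by (subst nn_integral_cmult) (auto simp: ennreal_L2_norm_power2[OF D])
  also have "\<dots> \<le> (\<Sum>k. ennreal (C\<^sup>2 * (1/8)^k))"
  proof (rule suminf_le)
    fix k
    have "(L2_norm (D k))\<^sup>2 \<le> (C * (1/4)^k)\<^sup>2"
      using C[of k] by (intro power_mono) (auto simp: D_def[abs_def])
    then have "2^k * (L2_norm (D k))\<^sup>2 \<le> 2^k * (C * (1/4)^k)\<^sup>2" by (intro mult_left_mono) auto
    also have "\<dots> = C\<^sup>2 * (2 * (1/4)\<^sup>2)^k"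
      unfolding power_mult_distrib by (simp add: power_mult[symmetric] mult.commute)
    also have "\<dots> = C\<^sup>2 * (1/8)^k" by (simp add: power2_eq_square)
    finally show "ennreal (2^k) * ennreal ((L2_norm (D k))\<^sup>2) \<le> ennreal (C\<^sup>2 * (1/8)^k)"
      by (simp add: ennreal_mult[symmetric] ennreal_leI)
  qed auto
  also have "\<dots> < \<infinity>"
    by (subst suminf_ennreal2) (auto intro!: summable_mult summable_geometric)
  finally have "(\<integral>\<^sub>\<lambda> t. (\<Sum>k. ennreal (2^k * (norm (D k t))\<^sup>2))) \<noteq> \<infinity>" by simp
  then have "AE t in lebesgue. (\<Sum>k. ennreal (2^k * (norm (D k t))\<^sup>2)) \<noteq> \<infinity>"
    by (intro nn_integral_PInf_AE) measurable
  then have conv: "AE t in lebesgue. convergent (\<lambda>k. F k t)"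
  proof eventually_elim
    case (elim t)
    have "summable (\<lambda>k. 2^k * (norm (D k t))\<^sup>2)"
      by (rule summable_suminf_not_top) (use elim in \<open>auto simp: top_ennreal_def\<close>)
    then obtain M where M: "\<And>k. 2^k * (norm (D k t))\<^sup>2 \<le> M" and Mpos: "M > 0"
      using summable_imp_Bseq[of "\<lambda>k. 2^k * (norm (D k t))\<^sup>2"] by (auto simp: Bseq_def)
    have "summable (\<lambda>k. sqrt M * (1 / sqrt 2)^k)"
      by (intro summable_mult summable_geometric) (auto simp: real_less_rsqrt)
    then have "summable (\<lambda>k. norm (D k t))"
    proof (rule summable_comparison_test'[where N = 0])
      fix k
      have "(norm (D k t))\<^sup>2 \<le> M / 2^k" using M[of k] by (simp add: field_simps)
      also have "\<dots> = (sqrt M * (1 / sqrt 2)^k)\<^sup>2"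
        using Mpos by (simp add: power_mult_distrib power_divide power_mult[symmetric] mult.commute[of k])
          (simp add: power_mult)
      finally show "norm (norm (D k t)) \<le> sqrt M * (1 / sqrt 2)^k"
        by (simp, intro power2_le_imp_le[of "norm (D k t)"]) (use Mpos in auto)
    qed
    then have "summable (\<lambda>k. D k t)" by (rule summable_norm_cancel)
    then have "convergent (\<lambda>n. F 0 t + (\<Sum>k<n. D k t))"
      by (intro convergent_add convergent_const) (simp add: summable_iff_convergent)
    moreover have "F 0 t + (\<Sum>k<n. D k t) = F n t" for n
      unfolding D_def by (subst sum_lessThan_telescope) simp
    ultimately show ?case by simp
  qed
  define G where "G t = lim (\<lambda>k. F k t)" for t
  have [measurable]: "G \<in> borel_measurable lebesgue" unfolding G_def by measurable
  have lim: "AE t in lebesgue. (\<lambda>k. F k t) \<longlonglongrightarrow> G t"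
    using conv by eventually_elim (simp add: G_def convergent_LIMSEQ_iff)
  \<comment> \<open>The constant 4/3 is the sum of the geometric series in 1/4; keeping the factor
    \<open>1 - (1/4)^n\<close> makes the induction close exactly.\<close>
  have fin: "L2_dist (F k) (F (k + n)) \<le> 4/3 * C * (1/4)^k * (1 - (1/4)^n)" for k n
  proof (induction n)
    case 0
    then show ?case by (simp add: L2_norm_def)
  next
    case (Suc n)
    have "L2_dist (F k) (F (k + Suc n))
        \<le> L2_dist (F k) (F (k + n)) + L2_dist (F (k + n)) (F (k + Suc n))"
      by (intro L2_norm_triangle_diff F)
    also have "\<dots> \<le> 4/3 * C * (1/4)^k * (1 - (1/4)^n) + C * (1/4)^(k+n)"
      using Suc C[of "k + n"] by (intro add_mono) (simp_all add: L2_norm_minus_commute[of "F (k + n)"])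
    also have "\<dots> = 4/3 * C * (1/4)^k * (1 - (1/4)^Suc n)"
      by (simp add: power_add field_simps)
    finally show ?case .
  qed
  have tail: "(\<lambda>t. F k t - G t) \<in> L2_space \<and> L2_dist (F k) G \<le> 4/3 * C * (1/4)^k" for k
  proof -
    have 1: "(\<lambda>t. F k t - F (k + n) t) \<in> L2_space" for n by (intro L2_space_diff F)
    have 2: "AE t in lebesgue. (\<lambda>n. F k t - F (k + n) t) \<longlonglongrightarrow> F k t - G t"
      using lim
    proof eventually_elim
      case (elim t)
      then show ?case by (intro tendsto_intros) (subst add.commute, rule LIMSEQ_ignore_initial_segment)
    qed
    have "4/3 * C * (1/4)^k * (1 - (1/4)^n) \<le> 4/3 * C * (1/4)^k" for n :: nat
      using Cpos by (simp add: algebra_simps)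
    then have 3: "eventually (\<lambda>n. L2_dist (F k) (F (k + n)) \<le> 4/3 * C * (1/4)^k) sequentially"
      using fin order_trans by (intro always_eventually) blast
    show ?thesis
      using L2_Fatou[OF 1 2 3] by auto
  qed
  have "G \<in> L2_space" using L2_space_diff[OF F conjunct1[OF tail], of 0 0] by simp
  moreover have "(\<lambda>k. L2_dist (F k) G) \<longlonglongrightarrow> 0"
  proof (rule Lim_null_comparison)
    show "eventually (\<lambda>k. norm (L2_dist (F k) G) \<le> 4/3 * C * (1/4)^k) sequentially"
      using tail by auto
    show "(\<lambda>k. 4/3 * C * (1/4)^k) \<longlonglongrightarrow> 0"
      by (intro tendsto_mult_right_zero LIMSEQ_power_zero) auto
  qed
  ultimately show ?thesis using F by (auto simp: L2_converges_def)
qed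

lemma L2_dominated_convergence:
  assumes f: "f \<in> L2_space" and h: "\<And>n. h n \<in> L2_space"
    and lim: "AE t in lebesgue. (\<lambda>n. h n t) \<longlonglongrightarrow> f t"
    and W: "integrable lebesgue W" "\<And>n. AE t in lebesgue. (norm (h n t - f t))\<^sup>2 \<le> W t"
  shows "L2_converges h f"
proof -
  note [measurable] = L2_space_measurable[OF f] L2_space_measurable[OF h]
  have "(\<lambda>n. LINT t|lebesgue. (norm (h n t - f t))\<^sup>2) \<longlonglongrightarrow> (LINT t::real|lebesgue. (0::real))"
  proof (rule integral_dominated_convergence[where w = W])
    show "AE t in lebesgue. (\<lambda>n. (norm (h n t - f t))\<^sup>2) \<longlonglongrightarrow> 0"
      using lim
    proof eventually_elim
      case (elim t)
      have "(\<lambda>n. (norm (h n t - f t))\<^sup>2) \<longlonglongrightarrow> (norm (f t - f t))\<^sup>2"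
        by (intro tendsto_intros elim)
      then show ?case by simp
    qed
  qed (use W in auto)
  then have "(\<lambda>n. sqrt (LINT t|lebesgue. (norm (h n t - f t))\<^sup>2)) \<longlonglongrightarrow> sqrt 0"
    by (intro tendsto_real_sqrt) simp
  then show ?thesis using f h by (simp add: L2_converges_def L2_norm_def)
qed

lemma integrable_indicator_Icc: "integrable lebesgue (indicator {a..b::real} :: real \<Rightarrow> real)"
  by (rule integrable_real_indicator) (auto simp: emeasure_lborel_Icc_eq)

lemma L2_bounded_support:
  assumes [measurable]: "f \<in> borel_measurable lebesgue" and "\<And>t. norm (f t) \<le> M" "\<And>t. R < \<bar>t\<bar> \<Longrightarrow> f t = 0"
  shows "f \<in> L2_space"
proof -
  have "integrable lebesgue (\<lambda>t. (norm (f t))\<^sup>2)"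
  proof (rule Bochner_Integration.integrable_bound)
    show "integrable lebesgue (\<lambda>t. M\<^sup>2 * (indicator {-R..R} t :: real))" by (simp add: integrable_indicator_Icc)
    show "AE x in lebesgue. norm ((norm (f x))\<^sup>2) \<le> norm (M\<^sup>2 * (indicator {-R..R} x :: real))"
    proof (intro AE_I2)
      fix x
      have "(norm (f x))\<^sup>2 \<le> M\<^sup>2" using assms(2)[of x] by (intro power_mono) auto
      then show "norm ((norm (f x))\<^sup>2) \<le> norm (M\<^sup>2 * (indicator {-R..R} x :: real))"
        using assms(3)[of x] by (cases "R < \<bar>x\<bar>") (auto simp: indicator_def)
    qed
  qed measurable
  then show ?thesis by (simp add: L2_space_def)
qed

lemma L2_dense_bounded_support:
  assumes f: "f \<in> L2_space" and d: "d > 0"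
  shows "\<exists>h N. h \<in> L2_space \<and> N > 0 \<and> (\<forall>t. norm (h t) \<le> N) \<and> (\<forall>t. N < \<bar>t\<bar> \<longrightarrow> h t = 0)
           \<and> L2_dist h f < d"
proof -
  note [measurable] = L2_space_measurable[OF f]
  define h where "h n t = (if \<bar>t\<bar> \<le> real n + 1 \<and> norm (f t) \<le> real n + 1 then f t else 0)" for n t
  have [measurable]: "h n \<in> borel_measurable lebesgue" for n
    unfolding h_def by measurable
  have bd: "norm (h n t) \<le> real n + 1" "real n + 1 < \<bar>t\<bar> \<Longrightarrow> h n t = 0" for n t by (auto simp: h_def)
  have h: "h n \<in> L2_space" for n
    using bd by (intro L2_bounded_support[where M = "real n + 1" and R = "real n + 1"]) auto
  have "L2_converges h f"
  proof (rule L2_dominated_convergence[OF f h _ L2_space_integrable[OF f]])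
    show "AE t in lebesgue. (\<lambda>n. h n t) \<longlonglongrightarrow> f t"
    proof (intro AE_I2 tendsto_eventually)
      fix t
      obtain n0 :: nat where "max \<bar>t\<bar> (norm (f t)) \<le> real n0" using real_arch_simple by blast
      then show "eventually (\<lambda>n. h n t = f t) sequentially"
        unfolding eventually_sequentially by (intro exI[of _ n0]) (auto simp: h_def)
    qed
  qed (auto simp: h_def)
  then have "(\<lambda>n. L2_dist (h n) f) \<longlonglongrightarrow> 0" by (simp add: L2_converges_def)
  then have "eventually (\<lambda>n. L2_dist (h n) f < d) sequentially"
    using d by (rule order_tendstoD)
  then obtain n where "L2_dist (h n) f < d" by (auto simp: eventually_sequentially)
  then show ?thesis using h[of n] bd[of n] by (intro exI[of _ "h n"] exI[of _ "real n + 1"]) auto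
qed

text \<open>A Lebesgue measurable function is almost everywhere a limit of continuous ones, but
  these come without any bound. Truncating f first to a bounded b of bounded support allows the
  approximants to be cut off in value and in domain without changing their limit, and dominated
  convergence applies.\<close>

lemma L2_dense_continuous:
  assumes f: "f \<in> L2_space" and d: "d > 0"
  obtains h M R where "continuous_on UNIV h" "h \<in> L2_space" "\<And>t. norm (h t) \<le> M" "\<And>t. R < \<bar>t\<bar> \<Longrightarrow> h t = 0"
    "L2_dist h f < d"
proof -
  obtain b N where b: "b \<in> L2_space" and N: "N > 0" "\<And>t. norm (b t) \<le> N" "\<And>t. N < \<bar>t\<bar> \<Longrightarrow> b t = 0"
    and bf: "L2_dist b f < d / 2"
    using L2_dense_bounded_support[OF f, of "d/2"] d by auto
  have "b measurable_on UNIV"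
    using b by (intro lebesgue_measurable_imp_measurable_on) (auto simp: L2_space_def)
  then obtain Z g where Z: "negligible Z" and g: "\<And>n. continuous_on UNIV (g n)"
    and lim: "\<And>x. x \<notin> Z \<Longrightarrow> (\<lambda>n. g n x) \<longlonglongrightarrow> b x"
    unfolding measurable_on_def by auto
  \<comment> \<open>\<open>c\<close> is the radial retraction onto the disc of radius N, and the
    factor in \<open>h\<close> is a trapezoid equal to 1 on [-N, N] and 0 outside [-(N+1), N+1].
    Both are continuous and leave b unchanged.\<close>
  define c where "c z = complex_of_real (N / max N (norm z)) * z" for z
  define h where "h n t = complex_of_real (max 0 (min 1 (N + 1 - \<bar>t\<bar>))) * c (g n t)" for n t
  have c_cont: "continuous_on UNIV c"
    unfolding c_def using N(1) by (intro continuous_intros) (simp_all add: less_max_iff_disj less_imp_neq[THEN not_sym])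
  have c_bd: "norm (c z) \<le> N" for z
  proof -
    have "norm z \<le> max N (norm z)" by simp
    then have "N * (norm z / max N (norm z)) \<le> N * 1"
      using N(1) by (intro mult_left_mono) (auto simp: divide_le_eq_1 less_max_iff_disj)
    then show ?thesis using N(1) by (simp add: c_def norm_mult norm_divide)
  qed
  have c_id: "c z = z" if "norm z \<le> N" for z
    using that N(1) by (simp add: c_def max_def)
  have h_cont: "continuous_on UNIV (h n)" for n
    unfolding h_def by (intro continuous_intros continuous_on_compose2[OF c_cont g]) auto
  have h_bd: "norm (h n t) \<le> N" for n t
    using mult_mono[OF _ c_bd[of "g n t"], of "\<bar>max 0 (min 1 (N + 1 - \<bar>t\<bar>))\<bar>" 1] by (simp add: h_def norm_mult)
  have h_supp: "h n t = 0" if "N + 1 < \<bar>t\<bar>" for n t using that by (simp add: h_def)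
  have h_meas [measurable]: "h n \<in> borel_measurable lebesgue" for n
    using borel_measurable_continuous_onI[OF h_cont[of n]] by simp
  have h: "h n \<in> L2_space" for n
    by (rule L2_bounded_support[OF h_meas h_bd h_supp])
  have "L2_converges h b"
  proof (rule L2_dominated_convergence[OF b h])
    have "AE t in lebesgue. t \<notin> Z"
      using Z by (intro AE_not_in) (simp add: negligible_iff_null_sets)
    then show "AE t in lebesgue. (\<lambda>n. h n t) \<longlonglongrightarrow> b t"
    proof eventually_elim
      case (elim t)
      have "isCont c (b t)" using c_cont by (simp add: continuous_on_eq_continuous_at)
      from isCont_tendsto_compose[OF this lim[OF elim]]
      have "(\<lambda>n. c (g n t)) \<longlonglongrightarrow> b t" using c_id[OF N(2)] by simp
      then have "(\<lambda>n. h n t) \<longlonglongrightarrow> complex_of_real (max 0 (min 1 (N + 1 - \<bar>t\<bar>))) * b t"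
        unfolding h_def by (intro tendsto_intros)
      moreover have "complex_of_real (max 0 (min 1 (N + 1 - \<bar>t\<bar>))) * b t = b t"
        using N(3)[of t] by (cases "N < \<bar>t\<bar>") auto
      ultimately show ?case by simp
    qed
    show "integrable lebesgue (\<lambda>t. (2 * N)\<^sup>2 * (indicator {-(N+1)..N+1} t :: real))" by (simp add: integrable_indicator_Icc)
    show "AE t in lebesgue. (norm (h n t - b t))\<^sup>2 \<le> (2 * N)\<^sup>2 * (indicator {-(N+1)..N+1} t :: real)" for n
    proof (intro AE_I2)
      fix t
      have "norm (h n t - b t) \<le> 2 * N"
        using norm_triangle_ineq4[of "h n t" "b t"] h_bd[of n t] N(2)[of t] by linarith
      then have "(norm (h n t - b t))\<^sup>2 \<le> (2 * N)\<^sup>2" by (intro power_mono) auto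
      then show "(norm (h n t - b t))\<^sup>2 \<le> (2 * N)\<^sup>2 * (indicator {-(N+1)..N+1} t :: real)"
        using N(3)[of t] h_supp[of t n] by (cases "N + 1 < \<bar>t\<bar>") (auto simp: indicator_def)
    qed
  qed
  then have "eventually (\<lambda>n. L2_dist (h n) b < d / 2) sequentially"
    using d by (intro order_tendstoD) (auto simp: L2_converges_def)
  then obtain n where n: "L2_dist (h n) b < d / 2" by (auto simp: eventually_sequentially)
  have "L2_dist (h n) f < d"
    using L2_norm_triangle_diff[OF h b f, of n] n bf by linarith
  then show ?thesis using that[OF h_cont h h_bd h_supp] by blast
qed

section \<open>Plancherel theorem for integrable functions\<close>

definition phase :: "real \<Rightarrow> complex" where
  "phase x = cis (2 * pi * x)"

lemma phase_add: "phase (x + y) = phase x * phase y"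
  by (simp add: phase_def cis_mult algebra_simps)

lemma phase_0 [simp]: "phase 0 = 1"
  by (simp add: phase_def)

lemma norm_phase [simp]: "norm (phase x) = 1"
  by (simp add: phase_def)

lemma cnj_phase: "cnj (phase x) = phase (- x)"
  by (simp add: phase_def cis_cnj)

lemma phase_of_int [simp]: "phase (of_int k) = 1"
  using cis_multiple_2pi[of "of_int k"] by (simp add: phase_def)

lemma phase_measurable [measurable]: "phase \<in> borel_measurable borel"
  unfolding phase_def cis_conv_exp by measurable

lemma fourier_eq_phase: "fourier f \<xi> = (LINT t|lebesgue. f t * phase (- (t * \<xi>)))"
proof -
  have "exp (- 2 * pi * \<i> * t * \<xi>) = phase (- (t * \<xi>))" for t :: real
    by (simp add: phase_def cis_conv_exp algebra_simps)
  then show ?thesis unfolding fourier_def by simp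
qed

lemma sigma_finite_lebesgue: "sigma_finite_measure (lebesgue :: 'a::euclidean_space measure)"
proof
  obtain A where "countable A" "A \<subseteq> sets (lborel :: 'a measure)" "\<Union>A = space (lborel :: 'a measure)"
    "\<forall>a\<in>A. emeasure lborel a \<noteq> \<infinity>"
    using lborel.sigma_finite_countable by blast
  then show "\<exists>A. countable A \<and> A \<subseteq> sets (lebesgue :: 'a measure) \<and> \<Union>A = space (lebesgue :: 'a measure)
      \<and> (\<forall>a\<in>A. emeasure lebesgue a \<noteq> \<infinity>)"
    by (intro exI[of _ A]) auto
qed

interpretation lebesgue: sigma_finite_measure "lebesgue :: 'a::euclidean_space measure"
  by (rule sigma_finite_lebesgue)

interpretation lebesgue_pair: pair_sigma_finite "lebesgue :: 'a::euclidean_space measure" "lebesgue :: 'b::euclidean_space measure"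
  by standard

lemma lebesgue_fst_borel [measurable]: "fst \<in> borel_measurable ((lebesgue :: real measure) \<Otimes>\<^sub>M M)"
  using measurable_compose[OF measurable_fst borel_measurable_lebesgue_ident] by (simp add: comp_def cong: measurable_cong)

lemma lebesgue_snd_borel [measurable]: "snd \<in> borel_measurable (M \<Otimes>\<^sub>M (lebesgue :: real measure))"
  using measurable_compose[OF measurable_snd borel_measurable_lebesgue_ident] by (simp add: comp_def cong: measurable_cong)

lemma (in pair_sigma_finite) integrable_product_kernel:
  fixes f g :: "_ \<Rightarrow> complex"
  assumes f: "integrable M1 f" and g: "integrable M2 g"
    and u [measurable]: "u \<in> borel_measurable (M1 \<Otimes>\<^sub>M M2)" and B: "\<And>z. norm (u z) \<le> B"
  shows "integrable (M1 \<Otimes>\<^sub>M M2) (\<lambda>(x, y). f x * g y * u (x, y))"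
proof (rule Bochner_Integration.integrable_bound)
  have [measurable]: "f \<in> borel_measurable M1" "g \<in> borel_measurable M2" using f g by auto
  show "integrable (M1 \<Otimes>\<^sub>M M2) (\<lambda>(x, y). norm (f x) * norm (g y) * B)"
  proof (rule Fubini_integrable)
    show "integrable M1 (\<lambda>x. \<integral> y. norm (case (x, y) of (x, y) \<Rightarrow> norm (f x) * norm (g y) * B) \<partial>M2)"
      using f by (simp add: abs_mult mult.assoc)
    show "AE x in M1. integrable M2 (\<lambda>y. case (x, y) of (x, y) \<Rightarrow> norm (f x) * norm (g y) * B)"
      using g by (simp add: mult.assoc)
  qed measurable
  show "(\<lambda>(x, y). f x * g y * u (x, y)) \<in> borel_measurable (M1 \<Otimes>\<^sub>M M2)" by measurable
  have "norm (f x * g y * u (x, y)) \<le> norm (norm (f x) * norm (g y) * B)" for x y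
  proof -
    have "norm (f x * g y * u (x, y)) \<le> norm (f x) * norm (g y) * B"
      unfolding norm_mult by (intro mult_left_mono B) auto
    then show ?thesis by simp
  qed
  then show "AE z in M1 \<Otimes>\<^sub>M M2. norm (case z of (x, y) \<Rightarrow> f x * g y * u (x, y)) \<le> norm (case z of (x, y) \<Rightarrow> norm (f x) * norm (g y) * B)"
    by (intro AE_I2) auto
qed

lemma (in pair_sigma_finite) Fubini_product_kernel:
  fixes f g :: "_ \<Rightarrow> complex"
  assumes "integrable M1 f" "integrable M2 g"
    and "case_prod u \<in> borel_measurable (M1 \<Otimes>\<^sub>M M2)" and "\<And>x y. norm (u x y) \<le> B"
  shows "(\<integral>x. f x * (\<integral>y. g y * u x y \<partial>M2) \<partial>M1) = (\<integral>y. g y * (\<integral>x. f x * u x y \<partial>M1) \<partial>M2)"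
proof -
  have "integrable (M1 \<Otimes>\<^sub>M M2) (\<lambda>(x, y). f x * g y * (case_prod u) (x, y))"
    by (rule integrable_product_kernel[OF assms(1-3)]) (use assms(4) in auto)
  then have *: "integrable (M1 \<Otimes>\<^sub>M M2) (\<lambda>(x, y). f x * g y * u x y)" by simp
  have "(\<integral>x. (\<integral>y. f x * g y * u x y \<partial>M2) \<partial>M1) = (\<integral>y. (\<integral>x. f x * g y * u x y \<partial>M1) \<partial>M2)"
    by (rule Fubini_integral[OF *, symmetric])
  moreover have "(\<integral>y. f x * g y * u x y \<partial>M2) = f x * (\<integral>y. g y * u x y \<partial>M2)" for x
    unfolding mult.assoc by simp
  moreover have "(\<integral>x. f x * g y * u x y \<partial>M1) = g y * (\<integral>x. f x * u x y \<partial>M1)" for y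
    unfolding mult.assoc mult.left_commute[of "f _"] by simp
  ultimately show ?thesis by simp
qed

lemma fourier_measurable [measurable]:
  assumes [measurable]: "f \<in> borel_measurable lebesgue"
  shows "fourier f \<in> borel_measurable lebesgue"
proof -
  have "(\<lambda>\<xi>. LINT t|lebesgue. f t * phase (- (t * \<xi>))) \<in> borel_measurable lebesgue"
    by (rule lebesgue.borel_measurable_lebesgue_integral) measurable
  then show ?thesis by (simp add: fourier_eq_phase[abs_def])
qed

lemma norm_fourier_le: "norm (fourier f \<xi>) \<le> (LINT t|lebesgue. norm (f t))"
  unfolding fourier_eq_phase by (rule order_trans[OF integral_norm_bound]) (simp add: norm_mult)

lemma integrable_mult_phase:
  assumes "integrable lebesgue f"
  shows "integrable lebesgue (\<lambda>t. f t * phase (a * t))"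
proof (rule Bochner_Integration.integrable_bound[OF assms])
  have [measurable]: "f \<in> borel_measurable lebesgue" using assms by auto
  show "(\<lambda>t. f t * phase (a * t)) \<in> borel_measurable lebesgue" by measurable
qed (auto simp: norm_mult)

lemma fourier_add_cmult:
  assumes f: "integrable lebesgue f" and g: "integrable lebesgue g"
  shows "fourier (\<lambda>t. f t + c * g t) \<xi> = fourier f \<xi> + c * fourier g \<xi>"
proof -
  have "fourier (\<lambda>t. f t + c * g t) \<xi>
      = (LINT t|lebesgue. f t * phase (- \<xi> * t) + c * (g t * phase (- \<xi> * t)))"
    by (simp add: fourier_eq_phase algebra_simps)
  also have "\<dots> = (LINT t|lebesgue. f t * phase (- \<xi> * t)) + c * (LINT t|lebesgue. g t * phase (- \<xi> * t))"
    using integrable_mult_phase[OF f, of "- \<xi>"] integrable_mult_phase[OF g, of "- \<xi>"]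
    by (subst Bochner_Integration.integral_add) auto
  finally show ?thesis by (simp add: fourier_eq_phase mult.commute)
qed

section \<open>Gaussian means of the energy of the transform\<close>

abbreviation gaussian :: "real \<Rightarrow> real \<Rightarrow> real" where
  "gaussian \<sigma> \<xi> \<equiv> exp (- (2 * pi * \<sigma> * \<xi>)\<^sup>2 / 2)"

lemma gaussian_integrable:
  assumes "\<sigma> > 0"
  shows "integrable lebesgue (\<lambda>\<xi>. complex_of_real (gaussian \<sigma> \<xi>))"
proof -
  have "integrable lborel (\<lambda>x. sqrt (2 * pi) * std_normal_density x)" by simp
  then have "integrable lborel (\<lambda>x::real. exp (- x\<^sup>2 / 2))"
    by (simp add: std_normal_density_def)
  then have "integrable lebesgue (\<lambda>x::real. exp (- x\<^sup>2 / 2))"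
    by (subst integrable_completion) auto
  then have "integrable lebesgue (\<lambda>x. exp (- (0 + 2 * pi * \<sigma> * x)\<^sup>2 / 2))"
    using lebesgue_integrable_real_affine_iff[of "2 * pi * \<sigma>" "\<lambda>x. exp (- x\<^sup>2 / 2)" 0] assms by simp
  then show ?thesis by (intro integrable_of_real) simp
qed

text \<open>The characteristic function of the standard normal law at -(x/\<sigma>), after the
  substitution u = 2 pi \<sigma> \<xi>. The scaling in \<open>gaussian\<close> is chosen so that the
  transform is exactly the normal density of standard deviation \<sigma>, hence an approximate
  identity of mass 1 as \<sigma> tends to 0.\<close>

lemma fourier_gaussian:
  assumes "\<sigma> > 0"
  shows "fourier (\<lambda>\<xi>. complex_of_real (gaussian \<sigma> \<xi>)) x = of_real (normal_density 0 \<sigma> x)"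
proof -
  have "complex_of_real (exp (- ((- (x / \<sigma>))\<^sup>2) / 2)) = char std_normal_distribution (- (x / \<sigma>))"
    by (simp only: char_std_normal_distribution)
  also have "\<dots> = (LINT u|lborel. std_normal_density u *\<^sub>R iexp (- (x / \<sigma>) * u))"
    unfolding char_def by (subst integral_density) auto
  also have "\<dots> = (LINT u|lebesgue. std_normal_density u *\<^sub>R iexp (- (x / \<sigma>) * u))"
    by (subst integral_completion) auto
  also have "\<dots> = (2 * pi * \<sigma>) *\<^sub>R (LINT \<xi>|lebesgue. std_normal_density (2 * pi * \<sigma> * \<xi>) *\<^sub>R iexp (- (x / \<sigma>) * (2 * pi * \<sigma> * \<xi>)))"
    using assms by (subst lebesgue_integral_real_affine[of "2 * pi * \<sigma>" _ 0]) simp_all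
  also have "(LINT \<xi>|lebesgue. std_normal_density (2 * pi * \<sigma> * \<xi>) *\<^sub>R iexp (- (x / \<sigma>) * (2 * pi * \<sigma> * \<xi>)))
     = (LINT \<xi>|lebesgue. complex_of_real (1 / sqrt (2 * pi)) * (complex_of_real (gaussian \<sigma> \<xi>) * phase (- (\<xi> * x))))"
    using assms by (intro Bochner_Integration.integral_cong)
      (simp_all add: std_normal_density_def phase_def cis_conv_exp scaleR_conv_of_real mult_ac)
  also have "\<dots> = complex_of_real (1 / sqrt (2 * pi)) * fourier (\<lambda>\<xi>. complex_of_real (gaussian \<sigma> \<xi>)) x"
    unfolding fourier_eq_phase by (rule integral_mult_right_zero)
  finally have "complex_of_real (exp (- ((- (x / \<sigma>))\<^sup>2) / 2)) =
    complex_of_real (2 * pi * \<sigma> / sqrt (2 * pi)) * fourier (\<lambda>\<xi>. complex_of_real (gaussian \<sigma> \<xi>)) x"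
    by (simp add: scaleR_conv_of_real)
  moreover have "2 * pi * \<sigma> / sqrt (2 * pi) = sqrt (2 * pi) * \<sigma>"
    by (simp add: field_simps)
  moreover have "exp (- ((- (x / \<sigma>))\<^sup>2) / 2) = sqrt (2 * pi) * \<sigma> * normal_density 0 \<sigma> x"
    using assms by (simp add: normal_density_def real_sqrt_mult power_divide field_simps)
  ultimately have "complex_of_real (sqrt (2 * pi) * \<sigma>) * of_real (normal_density 0 \<sigma> x)
     = complex_of_real (sqrt (2 * pi) * \<sigma>) * fourier (\<lambda>\<xi>. complex_of_real (gaussian \<sigma> \<xi>)) x"
    by (simp only: of_real_mult)
  then show ?thesis using assms by (simp del: of_real_mult)
qed

lemma integrable_mult_fourier:
  assumes f: "integrable lebesgue f" and g: "integrable lebesgue g"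
  shows "integrable lebesgue (\<lambda>\<xi>. g \<xi> * fourier f \<xi>)"
proof (rule Bochner_Integration.integrable_bound)
  have [measurable]: "f \<in> borel_measurable lebesgue" "g \<in> borel_measurable lebesgue" using f g by auto
  show "integrable lebesgue (\<lambda>\<xi>. (LINT t|lebesgue. norm (f t)) * norm (g \<xi>))"
    using g by simp
  show "(\<lambda>\<xi>. g \<xi> * fourier f \<xi>) \<in> borel_measurable lebesgue" by measurable
  show "AE x in lebesgue. norm (g x * fourier f x) \<le> norm ((LINT t|lebesgue. norm (f t)) * norm (g x))"
  proof (intro AE_I2)
    fix x
    have "norm (g x) * norm (fourier f x) \<le> norm (g x) * (LINT t|lebesgue. norm (f t))"
      by (intro mult_left_mono norm_fourier_le) auto
    then show "norm (g x * fourier f x) \<le> norm ((LINT t|lebesgue. norm (f t)) * norm (g x))"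
      by (simp add: norm_mult mult.commute)
  qed
qed

lemma fourier_cnj: "cnj (fourier f \<xi>) = (LINT t|lebesgue. cnj (f t) * phase (\<xi> * t))"
  unfolding fourier_eq_phase Bochner_Integration.integral_cnj[symmetric] by (simp add: cnj_phase mult.commute)

text \<open>For integrable f the transform is merely bounded, so its squared modulus need not be
  integrable a priori. The Gaussian factor makes the frequency integral absolutely convergent;
  expanding first \<open>fourier f\<close> and then its conjugate, with one use of Fubini for each,
  leaves the transform of the Gaussian at x - y.\<close>

lemma fourier_gaussian_mean:
  assumes f: "integrable lebesgue f" and \<sigma>: "\<sigma> > 0"
  shows "(LINT \<xi>|lebesgue. complex_of_real (gaussian \<sigma> \<xi>) * (fourier f \<xi> * cnj (fourier f \<xi>)))
    = (LINT x|lebesgue. f x * (LINT y|lebesgue. cnj (f y) * of_real (normal_density 0 \<sigma> (x - y))))"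
proof -
  define G where "G \<xi> = complex_of_real (gaussian \<sigma> \<xi>)" for \<xi>
  have G: "integrable lebesgue G" unfolding G_def by (rule gaussian_integrable[OF \<sigma>])
  have cnj_G: "cnj (G \<xi>) = G \<xi>" for \<xi> by (simp add: G_def)
  have fc: "integrable lebesgue (\<lambda>y. cnj (f y))" using f by simp
  have Gf: "integrable lebesgue (\<lambda>\<xi>. G \<xi> * cnj (fourier f \<xi>))"
    using integrable_mult_fourier[OF f G] complex_integrable_cnj[of lebesgue "\<lambda>\<xi>. G \<xi> * fourier f \<xi>"]
    by (simp add: cnj_G)
  have inner: "(LINT \<xi>|lebesgue. G \<xi> * cnj (fourier f \<xi>) * phase (- (x * \<xi>)))
     = (LINT y|lebesgue. cnj (f y) * of_real (normal_density 0 \<sigma> (x - y)))" for x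
  proof -
    have "(LINT \<xi>|lebesgue. G \<xi> * cnj (fourier f \<xi>) * phase (- (x * \<xi>)))
       = (LINT \<xi>|lebesgue. (G \<xi> * phase ((- x) * \<xi>)) * (LINT y|lebesgue. cnj (f y) * phase (\<xi> * y)))"
      by (simp add: fourier_cnj mult_ac)
    also have "\<dots> = (LINT y|lebesgue. cnj (f y) * (LINT \<xi>|lebesgue. (G \<xi> * phase ((- x) * \<xi>)) * phase (\<xi> * y)))"
      by (rule lebesgue_pair.Fubini_product_kernel[OF integrable_mult_phase[OF G] fc, where B = 1]) auto
    also have "(\<lambda>y. LINT \<xi>|lebesgue. (G \<xi> * phase ((- x) * \<xi>)) * phase (\<xi> * y)) = (\<lambda>y. fourier G (x - y))"
      unfolding fourier_eq_phase by (simp add: mult.assoc phase_add[symmetric] algebra_simps)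
    finally show ?thesis unfolding G_def by (simp only: fourier_gaussian[OF \<sigma>])
  qed
  have "(LINT \<xi>|lebesgue. G \<xi> * (fourier f \<xi> * cnj (fourier f \<xi>)))
      = (LINT \<xi>|lebesgue. (G \<xi> * cnj (fourier f \<xi>)) * (LINT x|lebesgue. f x * phase (- (x * \<xi>))))"
    by (simp add: fourier_eq_phase[of f] mult_ac)
  also have "\<dots> = (LINT x|lebesgue. f x * (LINT \<xi>|lebesgue. (G \<xi> * cnj (fourier f \<xi>)) * phase (- (x * \<xi>))))"
    by (rule lebesgue_pair.Fubini_product_kernel[OF Gf f, where B = 1]) auto
  finally show ?thesis unfolding inner unfolding G_def .
qed

lemma nn_integral_normal_density_lebesgue:
  assumes \<sigma>: "\<sigma> > 0"
  shows "(\<integral>\<^sub>\<lambda>y. ennreal (normal_density 0 \<sigma> (x - y))) = 1"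
    "(\<integral>\<^sub>\<lambda>y. ennreal (normal_density 0 \<sigma> (y - x))) = 1"
proof -
  have 1: "(\<integral>\<^sub>\<lambda>y. ennreal (normal_density 0 \<sigma> y)) = 1"
    by (simp add: nn_integral_completion nn_integral_eq_integral[OF integrable_normal_density[OF \<sigma>]] integral_normal_density[OF \<sigma>])
  show "(\<integral>\<^sub>\<lambda>y. ennreal (normal_density 0 \<sigma> (x - y))) = 1"
    using nn_integral_real_affine_lebesgue[of "\<lambda>y. ennreal (normal_density 0 \<sigma> y)" "-1" x] 1 by simp
  show "(\<integral>\<^sub>\<lambda>y. ennreal (normal_density 0 \<sigma> (y - x))) = 1"
    using nn_integral_real_affine_lebesgue[of "\<lambda>y. ennreal (normal_density 0 \<sigma> y)" "1" "-x"] 1 by simp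
qed

lemma fourier_gaussian_mean_nonneg:
  assumes f: "integrable lebesgue f" and \<sigma>: "\<sigma> > 0"
  shows "integrable lebesgue (\<lambda>\<xi>. gaussian \<sigma> \<xi> * (norm (fourier f \<xi>))\<^sup>2)"
    "complex_of_real (LINT \<xi>|lebesgue. gaussian \<sigma> \<xi> * (norm (fourier f \<xi>))\<^sup>2)
     = (LINT x|lebesgue. f x * (LINT y|lebesgue. cnj (f y) * of_real (normal_density 0 \<sigma> (x - y))))"
proof -
  have "integrable lebesgue (\<lambda>\<xi>. complex_of_real (gaussian \<sigma> \<xi>) * fourier f \<xi>)"
    by (rule integrable_mult_fourier[OF f gaussian_integrable[OF \<sigma>]])
  from integrable_mult_fourier[OF f complex_integrable_cnj[THEN iffD2, OF this]]
  have "integrable lebesgue (\<lambda>\<xi>. complex_of_real (gaussian \<sigma> \<xi>) * (fourier f \<xi> * cnj (fourier f \<xi>)))"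
    by (simp add: mult_ac)
  then have *: "integrable lebesgue (\<lambda>\<xi>. complex_of_real (gaussian \<sigma> \<xi> * (norm (fourier f \<xi>))\<^sup>2))"
    by (simp add: complex_norm_square[symmetric] del: of_real_power add: of_real_mult)
  then show "integrable lebesgue (\<lambda>\<xi>. gaussian \<sigma> \<xi> * (norm (fourier f \<xi>))\<^sup>2)"
    by (simp only: complex_of_real_integrable_eq)
  show "complex_of_real (LINT \<xi>|lebesgue. gaussian \<sigma> \<xi> * (norm (fourier f \<xi>))\<^sup>2)
     = (LINT x|lebesgue. f x * (LINT y|lebesgue. cnj (f y) * of_real (normal_density 0 \<sigma> (x - y))))"
    unfolding fourier_gaussian_mean[OF f \<sigma>, symmetric] complex_norm_square[symmetric] of_real_mult[symmetric]
    by (rule integral_complex_of_real[symmetric])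
qed

text \<open>Schur's test for the Gaussian convolution kernel.\<close>

lemma fourier_gaussian_mean_le:
  assumes f1: "integrable lebesgue f" and f2: "f \<in> L2_space" and \<sigma>: "\<sigma> > 0"
  shows "(LINT \<xi>|lebesgue. gaussian \<sigma> \<xi> * (norm (fourier f \<xi>))\<^sup>2) \<le> (L2_norm f)\<^sup>2"
proof -
  have [measurable]: "f \<in> borel_measurable lebesgue" using f1 by auto
  let ?N = "\<lambda>x y. normal_density 0 \<sigma> (x - y)"
  have nN: "norm (complex_of_real (?N x y)) = ?N x y" for x y by simp
  have half: "(\<integral>\<^sub>\<lambda>x. \<integral>\<^sub>\<lambda>y. enorm2 (f x) * ennreal (?N x y)) = ennreal ((L2_norm f)\<^sup>2)"
    unfolding ennreal_L2_norm_power2[OF f2]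
    by (subst nn_integral_cmult) (auto simp: nn_integral_normal_density_lebesgue[OF \<sigma>])
  have "(\<integral>\<^sub>\<lambda>x. \<integral>\<^sub>\<lambda>y. enorm2 (f y) * ennreal (?N x y))
      = (\<integral>\<^sub>\<lambda>y. \<integral>\<^sub>\<lambda>x. enorm2 (f y) * ennreal (?N x y))"
    by (rule lebesgue_pair.Fubini') measurable
  also have "\<dots> = ennreal ((L2_norm f)\<^sup>2)"
    unfolding ennreal_L2_norm_power2[OF f2]
    by (subst nn_integral_cmult) (auto simp: nn_integral_normal_density_lebesgue[OF \<sigma>])
  finally have half': "(\<integral>\<^sub>\<lambda>x. \<integral>\<^sub>\<lambda>y. enorm2 (f y) * ennreal (?N x y)) = ennreal ((L2_norm f)\<^sup>2)" .
  let ?I = "LINT \<xi>|lebesgue. gaussian \<sigma> \<xi> * (norm (fourier f \<xi>))\<^sup>2"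
  have "ennreal ?I \<le> enorm (complex_of_real ?I)" by (intro ennreal_leI) simp
  also have "\<dots> \<le> (\<integral>\<^sub>\<lambda>x. norm (f x * (LINT y|lebesgue. cnj (f y) * of_real (?N x y))))"
    unfolding fourier_gaussian_mean_nonneg(2)[OF f1 \<sigma>]
    by (cases "integrable lebesgue (\<lambda>x. f x * (LINT y|lebesgue. cnj (f y) * of_real (?N x y)))")
       (auto intro: integral_norm_bound_ennreal simp: not_integrable_integral_eq)
  also have "\<dots> \<le> (\<integral>\<^sub>\<lambda>x. \<integral>\<^sub>\<lambda>y. enorm (f x) * ennreal (norm (f y) * ?N x y))"
  proof (intro nn_integral_mono)
    fix x
    have "enorm (LINT y|lebesgue. cnj (f y) * of_real (?N x y)) \<le> (\<integral>\<^sub>\<lambda>y. ennreal (norm (f y) * ?N x y))"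
      using integral_norm_bound_ennreal[of lebesgue "\<lambda>y. cnj (f y) * of_real (?N x y)"]
      by (cases "integrable lebesgue (\<lambda>y. cnj (f y) * of_real (?N x y))")
         (auto simp: not_integrable_integral_eq norm_mult nN)
    then have "enorm (f x) * enorm (LINT y|lebesgue. cnj (f y) * of_real (?N x y))
        \<le> enorm (f x) * (\<integral>\<^sub>\<lambda>y. ennreal (norm (f y) * ?N x y))"
      by (rule mult_left_mono) simp
    also have "\<dots> = (\<integral>\<^sub>\<lambda>y. enorm (f x) * ennreal (norm (f y) * ?N x y))"
      by (rule nn_integral_cmult[symmetric]) measurable
    finally show "enorm (f x * (LINT y|lebesgue. cnj (f y) * of_real (?N x y)))
       \<le> (\<integral>\<^sub>\<lambda>y. enorm (f x) * ennreal (norm (f y) * ?N x y))"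
      by (simp add: norm_mult ennreal_mult)
  qed
  also have "\<dots> \<le> (\<integral>\<^sub>\<lambda>x. \<integral>\<^sub>\<lambda>y. ennreal (1/2) * (enorm2 (f x) * ennreal (?N x y) + enorm2 (f y) * ennreal (?N x y)))"
  proof (intro nn_integral_mono)
    fix x y
    have "a * b \<le> 1/2 * (a\<^sup>2 + b\<^sup>2)" for a b :: real
      using zero_le_power2[of "a - b"] by (simp add: power2_eq_square algebra_simps)
    from mult_right_mono[OF this[of "norm (f x)" "norm (f y)"] normal_density_nonneg[of 0 \<sigma> "x - y"]]
    have "norm (f x) * (norm (f y) * ?N x y) \<le> 1/2 * ((norm (f x))\<^sup>2 * ?N x y + (norm (f y))\<^sup>2 * ?N x y)"
      by (simp add: algebra_simps)
    then have "ennreal (norm (f x) * (norm (f y) * ?N x y))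
       \<le> ennreal (1/2 * ((norm (f x))\<^sup>2 * ?N x y + (norm (f y))\<^sup>2 * ?N x y))"
      by (rule ennreal_leI)
    also have "\<dots> = ennreal (1/2) * (enorm2 (f x) * ennreal (?N x y) + enorm2 (f y) * ennreal (?N x y))"
      by (subst ennreal_mult, simp, simp, subst ennreal_plus, simp, simp, subst (1 2) ennreal_mult, simp_all)
    finally show "enorm (f x) * ennreal (norm (f y) * ?N x y)
       \<le> ennreal (1/2) * (enorm2 (f x) * ennreal (?N x y) + enorm2 (f y) * ennreal (?N x y))"
      by (simp only: ennreal_mult[OF norm_ge_zero mult_nonneg_nonneg[OF norm_ge_zero normal_density_nonneg]])
  qed
  also have "\<dots> = (\<integral>\<^sub>\<lambda>x. ennreal (1/2) * ((\<integral>\<^sub>\<lambda>y. enorm2 (f x) * ennreal (?N x y)) + (\<integral>\<^sub>\<lambda>y. enorm2 (f y) * ennreal (?N x y))))"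
    by (intro nn_integral_cong, subst nn_integral_cmult, measurable, subst nn_integral_add) measurable
  also have "\<dots> = ennreal (1/2) * (ennreal ((L2_norm f)\<^sup>2) + ennreal ((L2_norm f)\<^sup>2))"
    by (subst nn_integral_cmult, measurable, subst nn_integral_add, measurable) (simp only: half half')
  also have "\<dots> = ennreal ((L2_norm f)\<^sup>2)"
  proof -
    have "ennreal ((L2_norm f)\<^sup>2) = ennreal (1/2 * ((L2_norm f)\<^sup>2 + (L2_norm f)\<^sup>2))" by simp
    also have "\<dots> = ennreal (1/2) * (ennreal ((L2_norm f)\<^sup>2) + ennreal ((L2_norm f)\<^sup>2))"
      by (subst ennreal_mult, simp, simp, subst ennreal_plus) simp_all
    finally show ?thesis by (rule sym)
  qed
  finally show ?thesis by (simp add: ennreal_le_iff)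
qed

text \<open>Multiplying \<open>fourier f\<close> by the square root of the Gaussian makes the
  Gaussian mean a squared norm. These products converge pointwise to \<open>fourier f\<close> as
  \<sigma> tends to 0, and Fatou's lemma carries membership and the bound to the limit.\<close>

lemma fourier_L2_contraction:
  assumes f1: "integrable lebesgue f" and f2: "f \<in> L2_space"
  shows "fourier f \<in> L2_space" "L2_norm (fourier f) \<le> L2_norm f"
proof -
  have [measurable]: "f \<in> borel_measurable lebesgue" using f1 by auto
  define \<sigma> where "\<sigma> n = 1 / real (Suc n)" for n
  have \<sigma>: "\<sigma> n > 0" for n by (simp add: \<sigma>_def)
  have \<sigma>0: "\<sigma> \<longlonglongrightarrow> 0" unfolding \<sigma>_def by (rule LIMSEQ_Suc[OF lim_1_over_n])
  define g where "g n \<xi> = complex_of_real (sqrt (gaussian (\<sigma> n) \<xi>)) * fourier f \<xi>" for n \<xi>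
  have [measurable]: "g n \<in> borel_measurable lebesgue" for n unfolding g_def by measurable
  have eq: "(norm (g n \<xi>))\<^sup>2 = gaussian (\<sigma> n) \<xi> * (norm (fourier f \<xi>))\<^sup>2" for n \<xi>
    by (simp add: g_def norm_mult power_mult_distrib)
  have g: "g n \<in> L2_space" for n
    using fourier_gaussian_mean_nonneg(1)[OF f1 \<sigma>] by (simp add: L2_space_def eq)
  have bd: "L2_norm (g n) \<le> L2_norm f" for n
    using fourier_gaussian_mean_le[OF f1 f2 \<sigma>, of n] unfolding eq[symmetric] L2_norm_power2[of "g n", symmetric]
    by (rule power2_le_imp_le) simp
  have lim: "(\<lambda>n. g n \<xi>) \<longlonglongrightarrow> fourier f \<xi>" for \<xi>
  proof -
    have "(\<lambda>n. g n \<xi>) \<longlonglongrightarrow> complex_of_real (sqrt (exp (- (2 * pi * 0 * \<xi>)\<^sup>2 / 2))) * fourier f \<xi>"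
      unfolding g_def by (intro tendsto_intros \<sigma>0) simp
    then show ?thesis by simp
  qed
  show "fourier f \<in> L2_space" "L2_norm (fourier f) \<le> L2_norm f"
    by (rule L2_Fatou[OF g AE_I2[OF lim] always_eventually], use bd in auto)+
qed

text \<open>After the contraction only \<open>L2_norm h \<le> L2_norm (fourier h)\<close> is
  missing. Gaussian means never exceed the energy of the transform, and they converge to the energy
  of h: continuity gives pointwise convergence of the smoothed function, boundedness and bounded
  support give the dominating functions.\<close>

lemma plancherel_continuous:
  assumes cont: "continuous_on UNIV h" and h2: "h \<in> L2_space" and M: "\<And>t. norm (h t) \<le> M"
    and R: "\<And>t. R < \<bar>t\<bar> \<Longrightarrow> h t = 0"
  shows "integrable lebesgue h" "L2_norm (fourier h) = L2_norm h"
proof -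
  have bm [measurable]: "h \<in> borel_measurable borel" using cont by (rule borel_measurable_continuous_onI)
  show h1: "integrable lebesgue h"
  proof (rule Bochner_Integration.integrable_bound)
    show "integrable lebesgue (\<lambda>t. M * (indicator {-R..R} t :: real))" by (simp add: integrable_indicator_Icc)
    have "norm (h x) \<le> norm (M * (indicator {-R..R} x :: real))" for x
      using M[of x] R[of x] by (cases "R < \<bar>x\<bar>") (auto simp: indicator_def)
    then show "AE x in lebesgue. norm (h x) \<le> norm (M * (indicator {-R..R} x :: real))" by simp
  qed measurable
  define \<sigma> where "\<sigma> n = 1 / real (Suc n)" for n
  have \<sigma>: "\<sigma> n > 0" for n by (simp add: \<sigma>_def)
  have \<sigma>0: "\<sigma> \<longlonglongrightarrow> 0" unfolding \<sigma>_def by (rule LIMSEQ_Suc[OF lim_1_over_n])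
  \<comment> \<open>The convolution with the normal density after the substitution y = x - \<sigma>
    u: the density no longer varies with n, so dominated convergence applies in u.\<close>
  define Q where "Q n x = (LINT u|lebesgue. cnj (h (x - \<sigma> n * u)) * of_real (std_normal_density u))" for n x
  have Q_eq: "(LINT y|lebesgue. cnj (h y) * of_real (normal_density 0 (\<sigma> n) (x - y))) = Q n x" for n x
  proof -
    have *: "normal_density 0 (\<sigma> n) (\<sigma> n * u) = std_normal_density u / \<sigma> n" for u
      using \<sigma>[of n] by (simp add: normal_density_def std_normal_density_def real_sqrt_mult power_mult_distrib field_simps)
    have "(LINT y|lebesgue. cnj (h y) * of_real (normal_density 0 (\<sigma> n) (x - y)))
       = \<bar>- \<sigma> n\<bar> *\<^sub>R (LINT u|lebesgue. cnj (h (x + (- \<sigma> n) * u)) * of_real (normal_density 0 (\<sigma> n) (x - (x + (- \<sigma> n) * u))))"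
      using \<sigma>[of n] by (intro lebesgue_integral_real_affine) auto
    also have "\<dots> = (LINT u|lebesgue. of_real (\<sigma> n) * (cnj (h (x - \<sigma> n * u)) * of_real (std_normal_density u / \<sigma> n)))"
      using \<sigma>[of n] by (simp add: scaleR_conv_of_real *)
    also have "\<dots> = Q n x"
      unfolding Q_def using \<sigma>[of n] by (intro Bochner_Integration.integral_cong) auto
    finally show ?thesis .
  qed
  have std: "integrable lebesgue std_normal_density"
    by (subst integrable_completion) auto
  have std1: "(LINT u|lebesgue. std_normal_density u) = 1"
    by (subst integral_completion) auto
  have M0: "0 \<le> M" using M[of 0] norm_ge_zero order_trans by blast
  have Qbd: "norm (Q n x) \<le> M" for n x
  proof -
    have "norm (Q n x) \<le> (LINT u|lebesgue. norm (cnj (h (x - \<sigma> n * u)) * of_real (std_normal_density u)))"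
      unfolding Q_def by (rule integral_norm_bound)
    also have "\<dots> \<le> (LINT u|lebesgue. M * std_normal_density u)"
      by (rule Bochner_Integration.integral_mono')
         (use std M M0 in \<open>auto simp: norm_mult intro!: mult_right_mono mult_nonneg_nonneg\<close>)
    finally show ?thesis using std1 by simp
  qed
  have Qlim: "(\<lambda>n. Q n x) \<longlonglongrightarrow> cnj (h x)" for x
  proof -
    have "(\<lambda>n. Q n x) \<longlonglongrightarrow> (LINT u|lebesgue. cnj (h x) * of_real (std_normal_density u))"
      unfolding Q_def
    proof (rule integral_dominated_convergence[where w = "\<lambda>u. M * std_normal_density u"])
      show "AE u in lebesgue. (\<lambda>n. cnj (h (x - \<sigma> n * u)) * of_real (std_normal_density u)) \<longlonglongrightarrow> cnj (h x) * of_real (std_normal_density u)"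
      proof (intro AE_I2)
        fix u
        have "(\<lambda>n. x - \<sigma> n * u) \<longlonglongrightarrow> x - 0 * u" by (intro tendsto_intros \<sigma>0)
        moreover have "isCont h x" using cont by (simp add: continuous_on_eq_continuous_at)
        ultimately have "(\<lambda>n. h (x - \<sigma> n * u)) \<longlonglongrightarrow> h x" using isCont_tendsto_compose[of x h] by simp
        then show "(\<lambda>n. cnj (h (x - \<sigma> n * u)) * of_real (std_normal_density u)) \<longlonglongrightarrow> cnj (h x) * of_real (std_normal_density u)"
          by (intro tendsto_intros)
      qed
      show "integrable lebesgue (\<lambda>u. M * std_normal_density u)" using std by simp
    qed (use M in \<open>auto simp: norm_mult intro!: mult_right_mono\<close>)
    then show ?thesis using std1 by simp
  qed
  let ?J = "\<lambda>n. LINT \<xi>|lebesgue. gaussian (\<sigma> n) \<xi> * (norm (fourier h \<xi>))\<^sup>2"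
  have J: "complex_of_real (?J n) = (LINT x|lebesgue. h x * Q n x)" for n
    using fourier_gaussian_mean_nonneg(2)[OF h1 \<sigma>, of n] unfolding Q_eq .
  have Qm [measurable]: "Q n \<in> borel_measurable lebesgue" for n
  proof -
    have "(\<lambda>x. LINT u|lebesgue. cnj (h (x - \<sigma> n * u)) * of_real (std_normal_density u)) \<in> borel_measurable lebesgue"
      by (rule lebesgue.borel_measurable_lebesgue_integral) measurable
    then show ?thesis by (simp add: Q_def[abs_def])
  qed
  have "(\<lambda>n. LINT x|lebesgue. h x * Q n x) \<longlonglongrightarrow> (LINT x|lebesgue. h x * cnj (h x))"
  proof (rule integral_dominated_convergence[where w = "\<lambda>x. norm (h x) * M"])
    show "AE x in lebesgue. (\<lambda>n. h x * Q n x) \<longlonglongrightarrow> h x * cnj (h x)"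
      using Qlim by (intro AE_I2 tendsto_intros)
    show "integrable lebesgue (\<lambda>x. norm (h x) * M)" using h1 by simp
    show "AE x in lebesgue. norm (h x * Q n x) \<le> norm (h x) * M" for n
      using Qbd by (auto simp: norm_mult intro!: mult_left_mono)
  qed measurable
  also have "(LINT x|lebesgue. h x * cnj (h x)) = complex_of_real ((L2_norm h)\<^sup>2)"
    unfolding complex_norm_square[symmetric] L2_norm_power2 by (rule integral_complex_of_real)
  finally have "(\<lambda>n. complex_of_real (?J n)) \<longlonglongrightarrow> complex_of_real ((L2_norm h)\<^sup>2)" unfolding J .
  then have "?J \<longlonglongrightarrow> (L2_norm h)\<^sup>2" by (simp only: tendsto_of_real_iff)
  moreover have "?J n \<le> (L2_norm (fourier h))\<^sup>2" for n
    unfolding L2_norm_power2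
    by (rule integral_mono[OF fourier_gaussian_mean_nonneg(1)[OF h1 \<sigma>] L2_space_integrable[OF fourier_L2_contraction(1)[OF h1 h2]]])
       (auto intro!: mult_left_le_one_le)
  ultimately have "(L2_norm h)\<^sup>2 \<le> (L2_norm (fourier h))\<^sup>2"
    by (intro LIMSEQ_le_const2) auto
  then have "L2_norm h \<le> L2_norm (fourier h)" by (rule power2_le_imp_le) simp
  with fourier_L2_contraction(2)[OF h1 h2] show "L2_norm (fourier h) = L2_norm h" by simp
qed

text \<open>Approximation by continuous h of bounded support in the L2 norm alone suffices, because
  the contraction already controls the transform of h - f without any closeness in L1.\<close>

theorem plancherel:
  assumes f1: "integrable lebesgue f" and f2: "f \<in> L2_space"
  shows "L2_norm (fourier f) = L2_norm f"
proof -
  have "\<bar>L2_norm (fourier f) - L2_norm f\<bar> \<le> 2 * d" if d: "d > 0" for d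
  proof -
    obtain h M R where h: "continuous_on UNIV h" "h \<in> L2_space" "\<And>t. norm (h t) \<le> M" "\<And>t. R < \<bar>t\<bar> \<Longrightarrow> h t = 0"
      and hd: "L2_dist h f < d"
      using L2_dense_continuous[OF f2 d] by metis
    have h1: "integrable lebesgue h" and heq: "L2_norm (fourier h) = L2_norm h"
      by (rule plancherel_continuous[OF h(1,2), of M R]; use h in auto)+
    have diff: "fourier (\<lambda>t. h t - f t) = (\<lambda>\<xi>. fourier h \<xi> - fourier f \<xi>)"
      using fourier_add_cmult[OF h1 f1, of "-1"] by (simp add: fun_eq_iff)
    have "\<bar>L2_norm (fourier h) - L2_norm (fourier f)\<bar> \<le> L2_norm (fourier (\<lambda>t. h t - f t))"
      unfolding diff by (intro L2_norm_abs_diff fourier_L2_contraction h1 f1 h f2)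
    also have "\<dots> \<le> L2_dist h f"
      by (intro fourier_L2_contraction L2_space_diff h f2) (use h1 f1 in simp)
    finally have "\<bar>L2_norm h - L2_norm (fourier f)\<bar> < d" using hd heq by simp
    moreover have "\<bar>L2_norm h - L2_norm f\<bar> < d" using L2_norm_abs_diff[OF h(2) f2] hd by linarith
    ultimately show ?thesis by linarith
  qed
  then have "\<bar>L2_norm (fourier f) - L2_norm f\<bar> \<le> 0 + e" if "e > 0" for e
    using that by (metis field_sum_of_halves add_0 half_gt_zero mult_2)
  then have "\<bar>L2_norm (fourier f) - L2_norm f\<bar> \<le> 0" by (rule field_le_epsilon)
  then show ?thesis by simp
qed

section \<open>The Fourier transform on square-integrable functions\<close>

lemma has_fourier_L2_spaces:
  assumes "has_fourier_L2 f F"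
  shows "f \<in> L2_space" "F \<in> L2_space"
  using assms by (auto simp: has_fourier_L2_def L2_converges_def)

lemma has_fourier_L2_norm:
  assumes "has_fourier_L2 f F"
  shows "L2_norm F = L2_norm f"
proof -
  obtain s where s1: "\<And>k. s k \<in> L1_space" and sf: "L2_converges s f" and sF: "L2_converges (\<lambda>k. fourier (s k)) F"
    using assms by (auto simp: has_fourier_L2_def)
  have "L2_norm (fourier (s k)) = L2_norm (s k)" for k
    using s1[of k] sf by (intro plancherel) (auto simp: L1_space_def L2_converges_def)
  then show ?thesis
    using LIMSEQ_unique[OF L2_norm_tendsto[OF sF], of "L2_norm f"] L2_norm_tendsto[OF sf] by simp
qed

lemma has_fourier_L2_add_cmult:
  assumes f: "has_fourier_L2 f F" and g: "has_fourier_L2 g G"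
  shows "has_fourier_L2 (\<lambda>t. f t + c * g t) (\<lambda>\<xi>. F \<xi> + c * G \<xi>)"
proof -
  obtain s where s: "\<And>k. s k \<in> L1_space" "L2_converges s f" "L2_converges (\<lambda>k. fourier (s k)) F"
    using f by (auto simp: has_fourier_L2_def)
  obtain r where r: "\<And>k. r k \<in> L1_space" "L2_converges r g" "L2_converges (\<lambda>k. fourier (r k)) G"
    using g by (auto simp: has_fourier_L2_def)
  have "fourier (\<lambda>t. s k t + c * r k t) = (\<lambda>\<xi>. fourier (s k) \<xi> + c * fourier (r k) \<xi>)" for k
    using s(1)[of k] r(1)[of k] by (intro ext fourier_add_cmult) (auto simp: L1_space_def)
  then show ?thesis
    unfolding has_fourier_L2_def
    using L2_converges_add_cmult[OF s(2) r(2), of c] L2_converges_add_cmult[OF s(3) r(3), of c] s(1) r(1)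
    by (intro exI[of _ "\<lambda>k t. s k t + c * r k t"]) (auto simp: L1_space_def)
qed

lemma L2_eq_AE_if_norm_diff_0:
  assumes "F \<in> L2_space" "G \<in> L2_space" "L2_dist F G = 0"
  shows "AE t in lebesgue. F t = G t"
  using assms L2_norm_eq_0_iff[OF L2_space_diff[OF assms(1,2)]] by simp

text \<open>The approximants are chosen at rate (1/4)^k so that, by Plancherel, consecutive
  transforms differ by at most (1/4)^(k+1) + (1/4)^k <= 2 (1/4)^k, which is the input of
  \<open>L2_complete_geometric\<close>.\<close>

lemma has_fourier_L2_exists:
  assumes f: "f \<in> L2_space"
  shows "\<exists>F. has_fourier_L2 f F"
proof -
  have "\<exists>h. integrable lebesgue h \<and> h \<in> L2_space \<and> L2_dist h f < (1/4)^k" for k :: nat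
  proof -
    have pos: "(1/4::real)^k > 0" by simp
    obtain h M R where h: "continuous_on UNIV h" "h \<in> L2_space" "\<And>t. norm (h t) \<le> M" "\<And>t. R < \<bar>t\<bar> \<Longrightarrow> h t = 0"
      and hd: "L2_dist h f < (1/4)^k"
      by (rule L2_dense_continuous[OF f pos]) blast
    have "integrable lebesgue h" by (rule plancherel_continuous[OF h(1,2), of M R]) (use h in auto)
    then show ?thesis using h(2) hd by blast
  qed
  then have "\<exists>s. \<forall>k. integrable lebesgue (s k) \<and> s k \<in> L2_space \<and> L2_dist (s k) f < (1/4)^k"
    by (intro choice allI)
  then obtain s where s: "\<And>k. integrable lebesgue (s k)" "\<And>k. s k \<in> L2_space"
      "\<And>k::nat. L2_dist (s k) f < (1/4)^k"
    by blast
  have sf: "L2_converges s f"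
  proof -
    have "(\<lambda>k. L2_dist (s k) f) \<longlonglongrightarrow> 0"
    proof (rule Lim_null_comparison)
      show "eventually (\<lambda>k. norm (L2_dist (s k) f) \<le> (1/4)^k) sequentially"
        using s(3) by (auto intro!: always_eventually less_imp_le)
      show "(\<lambda>k. (1/4::real)^k) \<longlonglongrightarrow> 0" by (rule LIMSEQ_power_zero) simp
    qed
    then show ?thesis using f s by (simp add: L2_converges_def)
  qed
  have F: "fourier (s k) \<in> L2_space" for k by (intro fourier_L2_contraction s)
  have "\<exists>G. L2_converges (\<lambda>k. fourier (s k)) G"
  proof (rule L2_complete_geometric[OF F])
    fix k
    have "(\<lambda>t. fourier (s (Suc k)) t - fourier (s k) t) = fourier (\<lambda>t. s (Suc k) t - s k t)"
      using fourier_add_cmult[OF s(1) s(1), of "Suc k" "-1" k] by (simp add: fun_eq_iff)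
    then have "L2_dist (fourier (s (Suc k))) (fourier (s k)) = L2_dist (s (Suc k)) (s k)"
      by (simp add: plancherel L2_space_diff s)
    also have "\<dots> \<le> L2_dist (s (Suc k)) f + L2_dist f (s k)"
      by (intro L2_norm_triangle_diff s f)
    also have "\<dots> \<le> (1/4)^Suc k + (1/4)^k"
      using s(3)[of "Suc k"] s(3)[of k] by (simp only: L2_norm_minus_commute[of f])
    also have "\<dots> \<le> 2 * (1/4)^k" by simp
    finally show "L2_dist (fourier (s (Suc k))) (fourier (s k)) \<le> 2 * (1/4)^k" .
  qed
  then show ?thesis using s(1) sf by (auto simp: has_fourier_L2_def L1_space_def)
qed

lemma has_fourier_fourier_L2: "f \<in> L2_space \<Longrightarrow> has_fourier_L2 f (fourier_L2 f)"
  unfolding fourier_L2_def by (rule someI_ex[OF has_fourier_L2_exists])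

section \<open>Inner products, reflection, inversion and translation\<close>

lemma L2_inner_eqI:
  assumes "f \<in> L2_space" "g \<in> L2_space" "F \<in> L2_space" "G \<in> L2_space"
    and "\<And>c. L2_norm (\<lambda>t. f t + c * g t) = L2_norm (\<lambda>t. F t + c * G t)"
  shows "L2_inner f g = L2_inner F G"
proof -
  have "4 * L2_inner f g = 4 * L2_inner F G"
    unfolding L2_inner_polarization[OF assms(1,2)] L2_inner_polarization[OF assms(3,4)] assms(5) ..
  then show ?thesis by simp
qed

lemma has_fourier_L2_inner:
  assumes "has_fourier_L2 f F" "has_fourier_L2 g G"
  shows "L2_inner f g = L2_inner F G"
  by (rule L2_inner_eqI) (use assms has_fourier_L2_spaces has_fourier_L2_norm[OF has_fourier_L2_add_cmult[OF assms]] in auto)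

lemma L2_inner_tendsto:
  assumes s: "L2_converges s f" and r: "L2_converges r g"
  shows "(\<lambda>k. L2_inner (s k) (r k)) \<longlonglongrightarrow> L2_inner f g"
proof -
  have mem: "f \<in> L2_space" "s k \<in> L2_space" "g \<in> L2_space" "r k \<in> L2_space" for k
    using s r by (auto simp: L2_converges_def)
  have "(\<lambda>k. 4 * L2_inner (s k) (r k)) \<longlonglongrightarrow> 4 * L2_inner f g"
    unfolding L2_inner_polarization[OF mem(2,4)] L2_inner_polarization[OF mem(1,3)]
    by (intro tendsto_add tendsto_diff tendsto_mult tendsto_const tendsto_of_real tendsto_power
        L2_norm_tendsto L2_converges_add_cmult s r)
  then have "(\<lambda>k. 1/4 * (4 * L2_inner (s k) (r k))) \<longlonglongrightarrow> 1/4 * (4 * L2_inner f g)"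
    by (rule tendsto_mult_left)
  then show ?thesis by simp
qed

text \<open>Translation is the case c = 1 and reflection the case c = -1. This explains the
  arguments written \<open>0 + (-1) * x\<close> and \<open>- x + 1 * t\<close> below.\<close>

lemma L2_affine:
  assumes f: "f \<in> L2_space" and c: "\<bar>c\<bar> = 1"
  shows "(\<lambda>x. f (t + c * x)) \<in> L2_space" "L2_norm (\<lambda>x. f (t + c * x)) = L2_norm f"
proof -
  have c0: "c \<noteq> 0" using c by auto
  have "(\<lambda>x. t + c * x) \<in> lebesgue \<rightarrow>\<^sub>M lebesgue"
    using lebesgue_affine_measurable[where c= "\<lambda>x::real. c"] c0 by simp
  then have "(\<lambda>x. f (t + c * x)) \<in> borel_measurable lebesgue"
    using f by (auto simp: L2_space_def intro: measurable_compose)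
  then show "(\<lambda>x. f (t + c * x)) \<in> L2_space"
    using lebesgue_integrable_real_affine_iff[OF c0, of "\<lambda>x. (norm (f x))\<^sup>2" t] L2_space_integrable[OF f]
    by (simp add: L2_space_def)
  show "L2_norm (\<lambda>x. f (t + c * x)) = L2_norm f"
    unfolding L2_norm_def using lebesgue_integral_real_affine[OF c0, of "\<lambda>x. (norm (f x))\<^sup>2" t] c by simp
qed

lemma L2_converges_affine:
  assumes s: "L2_converges s f" and c: "\<bar>c\<bar> = 1"
  shows "L2_converges (\<lambda>k x. s k (t + c * x)) (\<lambda>x. f (t + c * x))"
proof -
  have "L2_norm (\<lambda>x. s k (t + c * x) - f (t + c * x)) = L2_dist (s k) f" for k
    using s by (intro L2_affine(2)[of "\<lambda>x. s k x - f x"] L2_space_diff c) (auto simp: L2_converges_def)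
  then show ?thesis using s L2_affine(1)[OF _ c] by (simp add: L2_converges_def)
qed

text \<open>By Fubini the adjoint has the conjugate kernel, so it is the transform followed by a
  reflection. This is the candidate for the inverse; the limit version for
  \<open>has_fourier_L2\<close> feeds \<open>fourier_L2_inversion\<close>.\<close>

lemma fourier_adjoint:
  assumes f: "integrable lebesgue f" and g: "integrable lebesgue g"
  shows "L2_inner (fourier f) g = L2_inner f (\<lambda>x. fourier g (0 + (-1) * x))"
proof -
  have gc: "integrable lebesgue (\<lambda>\<xi>. cnj (g \<xi>))" using g by simp
  have "L2_inner (fourier f) g = (LINT \<xi>|lebesgue. cnj (g \<xi>) * (LINT t|lebesgue. f t * phase (- (t * \<xi>))))"
    by (simp add: L2_inner_def fourier_eq_phase mult.commute)
  also have "\<dots> = (LINT t|lebesgue. f t * (LINT \<xi>|lebesgue. cnj (g \<xi>) * phase (- (t * \<xi>))))"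
    by (rule lebesgue_pair.Fubini_product_kernel[OF gc f, where B = 1]) auto
  finally show ?thesis by (simp add: L2_inner_def fourier_cnj)
qed

lemma has_fourier_L2_adjoint:
  assumes f: "has_fourier_L2 f F" and g: "has_fourier_L2 g G"
  shows "L2_inner F g = L2_inner f (\<lambda>x. G (0 + (-1) * x))"
proof -
  obtain s where s: "\<And>k. s k \<in> L1_space" "L2_converges s f" "L2_converges (\<lambda>k. fourier (s k)) F"
    using f by (auto simp: has_fourier_L2_def)
  obtain r where r: "\<And>k. r k \<in> L1_space" "L2_converges r g" "L2_converges (\<lambda>k. fourier (r k)) G"
    using g by (auto simp: has_fourier_L2_def)
  have eq: "L2_inner (fourier (s k)) (r k) = L2_inner (s k) (\<lambda>x. fourier (r k) (0 + (-1) * x))" for k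
    using s(1)[of k] r(1)[of k] by (intro fourier_adjoint) (auto simp: L1_space_def)
  have "(\<lambda>k. L2_inner (fourier (s k)) (r k)) \<longlonglongrightarrow> L2_inner F g"
    by (rule L2_inner_tendsto[OF s(3) r(2)])
  moreover have "(\<lambda>k. L2_inner (s k) (\<lambda>x. fourier (r k) (0 + (-1) * x))) \<longlonglongrightarrow> L2_inner f (\<lambda>x. G (0 + (-1) * x))"
    by (intro L2_inner_tendsto s(2) L2_converges_affine r(3)) simp
  ultimately show ?thesis unfolding eq by (rule LIMSEQ_unique)
qed

lemma L2_inner_self: "L2_inner f f = of_real ((L2_norm f)\<^sup>2)"
  unfolding L2_inner_def L2_norm_power2 complex_norm_square[symmetric] by (rule integral_complex_of_real)

lemma L2_norm_diff_power2:
  assumes F: "F \<in> L2_space" and g: "g \<in> L2_space"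
  shows "(L2_dist F g)\<^sup>2 = (L2_norm F)\<^sup>2 + (L2_norm g)\<^sup>2 - 2 * Re (L2_inner F g)"
proof -
  have pt: "(norm (a - b))\<^sup>2 = (norm a)\<^sup>2 + (norm b)\<^sup>2 - 2 * Re (a * cnj b)" for a b :: complex
    unfolding cmod_power2 by (simp add: power2_eq_square algebra_simps)
  define p where "p t = Re (F t * cnj (g t))" for t
  have i: "integrable lebesgue (\<lambda>t. F t * cnj (g t))" by (rule L2_inner_integrable[OF F g])
  then have Re: "Re (L2_inner F g) = (LINT t|lebesgue. p t)"
    unfolding L2_inner_def p_def by (rule integral_Re[symmetric])
  have "integrable lebesgue p" unfolding p_def using i by (rule integrable_Re)
  then show ?thesis
    unfolding L2_norm_power2 pt p_def[symmetric] Re using L2_space_integrable[OF F] L2_space_integrable[OF g]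
    by simp
qed

text \<open>Let f be the reflected transform of g. The adjoint relation gives that the inner product
  of the transform of f with g equals ||f||^2, while f, g and the transform of f all have the same
  norm. Expanding the squared distance between the transform of f and g therefore gives 0.\<close>

theorem fourier_L2_inversion:
  assumes g: "g \<in> L2_space"
  shows "\<exists>f\<in>L2_space. AE \<xi> in lebesgue. fourier_L2 f \<xi> = g \<xi>"
proof -
  obtain G where G: "has_fourier_L2 g G" using has_fourier_L2_exists[OF g] by blast
  have G2: "G \<in> L2_space" and nG: "L2_norm G = L2_norm g"
    using has_fourier_L2_spaces[OF G] has_fourier_L2_norm[OF G] by auto
  define f where "f = (\<lambda>x. G (0 + (-1) * x))"
  have f2: "f \<in> L2_space" and nf: "L2_norm f = L2_norm g"
    unfolding f_def using L2_affine[OF G2, of "-1" 0] nG by auto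
  note F = has_fourier_fourier_L2[OF f2]
  have F2: "fourier_L2 f \<in> L2_space" and nF: "L2_norm (fourier_L2 f) = L2_norm g"
    using has_fourier_L2_spaces[OF F] has_fourier_L2_norm[OF F] nf by auto
  have "L2_inner (fourier_L2 f) g = L2_inner f f"
    using has_fourier_L2_adjoint[OF F G] by (simp add: f_def)
  then have "(L2_dist (fourier_L2 f) g)\<^sup>2 = 0"
    unfolding L2_norm_diff_power2[OF F2 g] by (simp add: L2_inner_self nF nf)
  then have "AE \<xi> in lebesgue. fourier_L2 f \<xi> = g \<xi>"
    by (intro L2_eq_AE_if_norm_diff_0 F2 g) simp
  then show ?thesis using f2 by blast
qed

lemma inv_fourier_L2:
  assumes "g \<in> L2_space"
  shows "inv_fourier_L2 g \<in> L2_space" "AE \<xi> in lebesgue. fourier_L2 (inv_fourier_L2 g) \<xi> = g \<xi>"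
proof -
  have "\<exists>f. f \<in> L2_space \<and> (AE \<xi> in lebesgue. fourier_L2 f \<xi> = g \<xi>)"
    using fourier_L2_inversion[OF assms] by blast
  from someI_ex[OF this]
  show "inv_fourier_L2 g \<in> L2_space" "AE \<xi> in lebesgue. fourier_L2 (inv_fourier_L2 g) \<xi> = g \<xi>"
    unfolding inv_fourier_L2_def by auto
qed

lemma fourier_translate: "fourier (\<lambda>t. f (- x + 1 * t)) \<xi> = phase (- (x * \<xi>)) * fourier f \<xi>"
proof -
  have "fourier f \<xi> = (LINT t|lebesgue. f (- x + 1 * t) * phase (- ((- x + 1 * t) * \<xi>)))"
    unfolding fourier_eq_phase by (subst lebesgue_integral_real_affine[of 1 _ "-x"]) simp_all
  also have "\<dots> = (LINT t|lebesgue. phase (x * \<xi>) * (f (- x + 1 * t) * phase (- (t * \<xi>))))"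
    by (intro Bochner_Integration.integral_cong) (simp_all add: phase_add[symmetric] algebra_simps)
  also have "\<dots> = phase (x * \<xi>) * fourier (\<lambda>t. f (- x + 1 * t)) \<xi>"
    unfolding fourier_eq_phase by (rule integral_mult_right_zero)
  finally have "phase (- (x * \<xi>)) * fourier f \<xi> = (phase (- (x * \<xi>)) * phase (x * \<xi>)) * fourier (\<lambda>t. f (- x + 1 * t)) \<xi>"
    by simp
  then show ?thesis by (simp add: phase_add[symmetric])
qed

lemma L2_converges_mult_bounded:
  assumes s: "L2_converges s f" and [measurable]: "u \<in> borel_measurable lebesgue" and u: "\<And>t. norm (u t) = 1"
  shows "L2_converges (\<lambda>k t. u t * s k t) (\<lambda>t. u t * f t)"
proof -
  have "L2_norm (\<lambda>t. u t * s k t - u t * f t) = L2_dist (s k) f" for k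
    unfolding L2_norm_def right_diff_distrib[symmetric] by (simp add: norm_mult u)
  moreover have "(\<lambda>t. u t * h t) \<in> L2_space" if "h \<in> L2_space" for h
    by (rule L2_space_mult_bounded[OF that, where B = 1]) (auto simp: u)
  ultimately show ?thesis using s by (simp add: L2_converges_def)
qed

lemma has_fourier_L2_translate:
  assumes "has_fourier_L2 f F"
  shows "has_fourier_L2 (translate x f) (\<lambda>\<xi>. phase (- (x * \<xi>)) * F \<xi>)"
proof -
  obtain s where s: "\<And>k. s k \<in> L1_space" "L2_converges s f" "L2_converges (\<lambda>k. fourier (s k)) F"
    using assms by (auto simp: has_fourier_L2_def)
  have "integrable lebesgue (\<lambda>t. s k (- x + 1 * t))" for k
    using s(1)[of k] by (subst lebesgue_integrable_real_affine_iff) (auto simp: L1_space_def)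
  moreover have "L2_converges (\<lambda>k t. s k (- x + 1 * t)) (\<lambda>t. f (- x + 1 * t))"
    by (rule L2_converges_affine[OF s(2)]) simp
  moreover have "L2_converges (\<lambda>k. fourier (\<lambda>t. s k (- x + 1 * t))) (\<lambda>\<xi>. phase (- (x * \<xi>)) * F \<xi>)"
    unfolding fourier_translate by (rule L2_converges_mult_bounded[OF s(3)]) auto
  ultimately show ?thesis
    unfolding has_fourier_L2_def translate_def
    by (intro exI[of _ "\<lambda>k t. s k (- x + 1 * t)"]) (auto simp: L1_space_def)
qed

lemma L2_inner_translate_inv_fourier:
  assumes f: "f \<in> L2_space" and g: "g \<in> L2_space"
  shows "L2_inner f (translate x (inv_fourier_L2 g)) = (LINT \<xi>|lebesgue. fourier_L2 f \<xi> * cnj (g \<xi>) * phase (x * \<xi>))"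
proof -
  have hg: "has_fourier_L2 (inv_fourier_L2 g) (fourier_L2 (inv_fourier_L2 g))"
    by (intro has_fourier_fourier_L2 inv_fourier_L2 g)
  note hf = has_fourier_fourier_L2[OF f]
  have [measurable]: "fourier_L2 f \<in> borel_measurable lebesgue" "g \<in> borel_measurable lebesgue"
    "fourier_L2 (inv_fourier_L2 g) \<in> borel_measurable lebesgue"
    using has_fourier_L2_spaces[OF hf] has_fourier_L2_spaces[OF hg] g by (auto simp: L2_space_def)
  have "L2_inner f (translate x (inv_fourier_L2 g)) = L2_inner (fourier_L2 f) (\<lambda>\<xi>. phase (- (x * \<xi>)) * fourier_L2 (inv_fourier_L2 g) \<xi>)"
    by (rule has_fourier_L2_inner[OF hf has_fourier_L2_translate[OF hg]])
  also have "\<dots> = (LINT \<xi>|lebesgue. fourier_L2 f \<xi> * cnj (g \<xi>) * phase (x * \<xi>))"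
    unfolding L2_inner_def
  proof (rule integral_cong_AE)
    show "AE \<xi> in lebesgue. fourier_L2 f \<xi> * cnj (phase (- (x * \<xi>)) * fourier_L2 (inv_fourier_L2 g) \<xi>)
        = fourier_L2 f \<xi> * cnj (g \<xi>) * phase (x * \<xi>)"
      using inv_fourier_L2(2)[OF g] by eventually_elim (simp add: cnj_phase mult_ac)
  qed measurable
  finally show ?thesis .
qed

section \<open>Parseval identity on the unit interval\<close>

lemma sum_le_nn_integral_count_space:
  fixes f :: "'i \<Rightarrow> ennreal"
  assumes "finite F"
  shows "sum f F \<le> (\<integral>\<^sup>+i. f i \<partial>count_space UNIV)"
proof -
  have "sum f F = (\<integral>\<^sup>+i. f i \<partial>count_space F)" using assms by (simp add: nn_integral_count_space_finite)
  also have "\<dots> = (\<integral>\<^sup>+i. f i * indicator F i \<partial>count_space UNIV)"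
    by (simp add: nn_integral_count_space_indicator)
  also have "\<dots> \<le> (\<integral>\<^sup>+i. f i \<partial>count_space UNIV)"
    by (intro nn_integral_mono) (auto simp: indicator_def)
  finally show ?thesis .
qed

text \<open>Frames and Bessel sequences are defined with infinite sums, while the estimates need
  Tonelli and monotonicity; integrals against counting measure provide these. An enumeration of the
  index type identifies both sides with suprema of finite partial sums.\<close>

lemma nn_integral_count_space_eq_infsum:
  fixes f :: "'i \<Rightarrow> ennreal"
  assumes "countable (UNIV :: 'i set)" "infinite (UNIV :: 'i set)"
  shows "(\<integral>\<^sup>+i. f i \<partial>count_space UNIV) = (\<Sum>\<^sub>\<infinity>i. f i)"
proof -
  have sup: "(\<Sum>\<^sub>\<infinity>i. f i) = (SUP F\<in>{F. finite F \<and> F \<subseteq> UNIV}. sum f F)"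
    by (rule nonneg_infsum_complete) simp
  let ?e = "from_nat_into (UNIV :: 'i set)"
  have e: "bij_betw ?e UNIV UNIV" using assms by (intro bij_betw_from_nat_into)
  have "(\<integral>\<^sup>+i. f i \<partial>count_space UNIV) = (\<integral>\<^sup>+n. f (?e n) \<partial>count_space UNIV)"
    by (rule nn_integral_bij_count_space[OF e, symmetric])
  also have "\<dots> = (SUP n. \<Sum>k<n. f (?e k))"
    by (simp add: nn_integral_count_space_nat suminf_eq_SUP)
  also have "\<dots> \<le> (\<Sum>\<^sub>\<infinity>i. f i)"
  proof (rule SUP_least)
    fix n
    have "(\<Sum>k<n. f (?e k)) = sum f (?e ` {..<n})"
      using e by (subst sum.reindex) (auto simp: bij_betw_def intro: inj_on_subset)
    also have "\<dots> \<le> (\<Sum>\<^sub>\<infinity>i. f i)" unfolding sup by (intro SUP_upper) auto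
    finally show "(\<Sum>k<n. f (?e k)) \<le> (\<Sum>\<^sub>\<infinity>i. f i)" .
  qed
  finally have le: "(\<integral>\<^sup>+i. f i \<partial>count_space UNIV) \<le> (\<Sum>\<^sub>\<infinity>i. f i)" .
  moreover have "(\<Sum>\<^sub>\<infinity>i. f i) \<le> (\<integral>\<^sup>+i. f i \<partial>count_space UNIV)"
    unfolding sup by (intro SUP_least sum_le_nn_integral_count_space) simp
  ultimately show ?thesis by (rule antisym)
qed

lemma nn_integral_count_space_le:
  fixes f :: "'i \<Rightarrow> ennreal"
  assumes "countable (UNIV :: 'i set)" "infinite (UNIV :: 'i set)" "\<And>F. finite F \<Longrightarrow> sum f F \<le> C"
  shows "(\<integral>\<^sup>+i. f i \<partial>count_space UNIV) \<le> C"
  unfolding nn_integral_count_space_eq_infsum[OF assms(1,2)]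
  by (subst nonneg_infsum_complete) (auto intro!: SUP_least assms(3))

abbreviation int_sum :: "(int \<Rightarrow> ennreal) \<Rightarrow> ennreal" (binder \<open>\<Sum>\<^sub>\<int>\<close> 61) where
  "int_sum f \<equiv> nn_integral (count_space UNIV) f"

lemma lebesgue_shift_measurable [measurable]: "(\<lambda>x::real. x + c) \<in> lebesgue \<rightarrow>\<^sub>M lebesgue"
  using lebesgue_affine_measurable[where c = "\<lambda>x::real. 1" and t = c] by (simp add: add.commute)

lemma lebesgue_measurable_shift:
  assumes "f \<in> borel_measurable lebesgue"
  shows "(\<lambda>x::real. f (x + c)) \<in> borel_measurable lebesgue"
  using assms by measurable

lemma nn_integral_lebesgue_shift:
  assumes "f \<in> borel_measurable lebesgue"
  shows "(\<integral>\<^sub>\<lambda>x. f (x + c)) = (\<integral>\<^sup>+x. f x \<partial>(lebesgue :: real measure))"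
  using nn_integral_real_affine_lebesgue[OF assms, of 1 c] by (simp add: add.commute)

lemma indicator_int_interval:
  "indicator {of_int k..<of_int k + 1} (x::real) = indicator {\<lfloor>x\<rfloor>} k"
proof -
  have "of_int k \<le> x \<and> x < of_int k + 1 \<longleftrightarrow> k = \<lfloor>x\<rfloor>" by linarith
  then show ?thesis by (auto simp: indicator_def)
qed

text \<open>Tonelli after cutting the line at the integers. It serves three times: for the energy of
  a transform, for the overlap of a function with its translates, and for the integral of
  \<open>decay\<close>.\<close>

lemma nn_integral_split_unit_intervals:
  assumes h [measurable]: "h \<in> borel_measurable lebesgue"
  shows "(\<integral>\<^sub>\<lambda>x. h x)
    = (\<integral>\<^sub>\<lambda>x. (\<Sum>\<^sub>\<int>k. h (x + of_int k)) * indicator {0..<1::real} x)"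
proof -
  have "(\<integral>\<^sub>\<lambda>x. h x) = (\<integral>\<^sub>\<lambda>x. \<Sum>\<^sub>\<int>k. h x * indicator {of_int k..<of_int k + 1} x)"
    by (simp add: indicator_int_interval nn_integral_cmult)
  also have "\<dots> = (\<Sum>\<^sub>\<int>k. \<integral>\<^sub>\<lambda>x. h x * indicator {of_int k..<of_int k + 1} x)"
    by (rule nn_integral_count_space_nn_integral) auto
  also have "\<dots> = (\<Sum>\<^sub>\<int>k. \<integral>\<^sub>\<lambda>x. h (x + of_int k) * indicator {0..<1} x)"
  proof (rule nn_integral_cong)
    fix k :: int
    have "(\<integral>\<^sub>\<lambda>x. h x * indicator {of_int k..<of_int k + 1} x)
        = (\<integral>\<^sub>\<lambda>x. h (x + of_int k) * indicator {of_int k..<of_int k + 1} (x + of_int k))"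
      by (rule nn_integral_lebesgue_shift[symmetric]) measurable
    also have "\<dots> = (\<integral>\<^sub>\<lambda>x. h (x + of_int k) * indicator {0..<1} x)"
      by (intro nn_integral_cong) (auto simp: indicator_def)
    finally show "(\<integral>\<^sub>\<lambda>x. h x * indicator {of_int k..<of_int k + 1} x)
        = (\<integral>\<^sub>\<lambda>x. h (x + of_int k) * indicator {0..<1} x)" .
  qed
  also have "\<dots> = (\<integral>\<^sub>\<lambda>x. \<Sum>\<^sub>\<int>k. h (x + of_int k) * indicator {0..<1} x)"
    using lebesgue_measurable_shift[OF h] by (intro nn_integral_count_space_nn_integral[symmetric]) auto
  finally show ?thesis by (simp add: nn_integral_multc)
qed

section \<open>Orthogonality and Bessel's inequality\<close>

lemma phase_orthogonal:
  "(LINT t|lebesgue. indicator {0..1} t *\<^sub>R phase (of_int k * t)) = (if k = 0 then 1 else 0)"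
proof -
  have "(LINT t|lebesgue. indicator {0..1} t *\<^sub>R phase (of_int k * t))
      = (LINT t|lborel. indicator {0..1} t *\<^sub>R phase (of_int k * t))"
    by (rule integral_completion) (auto intro!: borel_measurable_scaleR borel_measurable_indicator
        measurable_compose[OF borel_measurable_times phase_measurable])
  also have "\<dots> = (if k = 0 then 1 else 0)"
  proof (cases "k = 0")
    case True
    then show ?thesis by (simp add: scaleR_conv_of_real)
  next
    case False
    define A :: complex where "A = 2 * pi * \<i> * of_int k"
    have A0: "A \<noteq> 0" using False by (simp add: A_def)
    have ph: "phase (of_int k * t) = exp (t *\<^sub>R A)" for t
      by (simp add: phase_def cis_conv_exp A_def scaleR_conv_of_real mult_ac)
    have "(LINT t|lborel. indicator {0..1} t *\<^sub>R exp (t *\<^sub>R A)) = exp (1 *\<^sub>R A) * (1 / A) - exp (0 *\<^sub>R A) * (1 / A)"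
    proof (rule integral_FTC_atLeastAtMost)
      fix x :: real
      have "((\<lambda>t. exp (t *\<^sub>R A) * (1 / A)) has_vector_derivative exp (x *\<^sub>R A) * A * (1 / A)) (at x within {0..1})"
        by (intro has_vector_derivative_mult_left exp_scaleR_has_vector_derivative_right)
      then show "((\<lambda>t. exp (t *\<^sub>R A) * (1 / A)) has_vector_derivative exp (x *\<^sub>R A)) (at x within {0..1})"
        using A0 by simp
    qed (auto intro!: continuous_intros)
    also have "\<dots> = 0" using ph[of 1] by simp
    finally show ?thesis using False by (simp add: ph)
  qed
  finally show ?thesis .
qed

lemma integrable_indicator_unit_phase: "integrable lebesgue (\<lambda>t. indicator {0..1} t *\<^sub>R phase (a * t))"
  by (rule Bochner_Integration.integrable_bound[OF integrable_indicator_Icc[of 0 1]]) auto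

lemma L2_unit_interval_integrable:
  assumes P: "P \<in> L2_space" and supp: "\<And>t. t \<notin> {0..1} \<Longrightarrow> P t = 0"
  shows "integrable lebesgue P"
proof (rule Bochner_Integration.integrable_bound)
  show "integrable lebesgue (\<lambda>t. (norm (P t))\<^sup>2 + (indicator {0..1} t :: real))"
    using L2_space_integrable[OF P] by (simp add: integrable_indicator_Icc)
  show "P \<in> borel_measurable lebesgue" using P by (simp add: L2_space_def)
  have "a \<le> a\<^sup>2 + 1" for a :: real
    using zero_le_power2[of "a - 1/2"] by (simp add: power2_eq_square algebra_simps)
  then show "AE x in lebesgue. norm (P x) \<le> norm ((norm (P x))\<^sup>2 + (indicator {0..1} x :: real))"
    using supp by (intro AE_I2) (auto simp: indicator_def)
qed

text \<open>Expand 0 <= ||P - Q||^2 for the partial Fourier sum Q: both Re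
  \<open>L2_inner P Q\<close> and ||Q||^2 equal the sum of squared coefficients. The frequencies
  \<xi> + n are orthonormal on [0, 1] for every real \<xi>, and the Parseval identity below averages
  over \<xi>.\<close>

lemma bessel_unit_interval:
  assumes P: "P \<in> L2_space" and supp: "\<And>t. t \<notin> {0..1} \<Longrightarrow> P t = 0" and A: "finite A"
  shows "(\<Sum>n\<in>A. (norm (fourier P (\<xi> + of_int n)))\<^sup>2) \<le> (L2_norm P)\<^sup>2"
proof -
  define c where "c n = fourier P (\<xi> + of_int n)" for n
  define u where "u n t = indicator {0..1} t *\<^sub>R phase ((\<xi> + of_int n) * t)" for n t
  define Q where "Q t = (\<Sum>n\<in>A. c n * u n t)" for t
  have P1: "integrable lebesgue P" by (rule L2_unit_interval_integrable[OF P]) (rule supp)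
  have u_meas [measurable]: "u n \<in> borel_measurable lebesgue" for n
    unfolding u_def by measurable
  have u2: "u n \<in> L2_space" for n
    by (rule L2_bounded_support[where M = 1 and R = 1]) (auto simp: u_def indicator_def)
  have Q2: "Q \<in> L2_space"
    unfolding Q_def using A
  proof (induction A)
    case empty
    have "(\<lambda>t. 0 * u 0 t) \<in> L2_space" by (intro L2_space_cmult u2)
    then show ?case by simp
  next
    case (insert a A)
    then show ?case by (simp add: L2_space_add L2_space_cmult u2)
  qed
  have "L2_inner P Q = (LINT t|lebesgue. (\<Sum>n\<in>A. cnj (c n) * (P t * phase (- (\<xi> + of_int n) * t))))"
    unfolding L2_inner_def
  proof (intro Bochner_Integration.integral_cong refl)
    fix t
    show "P t * cnj (Q t) = (\<Sum>n\<in>A. cnj (c n) * (P t * phase (- (\<xi> + of_int n) * t)))"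
      using supp[of t]
      by (cases "t \<in> {0..1}") (simp_all add: Q_def u_def sum_distrib_left cnj_phase algebra_simps)
  qed
  also have "\<dots> = (\<Sum>n\<in>A. cnj (c n) * (LINT t|lebesgue. P t * phase (- (\<xi> + of_int n) * t)))"
    using integrable_mult_phase[OF P1] by (subst Bochner_Integration.integral_sum) auto
  also have "\<dots> = (\<Sum>n\<in>A. cnj (c n) * c n)"
    by (simp add: c_def fourier_eq_phase algebra_simps)
  also have "\<dots> = (\<Sum>n\<in>A. of_real ((norm (c n))\<^sup>2))"
    by (simp only: complex_norm_square mult.commute)
  finally have PQ: "Re (L2_inner P Q) = (\<Sum>n\<in>A. (norm (c n))\<^sup>2)" by simp
  have "L2_inner Q Q = (LINT t|lebesgue. (\<Sum>n\<in>A. \<Sum>m\<in>A. c n * cnj (c m) * (indicator {0..1} t *\<^sub>R phase (of_int (n - m) * t))))"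
    unfolding L2_inner_def
  proof (intro Bochner_Integration.integral_cong refl)
    fix t
    have "u n t * cnj (u m t) = indicator {0..1} t *\<^sub>R phase (of_int (n - m) * t)" for n m
      by (cases "t \<in> {0..1}") (simp_all add: u_def cnj_phase phase_add[symmetric] algebra_simps)
    then have "c n * u n t * cnj (c m * u m t) = c n * cnj (c m) * (indicator {0..1} t *\<^sub>R phase (of_int (n - m) * t))" for n m
      by (metis (no_types, lifting) complex_cnj_mult mult.assoc mult.left_commute)
    then show "Q t * cnj (Q t) = (\<Sum>n\<in>A. \<Sum>m\<in>A. c n * cnj (c m) * (indicator {0..1} t *\<^sub>R phase (of_int (n - m) * t)))"
      unfolding Q_def cnj_sum sum_product by simp
  qed
  also have "\<dots> = (\<Sum>n\<in>A. \<Sum>m\<in>A. c n * cnj (c m) * (LINT t|lebesgue. indicator {0..1} t *\<^sub>R phase (of_int (n - m) * t)))"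
  proof -
    define e where "e n m t = c n * cnj (c m) * (indicator {0..1} t *\<^sub>R phase (of_int (n - m) * t))" for n m t
    have "integrable lebesgue (e n m)" for n m
      unfolding e_def by (intro integrable_mult_right integrable_indicator_unit_phase)
    then have "(LINT t|lebesgue. (\<Sum>n\<in>A. \<Sum>m\<in>A. e n m t)) = (\<Sum>n\<in>A. \<Sum>m\<in>A. LINT t|lebesgue. e n m t)"
      by (simp add: Bochner_Integration.integral_sum Bochner_Integration.integrable_sum)
    then show ?thesis by (simp only: e_def integral_mult_right_zero)
  qed
  also have "\<dots> = (\<Sum>n\<in>A. \<Sum>m\<in>A. if m = n then of_real ((norm (c n))\<^sup>2) else 0)"
    unfolding phase_orthogonal by (intro sum.cong refl) (auto simp: complex_norm_square simp del: of_real_power)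
  also have "\<dots> = (\<Sum>n\<in>A. of_real ((norm (c n))\<^sup>2))" using A by simp
  finally have QQ: "(L2_norm Q)\<^sup>2 = (\<Sum>n\<in>A. (norm (c n))\<^sup>2)"
    unfolding L2_inner_self of_real_sum[symmetric] by (simp only: of_real_eq_iff)
  have "0 \<le> (L2_dist P Q)\<^sup>2" by simp
  then show ?thesis unfolding L2_norm_diff_power2[OF P Q2] PQ QQ c_def by simp
qed

lemma fourier_modulate: "fourier (\<lambda>t. phase (- (\<xi> * t)) * P t) \<eta> = fourier P (\<xi> + \<eta>)"
  unfolding fourier_eq_phase
  by (intro Bochner_Integration.integral_cong refl) (simp add: phase_add[symmetric] algebra_simps mult_ac)

lemma norm_phase_diff_le: "norm (phase x - 1) \<le> 2 * pi * \<bar>x\<bar>"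
  using iexp_approx1[of "2 * pi * x" 0] by (simp add: phase_def cis_conv_exp abs_mult)

text \<open>By Plancherel the mean over \<open>\<xi> \<in> [0, 1)\<close> of \<open>\<Sum>\<^sub>n |P^(\<xi> + n)|\<^sup>2\<close> is \<open>\<parallel>P\<parallel>\<^sup>2\<close>,
  which by Bessel's inequality is also an upper bound; continuity in \<open>\<xi>\<close> then gives equality at \<open>0\<close>.\<close>

theorem parseval_unit_interval:
  assumes P: "P \<in> L2_space" and supp: "\<And>t. t \<notin> {0..1} \<Longrightarrow> P t = 0"
  shows "(\<Sum>\<^sub>\<int>n. enorm2 (fourier P (of_int n))) = ennreal ((L2_norm P)\<^sup>2)"
proof -
  define B where "B \<xi> = (\<Sum>\<^sub>\<int>n. enorm2 (fourier P (\<xi> + of_int n)))" for \<xi>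
  define L where "L = (L2_norm P)\<^sup>2"
  have P1: "integrable lebesgue P" by (rule L2_unit_interval_integrable[OF P]) (rule supp)
  have [measurable]: "P \<in> borel_measurable lebesgue" using P1 by auto
  have le: "B \<xi> \<le> ennreal L" for \<xi>
    unfolding B_def L_def
    by (intro nn_integral_count_space_le) (auto intro!: ennreal_leI bessel_unit_interval P supp simp: infinite_UNIV_int sum_ennreal)
  have mean: "(\<integral>\<^sub>\<lambda>\<xi>. B \<xi> * indicator {0..<1} \<xi>) = ennreal L"
  proof -
    have "ennreal L = (\<integral>\<^sub>\<lambda>\<xi>. enorm2 (fourier P \<xi>))"
      using ennreal_L2_norm_power2[OF fourier_L2_contraction(1)[OF P1 P]] by (simp add: L_def plancherel[OF P1 P])
    also have "\<dots> = (\<integral>\<^sub>\<lambda>\<xi>. B \<xi> * indicator {0..<1} \<xi>)"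
      unfolding B_def by (rule nn_integral_split_unit_intervals) measurable
    finally show ?thesis by simp
  qed
  obtain b where b: "B 0 = ennreal b" "b \<ge> 0" using le[of 0] by (cases "B 0") (auto simp: top_unique)
  \<comment> \<open>Quantitative continuity at 0. The samples at \<xi> + n differ from those at n by
    the samples of the transform of S, where S = (phase (-\<xi> t) - 1) P has norm at most 2 pi
    \<delta> ||P||. Bessel's inequality for S and the triangle inequality for finite square sums
    give the bound.\<close>
  have shift: "B \<xi> \<le> ennreal ((sqrt b + 2 * pi * \<delta> * L2_norm P)\<^sup>2)" if \<xi>: "0 \<le> \<xi>" "\<xi> \<le> \<delta>" for \<xi> \<delta>
    unfolding B_def
  proof (rule nn_integral_count_space_le)
    fix A :: "int set" assume A: "finite A"
    define R where "R t = phase (- (\<xi> * t)) * P t" for t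
    have R2: "R \<in> L2_space" unfolding R_def by (rule L2_space_mult_bounded[OF P, where B = 1]) auto
    define S where "S t = R t - P t" for t
    have S2: "S \<in> L2_space" unfolding S_def by (intro L2_space_diff R2 P)
    have Ssupp: "S t = 0" if "t \<notin> {0..1}" for t using supp[OF that] by (simp add: S_def R_def)
    have R1: "integrable lebesgue R"
      by (rule L2_unit_interval_integrable[OF R2]) (simp add: R_def supp)
    have fS: "fourier S \<eta> = fourier P (\<xi> + \<eta>) - fourier P \<eta>" for \<eta>
      using fourier_add_cmult[OF R1 P1, of "-1" \<eta>] fourier_modulate[of \<xi> P \<eta>] by (simp add: S_def[abs_def] R_def[abs_def])
    have nS: "L2_norm S \<le> 2 * pi * \<delta> * L2_norm P"
    proof -
      have "(L2_norm S)\<^sup>2 \<le> (2 * pi * \<delta> * L2_norm P)\<^sup>2"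
        unfolding power_mult_distrib[of _ "L2_norm P"] L2_norm_power2
        unfolding Bochner_Integration.integral_mult_right_zero[symmetric]
      proof (rule integral_mono[OF L2_space_integrable[OF S2]])
        show "integrable lebesgue (\<lambda>t. (2 * pi * \<delta>)\<^sup>2 * (norm (P t))\<^sup>2)" using L2_space_integrable[OF P] by simp
        fix t
        have "norm (S t) \<le> (2 * pi * \<delta>) * norm (P t)"
        proof (cases "t \<in> {0..1}")
          case True
          have "norm (S t) = norm (phase (- (\<xi> * t)) - 1) * norm (P t)"
            by (simp add: S_def R_def norm_mult[symmetric] algebra_simps)
          also have "\<dots> \<le> (2 * pi * \<bar>- (\<xi> * t)\<bar>) * norm (P t)"
            by (intro mult_right_mono norm_phase_diff_le) auto
          also have "\<dots> \<le> (2 * pi * \<delta>) * norm (P t)"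
          proof -
            have "\<xi> * t \<le> \<delta> * 1" using True \<xi> by (intro mult_mono) auto
            then show ?thesis using True \<xi> by (intro mult_right_mono mult_left_mono) (auto simp: abs_mult)
          qed
          finally show ?thesis .
        qed (simp add: Ssupp supp)
        then have "(norm (S t))\<^sup>2 \<le> ((2 * pi * \<delta>) * norm (P t))\<^sup>2" by (intro power_mono) auto
        then show "(norm (S t))\<^sup>2 \<le> (2 * pi * \<delta>)\<^sup>2 * (norm (P t))\<^sup>2" by (simp add: power_mult_distrib)
      qed
      then show ?thesis by (rule power2_le_imp_le) (use \<xi> in auto)
    qed
    have "L2_set (\<lambda>n. norm (fourier P (\<xi> + of_int n))) A \<le> L2_set (\<lambda>n. norm (fourier P (of_int n)) + norm (fourier S (of_int n))) A"
      by (rule L2_set_mono) (auto simp: fS intro: norm_triangle_sub)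
    also have "\<dots> \<le> L2_set (\<lambda>n. norm (fourier P (of_int n))) A + L2_set (\<lambda>n. norm (fourier S (of_int n))) A"
      by (rule L2_set_triangle_ineq)
    also have "\<dots> \<le> sqrt b + 2 * pi * \<delta> * L2_norm P"
    proof (rule add_mono)
      have "ennreal (\<Sum>n\<in>A. (norm (fourier P (of_int n)))\<^sup>2) \<le> B 0"
        using sum_le_nn_integral_count_space[OF A, of "\<lambda>n. enorm2 (fourier P (of_int n))"]
        by (simp add: B_def sum_ennreal)
      then show "L2_set (\<lambda>n. norm (fourier P (of_int n))) A \<le> sqrt b"
        using b by (simp add: L2_set_def ennreal_le_iff)
      have "L2_set (\<lambda>n. norm (fourier S (of_int n))) A \<le> L2_norm S"
        unfolding L2_set_def using bessel_unit_interval[OF S2 Ssupp A, of 0]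
        by (intro real_le_lsqrt) (auto intro: sum_nonneg)
      then show "L2_set (\<lambda>n. norm (fourier S (of_int n))) A \<le> 2 * pi * \<delta> * L2_norm P" using nS by linarith
    qed
    finally have "(L2_set (\<lambda>n. norm (fourier P (\<xi> + of_int n))) A)\<^sup>2 \<le> (sqrt b + 2 * pi * \<delta> * L2_norm P)\<^sup>2"
      by (intro power_mono) (auto simp: L2_set_nonneg)
    then show "(\<Sum>n\<in>A. enorm2 (fourier P (\<xi> + of_int n))) \<le> ennreal ((sqrt b + 2 * pi * \<delta> * L2_norm P)\<^sup>2)"
      by (simp add: sum_ennreal L2_set_def sum_nonneg ennreal_leI)
  qed (auto simp: infinite_UNIV_int)
  \<comment> \<open>The mean L of B over [0, 1) is at most K \<delta> + L (1 - \<delta>), with K the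
    bound from \<open>shift\<close> on [0, \<delta>) and Bessel's bound L on the rest. Hence L <= K,
    and K tends to b as \<delta> tends to 0.\<close>
  have L_le: "L \<le> (sqrt b + 2 * pi * \<delta> * L2_norm P)\<^sup>2" if \<delta>: "0 < \<delta>" "\<delta> < 1" for \<delta>
  proof -
    let ?K = "(sqrt b + 2 * pi * \<delta> * L2_norm P)\<^sup>2"
    note mean[symmetric]
    also have "(\<integral>\<^sub>\<lambda>\<xi>. B \<xi> * indicator {0..<1} \<xi>) \<le> (\<integral>\<^sub>\<lambda>\<xi>. ennreal ?K * indicator {0..<\<delta>} \<xi> + ennreal L * indicator {\<delta>..<1} \<xi>)"
    proof (rule nn_integral_mono)
      fix \<xi> :: real
      show "B \<xi> * indicator {0..<1} \<xi> \<le> ennreal ?K * indicator {0..<\<delta>} \<xi> + ennreal L * indicator {\<delta>..<1} \<xi>"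
        using le[of \<xi>] shift[of \<xi> \<delta>] \<delta> by (auto simp: indicator_def)
    qed
    also have "\<dots> = ennreal ?K * ennreal \<delta> + ennreal L * ennreal (1 - \<delta>)"
      using \<delta> by (subst nn_integral_add) (auto simp: nn_integral_cmult)
    also have "\<dots> = ennreal (?K * \<delta> + L * (1 - \<delta>))"
      using \<delta> by (simp add: ennreal_mult ennreal_plus L_def)
    finally have "L \<le> ?K * \<delta> + L * (1 - \<delta>)"
      using \<delta> by (subst (asm) ennreal_le_iff) (auto simp: L_def)
    then have "L * \<delta> \<le> ?K * \<delta>" by (simp add: algebra_simps)
    then show ?thesis using \<delta> by simp
  qed
  have "L \<le> b"
  proof (rule tendsto_lowerbound)
    show "((\<lambda>\<delta>. (sqrt b + 2 * pi * \<delta> * L2_norm P)\<^sup>2) \<longlongrightarrow> b) (at_right 0)"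
      using b by (auto intro!: tendsto_eq_intros)
    show "eventually (\<lambda>\<delta>. L \<le> (sqrt b + 2 * pi * \<delta> * L2_norm P)\<^sup>2) (at_right 0)"
      unfolding eventually_at_right_field by (intro exI[of _ 1]) (auto intro: L_le)
  qed simp
  then have "ennreal L \<le> B 0" using b by (simp add: ennreal_leI)
  with le[of 0] have "B 0 = ennreal L" by (rule antisym)
  then show ?thesis by (simp add: B_def L_def)
qed

section \<open>Sampling the Fourier transform\<close>

interpretation int_lebesgue: pair_sigma_finite "count_space (UNIV :: int set)" "lebesgue :: real measure"
  by (intro pair_sigma_finite.intro sigma_finite_lebesgue sigma_finite_measure_count_space_countable) auto

lemma (in pair_sigma_finite) integrable_product_nn:
  fixes f :: "_ \<Rightarrow> complex"
  assumes f: "f \<in> borel_measurable (M1 \<Otimes>\<^sub>M M2)"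
    and fin: "(\<integral>\<^sup>+x. \<integral>\<^sup>+y. enorm (f (x, y)) \<partial>M2 \<partial>M1) < \<infinity>"
  shows "integrable (M1 \<Otimes>\<^sub>M M2) f"
proof (rule integrableI_bounded[OF f])
  have "(\<lambda>z. enorm (f z)) \<in> borel_measurable (M1 \<Otimes>\<^sub>M M2)" using f by measurable
  from M2.nn_integral_fst[OF this] fin show "(\<integral>\<^sup>+z. enorm (f z) \<partial>(M1 \<Otimes>\<^sub>M M2)) < \<infinity>" by simp
qed

lemma borel_measurable_int_family:
  assumes "\<And>k. f k \<in> borel_measurable M"
  shows "(\<lambda>(k :: int, x). f k x) \<in> borel_measurable (count_space UNIV \<Otimes>\<^sub>M M)"
    "(\<lambda>(x, k :: int). f k x) \<in> borel_measurable (M \<Otimes>\<^sub>M count_space UNIV)"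
proof -
  show *: "(\<lambda>(k :: int, x). f k x) \<in> borel_measurable (count_space UNIV \<Otimes>\<^sub>M M)"
    using assms by (intro measurable_pair_measure_countable1) auto
  show "(\<lambda>(x, k :: int). f k x) \<in> borel_measurable (M \<Otimes>\<^sub>M count_space UNIV)"
    using measurable_pair_swap[OF *] by (simp add: case_prod_beta)
qed

lemma borel_measurable_nn_integral_int:
  assumes "\<And>k. f k \<in> borel_measurable M"
  shows "(\<lambda>x. \<Sum>\<^sub>\<int>k. f k x) \<in> borel_measurable M"
  by (rule sigma_finite_measure.borel_measurable_nn_integral[OF int_lebesgue.M1.sigma_finite_measure_axioms])
     (use borel_measurable_int_family(2)[OF assms] in simp)

text \<open>The right side minus the left is the sum over ordered pairs i, j of distinct indices of
  Re (z i * cnj (z j)) + |z i| |z j|, and every such term is nonnegative. This bounds the square of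
  a sum below by its diagonal without subtracting the off-diagonal part.\<close>

lemma two_sum_norm_power2_le:
  fixes z :: "'i \<Rightarrow> complex"
  assumes "finite A"
  shows "2 * (\<Sum>i\<in>A. (norm (z i))\<^sup>2) \<le> (norm (\<Sum>i\<in>A. z i))\<^sup>2 + (\<Sum>i\<in>A. norm (z i))\<^sup>2"
  using assms
proof (induction A)
  case (insert a A)
  define Z S where "Z = (\<Sum>i\<in>A. z i)" and "S = (\<Sum>i\<in>A. norm (z i))"
  have "norm Z \<le> S" unfolding Z_def S_def by (rule norm_sum)
  have "- Re (z a * cnj Z) \<le> norm (z a * cnj Z)" using abs_Re_le_cmod[of "z a * cnj Z"] by linarith
  also have "\<dots> \<le> norm (z a) * S"
    using \<open>norm Z \<le> S\<close> by (simp add: norm_mult mult_left_mono)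
  finally have 1: "0 \<le> Re (z a * cnj Z) + norm (z a) * S" by simp
  have "(norm (z a + Z))\<^sup>2 = (norm (z a))\<^sup>2 + (norm Z)\<^sup>2 + 2 * Re (z a * cnj Z)"
    unfolding cmod_power2 by (simp add: power2_eq_square algebra_simps)
  moreover have "(norm (z a) + S)\<^sup>2 = (norm (z a))\<^sup>2 + S\<^sup>2 + 2 * (norm (z a) * S)"
    by (simp add: power2_eq_square algebra_simps)
  ultimately show ?case using insert 1 by (simp add: Z_def[symmetric] S_def[symmetric])
qed simp

lemma two_nn_integral_norm_power2_le:
  fixes z :: "int \<Rightarrow> complex"
  assumes fin: "(\<Sum>\<^sub>\<int>k. enorm (z k)) < \<infinity>"
  shows "2 * (\<Sum>\<^sub>\<int>k. enorm2 (z k))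
    \<le> enorm2 (LINT k|count_space UNIV. z k) + (\<Sum>\<^sub>\<int>k. enorm (z k))\<^sup>2"
proof -
  have bij: "bij_betw int_decode UNIV UNIV"
    using bij_int_decode by simp
  define y where "y i = z (int_decode i)" for i
  have tr: "(\<Sum>\<^sub>\<int>k. g (z k)) = (\<Sum>i. g (y i))" for g :: "complex \<Rightarrow> ennreal"
    unfolding y_def nn_integral_count_space_nat[symmetric] by (rule nn_integral_bij_count_space[OF bij, symmetric])
  have ysum: "summable (\<lambda>i. norm (y i))"
    by (rule summable_suminf_not_top) (use fin tr[of "\<lambda>w. ennreal (norm w)"] in auto)
  have yint: "integrable (count_space UNIV) y"
    using ysum by (simp add: integrable_count_space_nat_iff)
  have lint: "(LINT k|count_space UNIV. z k) = (\<Sum>i. y i)"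
  proof -
    have "(LINT k|count_space UNIV. z k) = (LINT i|count_space UNIV. y i)"
      unfolding y_def by (rule integral_bij_count_space[OF bij, symmetric])
    then show ?thesis by (simp add: integral_count_space_nat[OF yint])
  qed
  let ?S = "\<Sum>i. norm (y i)"
  have ybd: "norm (y i) \<le> ?S" for i
    using sum_le_suminf[OF ysum, of "{i}"] by simp
  have y2sum: "summable (\<lambda>i. (norm (y i))\<^sup>2)"
  proof (rule summable_comparison_test')
    show "summable (\<lambda>i. ?S * norm (y i))" using ysum by (rule summable_mult)
    show "norm ((norm (y i))\<^sup>2) \<le> ?S * norm (y i)" if "i \<ge> 0" for i
      using ybd[of i] by (simp add: power2_eq_square mult_right_mono)
  qed
  have "2 * (\<Sum>i. (norm (y i))\<^sup>2) \<le> (norm (\<Sum>i. y i))\<^sup>2 + ?S\<^sup>2"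
  proof (rule LIMSEQ_le)
    show "(\<lambda>n. 2 * (\<Sum>i<n. (norm (y i))\<^sup>2)) \<longlonglongrightarrow> 2 * (\<Sum>i. (norm (y i))\<^sup>2)"
      by (intro tendsto_intros summable_LIMSEQ y2sum)
    show "(\<lambda>n. (norm (\<Sum>i<n. y i))\<^sup>2 + (\<Sum>i<n. norm (y i))\<^sup>2) \<longlonglongrightarrow> (norm (\<Sum>i. y i))\<^sup>2 + ?S\<^sup>2"
      by (intro tendsto_intros summable_LIMSEQ ysum summable_norm_cancel[OF ysum])
    show "\<exists>N. \<forall>n\<ge>N. 2 * (\<Sum>i<n. (norm (y i))\<^sup>2) \<le> (norm (\<Sum>i<n. y i))\<^sup>2 + (\<Sum>i<n. norm (y i))\<^sup>2"
      using two_sum_norm_power2_le[of "{..<_}" y] by auto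
  qed
  then have "ennreal (2 * (\<Sum>i. (norm (y i))\<^sup>2)) \<le> ennreal ((norm (\<Sum>i. y i))\<^sup>2 + ?S\<^sup>2)"
    by (rule ennreal_leI)
  also have "ennreal (2 * (\<Sum>i. (norm (y i))\<^sup>2)) = 2 * (\<Sum>i. enorm2 (y i))"
    using y2sum by (simp add: ennreal_mult suminf_nonneg suminf_ennreal2)
  also have "ennreal ((norm (\<Sum>i. y i))\<^sup>2 + ?S\<^sup>2) = enorm2 (\<Sum>i. y i) + (\<Sum>i. enorm (y i))\<^sup>2"
    using ysum by (simp add: ennreal_power suminf_nonneg suminf_ennreal2)
  finally show ?thesis
    unfolding lint tr[of "\<lambda>w. ennreal ((norm w)\<^sup>2)"] tr[of "\<lambda>w. ennreal (norm w)"] .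
qed

lemma nn_integral_int_shift:
  "(\<Sum>\<^sub>\<int>k. f (k + j)) = (\<Sum>\<^sub>\<int>k. f k)"
proof (rule nn_integral_bij_count_space)
  show "bij_betw (\<lambda>k. k + j) (UNIV :: int set) UNIV"
    by (rule bij_betw_byWitness[where f' = "\<lambda>k. k - j"]) auto
qed

lemma nn_integral_int_uminus:
  "(\<Sum>\<^sub>\<int>k. f (- k)) = (\<Sum>\<^sub>\<int>k. f k)"
proof (rule nn_integral_bij_count_space)
  show "bij_betw uminus (UNIV :: int set) UNIV"
    by (rule bij_betw_byWitness[where f' = uminus]) auto
qed

text \<open>At integer frequencies the phases are 1-periodic, so cutting the Fourier integral at the
  integers and translating every piece to [0, 1) changes nothing. Integrability of H justifies both
  interchanges of sum and integral.\<close>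

lemma fourier_periodization:
  assumes H: "integrable lebesgue H"
  defines "P \<equiv> (\<lambda>x. indicator {0..<1} x *\<^sub>R (LINT k|count_space (UNIV :: int set). H (x + of_int k)))"
  shows "P \<in> borel_measurable lebesgue" "fourier P (of_int n) = fourier H (of_int n)"
proof -
  have Hm: "H \<in> borel_measurable lebesgue" using H by auto
  note Hs = lebesgue_measurable_shift[OF Hm]
  have [measurable]: "(\<lambda>x. LINT k|count_space (UNIV :: int set). H (x + of_int k)) \<in> borel_measurable lebesgue"
    by (rule sigma_finite_measure.borel_measurable_lebesgue_integral[OF int_lebesgue.M1.sigma_finite_measure_axioms])
       (rule borel_measurable_int_family(2)[OF Hs])
  show "P \<in> borel_measurable lebesgue" unfolding P_def by measurable
  have Hfin: "(\<integral>\<^sub>\<lambda>x. enorm (H x)) < \<infinity>" using H by (simp add: integrable_iff_bounded)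
  \<comment> \<open>\<open>g k\<close> is the Fourier integrand of H on the k-th unit interval, and
    \<open>f k\<close> is the same piece translated to [0, 1).\<close>
  define f where "f k x = indicator {0..<1} x *\<^sub>R (H (x + of_int k) * phase (- (x * of_int n)))" for k :: int and x
  define g where "g k x = indicator {of_int k..<of_int k + 1} x *\<^sub>R (H x * phase (- (x * of_int n)))" for k :: int and x
  have fm: "f k \<in> borel_measurable lebesgue" for k unfolding f_def using Hs by measurable
  have gm: "g k \<in> borel_measurable lebesgue" for k unfolding g_def using Hm by measurable
  have fg: "f k x = g k (x + of_int k)" for k x
  proof -
    have "phase (- ((x + of_int k) * of_int n)) = phase (- (x * of_int n)) * phase (of_int (- (k * n)))"
      unfolding phase_add[symmetric] by (simp add: algebra_simps)
    then have "phase (- ((x + of_int k) * of_int n)) = phase (- (x * of_int n))" by (simp only: phase_of_int mult_1_right)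
    then show ?thesis unfolding f_def g_def by (auto simp: indicator_def)
  qed
  have nng: "(\<Sum>\<^sub>\<int>k. \<integral>\<^sub>\<lambda>x. enorm (g k x)) < \<infinity>"
  proof -
    have "(\<Sum>\<^sub>\<int>k. \<integral>\<^sub>\<lambda>x. enorm (g k x))
        = (\<integral>\<^sub>\<lambda>x. \<Sum>\<^sub>\<int>k. enorm (g k x))"
      using gm by (intro nn_integral_count_space_nn_integral[symmetric]) auto
    also have "\<dots> = (\<integral>\<^sub>\<lambda>x. enorm (H x))"
    proof (rule nn_integral_cong)
      fix x :: real
      have "enorm (g k x) = enorm (H x) * indicator {\<lfloor>x\<rfloor>} k" for k
        unfolding g_def indicator_int_interval by (auto simp: indicator_def norm_mult)
      then show "(\<Sum>\<^sub>\<int>k. enorm (g k x)) = enorm (H x)"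
        by (simp add: nn_integral_cmult)
    qed
    finally show ?thesis using Hfin by simp
  qed
  have nnf: "(\<Sum>\<^sub>\<int>k. \<integral>\<^sub>\<lambda>x. enorm (f k x)) < \<infinity>"
  proof -
    have "(\<integral>\<^sub>\<lambda>x. enorm (f k x)) = (\<integral>\<^sub>\<lambda>x. enorm (g k x))" for k
      unfolding fg using gm[of k] by (intro nn_integral_lebesgue_shift[of "\<lambda>x. enorm (g k x)"]) measurable
    then show ?thesis using nng by simp
  qed
  have intf: "integrable (count_space UNIV \<Otimes>\<^sub>M lebesgue) (\<lambda>(k, x). f k x)"
    by (rule int_lebesgue.integrable_product_nn[OF borel_measurable_int_family(1)[OF fm]]) (use nnf in simp)
  have intg: "integrable (count_space UNIV \<Otimes>\<^sub>M lebesgue) (\<lambda>(k, x). g k x)"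
    by (rule int_lebesgue.integrable_product_nn[OF borel_measurable_int_family(1)[OF gm]]) (use nng in simp)
  have "fourier P (of_int n) = (LINT x|lebesgue. LINT k|count_space UNIV. f k x)"
    unfolding fourier_eq_phase P_def f_def by simp
  also have "\<dots> = (LINT k|count_space UNIV. LINT x|lebesgue. f k x)"
    by (rule int_lebesgue.Fubini_integral[OF intf])
  also have "\<dots> = (LINT k|count_space UNIV. LINT x|lebesgue. g k x)"
  proof (rule Bochner_Integration.integral_cong[OF refl])
    fix k
    show "(LINT x|lebesgue. f k x) = (LINT x|lebesgue. g k x)"
      unfolding fg using lebesgue_integral_real_affine[of 1 "g k" "of_int k"] by (simp add: add.commute)
  qed
  also have "\<dots> = (LINT x|lebesgue. LINT k|count_space UNIV. g k x)"
    by (rule int_lebesgue.Fubini_integral[OF intg, symmetric])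
  also have "\<dots> = fourier H (of_int n)"
    unfolding fourier_eq_phase
  proof (rule Bochner_Integration.integral_cong[OF refl])
    fix x :: real
    have "(LINT k|count_space UNIV. indicator {\<lfloor>x\<rfloor>} k *\<^sub>R (H x * phase (- (x * of_int n)))) = H x * phase (- (x * of_int n))"
      by simp
    then show "(LINT k|count_space UNIV. g k x) = H x * phase (- (x * of_int n))"
      unfolding g_def indicator_int_interval .
  qed
  finally show "fourier P (of_int n) = fourier H (of_int n)" .
qed

text \<open>Let P be the periodization of H and Q that of |H|, both over [0, 1). Parseval gives E =
  integral of |P|^2 when W is finite, and unfolding gives W = integral of Q^2. So the first bound is
  |P| <= Q, and the second is \<open>two_nn_integral_norm_power2_le\<close> at the points where Q is
  finite, integrated. If W is infinite both bounds are trivial.\<close>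

lemma fourier_samples_bounds:
  assumes H: "integrable lebesgue H"
  defines "W \<equiv> (\<Sum>\<^sub>\<int>k. \<integral>\<^sub>\<lambda>x. enorm (H x) * enorm (H (x + of_int k)))"
  defines "E \<equiv> (\<Sum>\<^sub>\<int>n. enorm2 (fourier H (of_int n)))"
  shows "E \<le> W" "2 * (\<integral>\<^sub>\<lambda>x. enorm2 (H x)) \<le> E + W"
proof -
  have Hm [measurable]: "H \<in> borel_measurable lebesgue" using H by auto
  note Hs = lebesgue_measurable_shift[OF Hm]
  have Hfin: "(\<integral>\<^sub>\<lambda>x. enorm (H x)) < \<infinity>" using H by (simp add: integrable_iff_bounded)
  define Q where "Q x = (\<Sum>\<^sub>\<int>k. enorm (H (x + of_int k)))" for x
  have Qm [measurable]: "Q \<in> borel_measurable lebesgue"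
    unfolding Q_def using Hs by (intro borel_measurable_nn_integral_int) measurable
  have Qper: "Q (x + of_int j) = Q x" for x j
    unfolding Q_def using nn_integral_int_shift[of "\<lambda>k. enorm (H (x + of_int k))" j] by (simp add: add_ac)
  have W: "W = (\<integral>\<^sub>\<lambda>x. (Q x)\<^sup>2 * indicator {0..<1} x)"
  proof -
    have "W = (\<integral>\<^sub>\<lambda>x. \<Sum>\<^sub>\<int>k. enorm (H x) * enorm (H (x + of_int k)))"
      unfolding W_def using Hs by (intro nn_integral_count_space_nn_integral[symmetric]) auto
    also have "\<dots> = (\<integral>\<^sub>\<lambda>x. enorm (H x) * Q x)"
      unfolding Q_def by (simp add: nn_integral_cmult)
    also have "\<dots> = (\<integral>\<^sub>\<lambda>x. (\<Sum>\<^sub>\<int>k. enorm (H (x + of_int k)) * Q (x + of_int k)) * indicator {0..<1} x)"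
      by (rule nn_integral_split_unit_intervals) measurable
    also have "\<dots> = (\<integral>\<^sub>\<lambda>x. (Q x)\<^sup>2 * indicator {0..<1} x)"
      unfolding Qper by (subst nn_integral_multc) (auto simp: Q_def power2_eq_square)
    finally show ?thesis .
  qed
  define P where "P = (\<lambda>x. indicator {0..<1} x *\<^sub>R (LINT k|count_space (UNIV :: int set). H (x + of_int k)))"
  have Pm [measurable]: "P \<in> borel_measurable lebesgue" and fP: "\<And>n. fourier P (of_int n) = fourier H (of_int n)"
    unfolding P_def using fourier_periodization[OF H] by auto
  have PQ: "enorm2 (P x) \<le> (Q x)\<^sup>2 * indicator {0..<1} x" for x
  proof -
    \<comment> \<open>The bound also holds where the sum is not absolutely convergent, since the
      Bochner integral then has the value 0.\<close>
    have "enorm (LINT k|count_space (UNIV :: int set). H (x + of_int k)) \<le> Q x"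
      unfolding Q_def
      by (cases "integrable (count_space UNIV) (\<lambda>k :: int. H (x + of_int k))")
         (auto intro: integral_norm_bound_ennreal simp: not_integrable_integral_eq)
    then show ?thesis by (auto simp: P_def indicator_def ennreal_power[symmetric] intro!: power_mono)
  qed
  have nnP: "(\<integral>\<^sub>\<lambda>x. enorm2 (P x)) \<le> W"
    unfolding W by (intro nn_integral_mono PQ)
  have main: "E = (\<integral>\<^sub>\<lambda>x. enorm2 (P x))" if "W < \<infinity>"
  proof -
    have P2: "P \<in> L2_space" unfolding L2_space_iff_nn_integral using le_less_trans[OF nnP that] Pm by simp
    have "E = (\<Sum>\<^sub>\<int>n. enorm2 (fourier P (of_int n)))"
      unfolding E_def fP ..
    also have "\<dots> = ennreal ((L2_norm P)\<^sup>2)"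
      by (rule parseval_unit_interval[OF P2]) (auto simp: P_def)
    finally show ?thesis unfolding ennreal_L2_norm_power2[OF P2] .
  qed
  show "E \<le> W" using main nnP by (cases "W < \<infinity>") (auto simp: not_less top_unique)
  show "2 * (\<integral>\<^sub>\<lambda>x. enorm2 (H x)) \<le> E + W"
  proof (cases "W < \<infinity>")
    case True
    have "(\<integral>\<^sub>\<lambda>x. Q x * indicator {0..<1} x) < \<infinity>"
      unfolding Q_def using nn_integral_split_unit_intervals[of "\<lambda>x. enorm (H x)"] Hfin by simp
    then have "AE x in lebesgue. Q x * indicator {0..<1} x \<noteq> \<infinity>"
      by (intro nn_integral_PInf_AE) auto
    then have pt: "AE x in lebesgue. 2 * ((\<Sum>\<^sub>\<int>k. enorm2 (H (x + of_int k))) * indicator {0..<1} x)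
        \<le> enorm2 (P x) + (Q x)\<^sup>2 * indicator {0..<1} x"
    proof eventually_elim
      case (elim x)
      show ?case
      proof (cases "x \<in> {0..<1}")
        case True
        then have "Q x < \<infinity>" using elim by (simp add: less_top)
        then show ?thesis
          using two_nn_integral_norm_power2_le[of "\<lambda>k. H (x + of_int k)"] True by (simp add: P_def Q_def)
      qed simp
    qed
    have "2 * (\<integral>\<^sub>\<lambda>x. enorm2 (H x))
       = (\<integral>\<^sub>\<lambda>x. 2 * ((\<Sum>\<^sub>\<int>k. enorm2 (H (x + of_int k))) * indicator {0..<1} x))"
      using Hs by (subst nn_integral_split_unit_intervals, measurable, subst nn_integral_cmult)
        (auto intro!: borel_measurable_times_ennreal borel_measurable_nn_integral_int)
    also have "\<dots> \<le> (\<integral>\<^sub>\<lambda>x. enorm2 (P x) + (Q x)\<^sup>2 * indicator {0..<1} x)"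
      by (rule nn_integral_mono_AE[OF pt])
    also have "\<dots> = E + W"
      unfolding main[OF True] W by (rule nn_integral_add) measurable
    finally show ?thesis .
  qed (simp add: not_less top_unique)
qed

text \<open>Apply the unit-spacing bounds to K(x) = H(x/a). The substitution multiplies W and the
  energy by a, but the squared samples by a^2, which leaves the factor 1/a. The sign of n changes
  because \<open>fourier\<close> carries a negative exponent.\<close>

lemma fourier_samples_bounds_scaled:
  assumes H: "integrable lebesgue H" and a: "a > 0"
  defines "W \<equiv> (\<Sum>\<^sub>\<int>k. \<integral>\<^sub>\<lambda>x. enorm (H x) * enorm (H (x + of_int k / a)))"
  defines "E \<equiv> (\<Sum>\<^sub>\<int>n. enorm2 (LINT x|lebesgue. H x * phase (of_int n * a * x)))"
  shows "E \<le> ennreal (1/a) * W" "2 * (ennreal (1/a) * (\<integral>\<^sub>\<lambda>x. enorm2 (H x))) \<le> E + ennreal (1/a) * W"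
proof -
  have Hm [measurable]: "H \<in> borel_measurable lebesgue" using H by auto
  note Hs = lebesgue_measurable_shift[OF Hm]
  define K where "K x = H (0 + (1/a) * x)" for x
  have K: "integrable lebesgue K"
    unfolding K_def using H a by (subst lebesgue_integrable_real_affine_iff) auto
  have nn: "(\<integral>\<^sub>\<lambda>x. g ((1/a) * x)) = ennreal a * (\<integral>\<^sub>\<lambda>x. g x)"
    if "g \<in> borel_measurable lebesgue" for g :: "real \<Rightarrow> ennreal"
  proof -
    have "ennreal a * (\<integral>\<^sub>\<lambda>x. g x) = ennreal a * (ennreal (1/a) * (\<integral>\<^sub>\<lambda>x. g ((1/a) * x)))"
      using nn_integral_real_affine_lebesgue[OF that, of "1/a" 0] a by simp
    also have "\<dots> = (\<integral>\<^sub>\<lambda>x. g ((1/a) * x))"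
      using a by (simp add: mult.assoc[symmetric] ennreal_mult[symmetric])
    finally show ?thesis by simp
  qed
  have fK: "fourier K (of_int n) = of_real a * (LINT x|lebesgue. H x * phase (of_int (- n) * a * x))" for n
  proof -
    have "(LINT x|lebesgue. H x * phase (of_int (- n) * a * x)) = (1/a) *\<^sub>R (LINT x|lebesgue. H (0 + (1/a) * x) * phase (of_int (- n) * a * (0 + (1/a) * x)))"
      using a by (subst lebesgue_integral_real_affine[of "1/a" _ 0]) auto
    also have "\<dots> = (1/a) *\<^sub>R fourier K (of_int n)"
      unfolding fourier_eq_phase K_def using a by (simp add: mult.commute)
    finally show ?thesis using a by (simp add: scaleR_conv_of_real)
  qed
  have E: "(\<Sum>\<^sub>\<int>n. enorm2 (fourier K (of_int n))) = ennreal (a\<^sup>2) * E"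
  proof -
    have "enorm2 (fourier K (of_int n)) = ennreal (a\<^sup>2) * enorm2 (LINT x|lebesgue. H x * phase (of_int (- n) * a * x))" for n
      using a by (simp add: fK norm_mult power_mult_distrib ennreal_mult)
    then show ?thesis
      unfolding E_def using nn_integral_int_uminus[of "\<lambda>n. enorm2 (LINT x|lebesgue. H x * phase (of_int n * a * x))"]
      by (simp add: nn_integral_cmult)
  qed
  have W: "(\<Sum>\<^sub>\<int>k. \<integral>\<^sub>\<lambda>x. enorm (K x) * enorm (K (x + of_int k))) = ennreal a * W"
  proof -
    have "(\<integral>\<^sub>\<lambda>x. enorm (K x) * enorm (K (x + of_int k)))
       = ennreal a * (\<integral>\<^sub>\<lambda>x. enorm (H x) * enorm (H (x + of_int k / a)))" for k
      using nn[of "\<lambda>x. enorm (H x) * enorm (H (x + of_int k / a))"] Hs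
      by (simp add: K_def add_divide_distrib)
    then show ?thesis unfolding W_def by (simp add: nn_integral_cmult)
  qed
  have N: "(\<integral>\<^sub>\<lambda>x. enorm2 (K x)) = ennreal a * (\<integral>\<^sub>\<lambda>x. enorm2 (H x))"
    using nn[of "\<lambda>x. enorm2 (H x)"] by (simp add: K_def)
  have c1: "ennreal (1/a\<^sup>2) * (ennreal (a\<^sup>2) * X) = X" for X
    using a by (simp add: mult.assoc[symmetric] ennreal_mult[symmetric])
  have c2: "ennreal (1/a\<^sup>2) * (ennreal a * X) = ennreal (1/a) * X" for X
    using a by (simp add: mult.assoc[symmetric] ennreal_mult[symmetric] power2_eq_square)
  note b = fourier_samples_bounds[OF K, unfolded E W N]
  show "E \<le> ennreal (1/a) * W"
    using mult_left_mono[OF b(1), of "ennreal (1/a\<^sup>2)"] by (simp only: c1 c2 zero_le simp_thms)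
  show "2 * (ennreal (1/a) * (\<integral>\<^sub>\<lambda>x. enorm2 (H x))) \<le> E + ennreal (1/a) * W"
    using mult_left_mono[OF b(2), of "ennreal (1/a\<^sup>2)"]
    by (simp only: distrib_left c1 c2 zero_le simp_thms mult.left_commute[of _ 2])
qed

text \<open>The inequality 2 p r <= p^2 + r^2 separates F(x) from F(x + c). The half containing |F(x
  + c)|^2 becomes the other half after translating by c and replacing k by -k, so F survives only as
  |F(x)|^2 against a kernel built from h.\<close>

lemma nn_integral_shifted_product_le:
  fixes F h :: "real \<Rightarrow> complex"
  assumes [measurable]: "F \<in> borel_measurable lebesgue" and h [measurable]: "h \<in> borel_measurable lebesgue"
  shows "(\<Sum>\<^sub>\<int>k. \<integral>\<^sub>\<lambda>x. enorm (F x * h x) * enorm (F (x + of_int k * b) * h (x + of_int k * b)))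
    \<le> (\<integral>\<^sub>\<lambda>x. enorm2 (F x) * (enorm (h x) * (\<Sum>\<^sub>\<int>k. enorm (h (x + of_int k * b)))))"
  (is "?L \<le> ?R")
proof -
  have Fs [measurable]: "(\<lambda>x. F (x + c)) \<in> borel_measurable lebesgue" for c by (rule lebesgue_measurable_shift) measurable
  have hs [measurable]: "(\<lambda>x. h (x + c)) \<in> borel_measurable lebesgue" for c by (rule lebesgue_measurable_shift) measurable
  define q where "q c x = enorm2 (F x) * (enorm (h x) * enorm (h (x + c)))" for c x
  have qm [measurable]: "q c \<in> borel_measurable lebesgue" for c unfolding q_def by measurable
  have R: "?R = (\<Sum>\<^sub>\<int>k. \<integral>\<^sub>\<lambda>x. q (of_int k * b) x)"
    by (subst nn_integral_count_space_nn_integral[symmetric]) (simp_all add: q_def nn_integral_cmult)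
  have pt: "enorm (F x * h x) * enorm (F (x + c) * h (x + c))
     \<le> ennreal (1/2) * (q c x + q (- c) (x + c))" for x c
  proof -
    have ab: "p * r \<le> 1/2 * (p\<^sup>2 + r\<^sup>2)" for p r :: real
      using zero_le_power2[of "p - r"] by (simp add: power2_eq_square algebra_simps)
    have "norm (F x * h x) * norm (F (x + c) * h (x + c)) = (norm (F x) * norm (F (x + c))) * (norm (h x) * norm (h (x + c)))"
      by (simp add: norm_mult mult_ac)
    also have "\<dots> \<le> (1/2 * ((norm (F x))\<^sup>2 + (norm (F (x + c)))\<^sup>2)) * (norm (h x) * norm (h (x + c)))"
      by (intro mult_right_mono ab) auto
    also have "\<dots> = 1/2 * ((norm (F x))\<^sup>2 * (norm (h x) * norm (h (x + c))) + (norm (F (x + c)))\<^sup>2 * (norm (h (x + c)) * norm (h x)))"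
      by (simp add: algebra_simps)
    finally have "ennreal (norm (F x * h x) * norm (F (x + c) * h (x + c)))
      \<le> ennreal (1/2 * ((norm (F x))\<^sup>2 * (norm (h x) * norm (h (x + c))) + (norm (F (x + c)))\<^sup>2 * (norm (h (x + c)) * norm (h x))))"
      by (rule ennreal_leI)
    also have "\<dots> = ennreal (1/2) * (q c x + q (- c) (x + c))"
      unfolding q_def by (subst ennreal_mult, simp, simp, subst ennreal_plus, simp, simp) (simp add: ennreal_mult)
    finally show ?thesis by (subst ennreal_mult[symmetric]) auto
  qed
  have "?L \<le> (\<Sum>\<^sub>\<int>k. \<integral>\<^sub>\<lambda>x. ennreal (1/2) * (q (of_int k * b) x + q (- (of_int k * b)) (x + of_int k * b)))"
    by (intro nn_integral_mono pt)
  also have "\<dots> = (\<Sum>\<^sub>\<int>k. ennreal (1/2) * ((\<integral>\<^sub>\<lambda>x. q (of_int k * b) x) + (\<integral>\<^sub>\<lambda>x. q (of_int (- k) * b) x)))"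
  proof (rule nn_integral_cong)
    fix k :: int
    have [measurable]: "(\<lambda>x. q (- (of_int k * b)) (x + of_int k * b)) \<in> borel_measurable lebesgue"
      by (rule lebesgue_measurable_shift) measurable
    have eq: "of_int (- k) * b = - (of_int k * b)" by simp
    have sh: "(\<integral>\<^sub>\<lambda>x. q (- (of_int k * b)) (x + of_int k * b)) = (\<integral>\<^sub>\<lambda>x. q (- (of_int k * b)) x)"
      by (rule nn_integral_lebesgue_shift) measurable
    show "(\<integral>\<^sub>\<lambda>x. ennreal (1/2) * (q (of_int k * b) x + q (- (of_int k * b)) (x + of_int k * b)))
      = ennreal (1/2) * ((\<integral>\<^sub>\<lambda>x. q (of_int k * b) x) + (\<integral>\<^sub>\<lambda>x. q (of_int (- k) * b) x))"
      by (subst nn_integral_cmult, measurable, subst nn_integral_add, measurable) (simp only: sh eq)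
  qed
  also have "\<dots> = ennreal (1/2) * (?R + ?R)"
    unfolding R by (subst nn_integral_cmult, simp, subst nn_integral_add, simp, simp,
      subst nn_integral_int_uminus[of "\<lambda>k. \<integral>\<^sub>\<lambda>x. q (of_int k * b) x"]) simp
  also have "\<dots> = ?R"
  proof -
    have "ennreal (1/2) * (?R + ?R) = (ennreal (1/2) * 2) * ?R" by (simp add: mult_2[symmetric] mult.assoc)
    also have "ennreal (1/2) * 2 = ennreal (1/2 * 2)" by (subst ennreal_mult) auto
    finally show ?thesis by simp
  qed
  finally show ?thesis .
qed

section \<open>Filter banks\<close>

text \<open>The factor \<open>sqrt a\<close> in the filter squares to a and cancels the sampling
  density 1/a. The spacing then enters only through the nodes x + k/a, and T still contains the
  diagonal term k = 0.\<close>

lemma filter_sampling_bounds: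
  fixes h :: "real \<Rightarrow> complex"
  assumes F: "F \<in> L2_space" and h [measurable]: "h \<in> borel_measurable lebesgue" and a: "a > 0"
    and g: "(\<lambda>x. complex_of_real (sqrt a) * h x) \<in> L2_space"
  defines "S \<equiv> (\<Sum>\<^sub>\<int>n. enorm2 (LINT x|lebesgue. F x * cnj (complex_of_real (sqrt a) * h x) * phase (of_int n * a * x)))"
  defines "T \<equiv> (\<integral>\<^sub>\<lambda>x. enorm2 (F x) * (enorm (h x) * (\<Sum>\<^sub>\<int>k. enorm (h (x + of_int k * (1/a))))))"
  shows "S \<le> T" "2 * (\<integral>\<^sub>\<lambda>x. enorm2 (F x) * enorm2 (h x)) \<le> S + T"
proof -
  note [measurable] = L2_space_measurable[OF F]
  define H where "H x = F x * cnj (complex_of_real (sqrt a) * h x)" for x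
  have H: "integrable lebesgue H" unfolding H_def by (rule L2_inner_integrable[OF F g])
  have nH: "norm (H x) = sqrt a * norm (F x * h x)" for x
    using a by (simp add: H_def norm_mult)
  have inv: "ennreal (1/a) * (ennreal a * X) = X" for X
    using a by (simp add: mult.assoc[symmetric] ennreal_mult[symmetric])
  define U where "U = (\<Sum>\<^sub>\<int>k. \<integral>\<^sub>\<lambda>x. enorm (F x * h x) * enorm (F (x + of_int k * (1/a)) * h (x + of_int k * (1/a))))"
  have UT: "U \<le> T" unfolding U_def T_def by (rule nn_integral_shifted_product_le) measurable
  have W: "(\<Sum>\<^sub>\<int>k. \<integral>\<^sub>\<lambda>x. enorm (H x) * enorm (H (x + of_int k / a))) = ennreal a * U"
  proof -
    have "enorm (H x) * enorm (H y) = ennreal a * (enorm (F x * h x) * enorm (F y * h y))" for x y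
    proof -
      have "norm (H x) * norm (H y) = (sqrt a * sqrt a) * (norm (F x * h x) * norm (F y * h y))"
        unfolding nH by (simp only: mult_ac)
      then have "norm (H x) * norm (H y) = a * (norm (F x * h x) * norm (F y * h y))" using a by simp
      then show ?thesis using a by (simp add: ennreal_mult[symmetric])
    qed
    then show ?thesis unfolding U_def by (simp add: nn_integral_cmult)
  qed
  have N: "(\<integral>\<^sub>\<lambda>x. enorm2 (H x)) = ennreal a * (\<integral>\<^sub>\<lambda>x. enorm2 (F x) * enorm2 (h x))"
  proof -
    have "enorm2 (H x) = ennreal a * (enorm2 (F x) * enorm2 (h x))" for x
      using a by (simp add: nH norm_mult power_mult_distrib ennreal_mult)
    then show ?thesis by (simp add: nn_integral_cmult)
  qed
  note b = fourier_samples_bounds_scaled[OF H a, unfolded W N inv, unfolded H_def, folded S_def]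
  show "S \<le> T" using b(1) UT by (rule order_trans)
  show "2 * (\<integral>\<^sub>\<lambda>x. enorm2 (F x) * enorm2 (h x)) \<le> S + T"
    using b(2) add_left_mono[OF UT, of S] by (rule order_trans)
qed

lemma filter_bank_sampling_bounds:
  fixes h :: "int \<Rightarrow> real \<Rightarrow> complex"
  assumes F: "F \<in> L2_space" and h [measurable]: "\<And>m. h m \<in> borel_measurable lebesgue" and a: "\<And>m. a m > 0"
    and g: "\<And>m. (\<lambda>x. complex_of_real (sqrt (a m)) * h m x) \<in> L2_space"
  defines "S \<equiv> (\<Sum>\<^sub>\<int>m. \<Sum>\<^sub>\<int>n. enorm2 (LINT x|lebesgue. F x * cnj (complex_of_real (sqrt (a m)) * h m x) * phase (of_int n * a m * x)))"
  defines "\<Theta> \<equiv> (\<lambda>x. \<Sum>\<^sub>\<int>m. enorm (h m x) * (\<Sum>\<^sub>\<int>k. enorm (h m (x + of_int k * (1 / a m)))))"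
  shows "S \<le> (\<integral>\<^sub>\<lambda>x. enorm2 (F x) * \<Theta> x)"
    "2 * (\<integral>\<^sub>\<lambda>x. enorm2 (F x) * (\<Sum>\<^sub>\<int>m. enorm2 (h m x)))
      \<le> S + (\<integral>\<^sub>\<lambda>x. enorm2 (F x) * \<Theta> x)"
proof -
  note [measurable] = L2_space_measurable[OF F]
  define R where "R m x = (\<Sum>\<^sub>\<int>k. enorm (h m (x + of_int k * (1 / a m))))" for m x
  have hs [measurable]: "(\<lambda>x. h m (x + c)) \<in> borel_measurable lebesgue" for m c by (rule lebesgue_measurable_shift) (rule h)
  have R [measurable]: "R m \<in> borel_measurable lebesgue" for m
    unfolding R_def by (intro borel_measurable_nn_integral_int) measurable
  define T where "T m = (\<integral>\<^sub>\<lambda>x. enorm2 (F x) * (enorm (h m x) * R m x))" for m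
  define S' where "S' m = (\<Sum>\<^sub>\<int>n. enorm2 (LINT x|lebesgue. F x * cnj (complex_of_real (sqrt (a m)) * h m x) * phase (of_int n * a m * x)))" for m
  have sumT: "(\<Sum>\<^sub>\<int>m. T m) = (\<integral>\<^sub>\<lambda>x. enorm2 (F x) * \<Theta> x)"
    unfolding T_def \<Theta>_def R_def[symmetric]
    by (subst nn_integral_count_space_nn_integral[symmetric]) (simp_all add: nn_integral_cmult)
  have S: "S = (\<Sum>\<^sub>\<int>m. S' m)" unfolding S_def S'_def ..
  note b = filter_sampling_bounds[OF F h a g, folded S'_def R_def, folded T_def]
  show "S \<le> (\<integral>\<^sub>\<lambda>x. enorm2 (F x) * \<Theta> x)"
    unfolding S sumT[symmetric] by (intro nn_integral_mono b)
  have "2 * (\<integral>\<^sub>\<lambda>x. enorm2 (F x) * (\<Sum>\<^sub>\<int>m. enorm2 (h m x)))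
     = (\<Sum>\<^sub>\<int>m. 2 * (\<integral>\<^sub>\<lambda>x. enorm2 (F x) * enorm2 (h m x)))"
    by (subst nn_integral_cmult, simp, subst nn_integral_count_space_nn_integral[symmetric]) (simp_all add: nn_integral_cmult)
  also have "\<dots> \<le> (\<Sum>\<^sub>\<int>m. S' m + T m)"
    by (intro nn_integral_mono b)
  also have "\<dots> = S + (\<integral>\<^sub>\<lambda>x. enorm2 (F x) * \<Theta> x)"
    unfolding S sumT[symmetric] by (rule nn_integral_add) auto
  finally show "2 * (\<integral>\<^sub>\<lambda>x. enorm2 (F x) * (\<Sum>\<^sub>\<int>m. enorm2 (h m x)))
      \<le> S + (\<integral>\<^sub>\<lambda>x. enorm2 (F x) * \<Theta> x)" .
qed

lemma warped_coefficients_sum: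
  assumes f: "f \<in> inv_fourier_space D" and g: "\<And>m. warped_filter D \<Phi> \<theta> a m \<in> L2_space"
  shows "(\<Sum>\<^sub>\<infinity>i. enorm2 (L2_inner f (warped_filter_bank D \<Phi> \<theta> a i)))
    = (\<Sum>\<^sub>\<int>m. \<Sum>\<^sub>\<int>n. enorm2 (LINT x|lebesgue. fourier_L2 f x * cnj (warped_filter D \<Phi> \<theta> a m x) * phase (of_int n * a m * x)))"
proof -
  have f2: "f \<in> L2_space" using f by (simp add: inv_fourier_space_def)
  have "(\<Sum>\<^sub>\<infinity>i. enorm2 (L2_inner f (warped_filter_bank D \<Phi> \<theta> a i)))
     = (\<integral>\<^sup>+i. enorm2 (L2_inner f (warped_filter_bank D \<Phi> \<theta> a i)) \<partial>count_space UNIV)"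
    by (rule nn_integral_count_space_eq_infsum[symmetric])
       (simp_all add: finite_prod infinite_UNIV_int)
  also have "\<dots> = (\<Sum>\<^sub>\<int>m. \<Sum>\<^sub>\<int>n. enorm2 (L2_inner f (warped_filter_bank D \<Phi> \<theta> a (m, n))))"
    by (rule nn_integral_fst_count_space[symmetric])
  finally show ?thesis
    by (simp add: warped_filter_bank_def L2_inner_translate_inv_fourier[OF f2 g])
qed

lemma inv_fourier_space_norm:
  assumes "f \<in> inv_fourier_space D"
  shows "fourier_L2 f \<in> L2_space" "L2_norm (fourier_L2 f) = L2_norm f"
    "AE \<xi> in lebesgue. \<xi> \<notin> D \<longrightarrow> fourier_L2 f \<xi> = 0"
  using assms has_fourier_L2_norm[OF has_fourier_fourier_L2]
  by (auto simp: inv_fourier_space_def L2_on_def)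

section \<open>Sums of power decay over integers and lattices\<close>

lemma nn_integral_int_le:
  "(\<Sum>\<^sub>\<int>k. f k) \<le> (\<Sum>n. f (int n)) + (\<Sum>n. f (- int n))"
proof -
  have 1: "(\<Sum>\<^sub>\<int>k. f k * indicator (range e) k) = (\<Sum>n. f (e n))" if "inj e" for e :: "nat \<Rightarrow> int"
  proof -
    have "(\<Sum>\<^sub>\<int>k. f k * indicator (range e) k) = (\<integral>\<^sup>+k. f k \<partial>count_space (range e))"
      by (simp add: nn_integral_count_space_indicator)
    also have "\<dots> = (\<integral>\<^sup>+n. f (e n) \<partial>count_space UNIV)"
      by (rule nn_integral_bij_count_space[symmetric]) (use that in \<open>simp add: bij_betw_def\<close>)
    finally show ?thesis by (simp add: nn_integral_count_space_nat)
  qed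
  have "(\<Sum>\<^sub>\<int>k. f k)
      \<le> (\<Sum>\<^sub>\<int>k. f k * indicator (range int) k + f k * indicator (range (\<lambda>n. - int n)) k)"
  proof (rule nn_integral_mono)
    fix k :: int
    have "k \<in> range int \<or> k \<in> range (\<lambda>n. - int n)"
    proof (cases "k \<ge> 0")
      case True
      then have "k = int (nat k)" by simp
      then show ?thesis by blast
    next
      case False
      then have "k = - int (nat (- k))" by simp
      then show ?thesis by blast
    qed
    then show "f k \<le> f k * indicator (range int) k + f k * indicator (range (\<lambda>n. - int n)) k"
      by (auto simp: indicator_def)
  qed
  also have "\<dots> = (\<Sum>n. f (int n)) + (\<Sum>n. f (- int n))"
    by (subst nn_integral_add) (simp_all add: 1[of int] 1[of "\<lambda>n. - int n"] inj_on_def)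
  finally show ?thesis .
qed

text \<open>Because \<open>0 powr _ = 0\<close> the term k = 0 vanishes, so for p > 1 this is twice
  the Riemann zeta value at p.\<close>

definition int_zeta :: "real \<Rightarrow> ennreal" where
  "int_zeta p = (\<Sum>\<^sub>\<int>k. ennreal (\<bar>of_int k\<bar> powr (- p)))"

lemma int_zeta_finite:
  assumes "p > 1"
  shows "int_zeta p < \<infinity>"
proof -
  have s: "summable (\<lambda>n. real n powr (- p))" using assms by (simp add: summable_real_powr_iff)
  have "int_zeta p \<le> (\<Sum>n. ennreal (real n powr (- p))) + (\<Sum>n. ennreal (real n powr (- p)))"
    unfolding int_zeta_def using nn_integral_int_le[of "\<lambda>k. ennreal (\<bar>of_int k\<bar> powr (- p))"] by simp
  also have "\<dots> < \<infinity>" using s by (simp add: suminf_ennreal2)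
  finally show ?thesis .
qed

text \<open>With p = 1 + \<epsilon> this is the reciprocal of \<open>w1\<close>; composed with
  \<open>weight_integral v 0\<close> it is the reciprocal of \<open>w2\<close>.\<close>

definition decay :: "real \<Rightarrow> real \<Rightarrow> real" where
  "decay p x = (1 + \<bar>x\<bar>) powr (- p)"

lemma decay_nonneg [simp]: "0 \<le> decay p x"
  by (simp add: decay_def)

lemma decay_antimono: "p \<ge> 0 \<Longrightarrow> \<bar>y\<bar> \<le> \<bar>x\<bar> \<Longrightarrow> decay p x \<le> decay p y"
  unfolding decay_def by (intro powr_mono2') auto

lemma decay_le_1: "p \<ge> 0 \<Longrightarrow> decay p x \<le> 1"
  using decay_antimono[of p 0 x] by (simp add: decay_def)

text \<open>For k different from 0, |x + k b| >= |k| b - b/2 >= |k| b/2. The omitted node k = 0 is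
  the only one that does not become small as b grows.\<close>

lemma decay_punctured_sum_le:
  assumes p: "p > 1" and b: "b > 0" and x: "\<bar>x\<bar> \<le> b / 2"
  shows "(\<Sum>\<^sub>\<int>k. ennreal (decay p (x + of_int k * b)) * indicator (- {0}) k)
    \<le> ennreal ((b / 2) powr (- p)) * int_zeta p"
proof -
  have "ennreal (decay p (x + of_int k * b)) * indicator (- {0}) k \<le> ennreal ((b / 2) powr (- p)) * ennreal (\<bar>of_int k\<bar> powr (- p))" for k :: int
  proof (cases "k = 0")
    case False
    then have k1: "1 \<le> \<bar>real_of_int k\<bar>" by linarith
    have "\<bar>of_int k\<bar> * b \<le> \<bar>x + of_int k * b\<bar> + \<bar>x\<bar>" using b by (simp add: abs_mult[symmetric] flip: abs_of_pos)
    moreover have "b / 2 \<le> \<bar>of_int k\<bar> * (b / 2)" using k1 b by (simp add: mult_le_cancel_right1)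
    ultimately have "(b / 2) * \<bar>of_int k\<bar> \<le> 1 + \<bar>x + of_int k * b\<bar>" using x by (simp add: algebra_simps)
    then have "decay p (x + of_int k * b) \<le> ((b / 2) * \<bar>of_int k\<bar>) powr (- p)"
      unfolding decay_def using b k1 p by (intro powr_mono2') auto
    also have "\<dots> = (b / 2) powr (- p) * \<bar>of_int k\<bar> powr (- p)" by (rule powr_mult)
    finally show ?thesis using False by (simp add: ennreal_mult[symmetric] ennreal_leI)
  qed simp
  then have "(\<Sum>\<^sub>\<int>k. ennreal (decay p (x + of_int k * b)) * indicator (- {0}) k)
    \<le> (\<Sum>\<^sub>\<int>k. ennreal ((b / 2) powr (- p)) * ennreal (\<bar>of_int k\<bar> powr (- p)))"
    by (intro nn_integral_mono)
  then show ?thesis by (simp add: nn_integral_cmult int_zeta_def)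
qed

lemma nn_integral_int_split_0:
  "(\<Sum>\<^sub>\<int>k. f k) = f 0 + (\<Sum>\<^sub>\<int>k. f k * indicator (- {0}) k)"
proof -
  have "(\<Sum>\<^sub>\<int>k. f k) = (\<Sum>\<^sub>\<int>k. f k * indicator {0} k + f k * indicator (- {0}) k)"
    by (intro nn_integral_cong) (auto simp: indicator_def)
  also have "\<dots> = (\<Sum>\<^sub>\<int>k. f k * indicator {0} k) + (\<Sum>\<^sub>\<int>k. f k * indicator (- {0}) k)"
    by (rule nn_integral_add) auto
  also have "(\<Sum>\<^sub>\<int>k. f k * indicator {0} k) = (\<Sum>\<^sub>\<int>k. f 0 * indicator {0} k)"
    by (intro nn_integral_cong) (auto simp: indicator_def)
  finally show ?thesis by (simp add: nn_integral_cmult)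
qed

definition decay_bound :: "real \<Rightarrow> real \<Rightarrow> ennreal" where
  "decay_bound p b = 1 + ennreal ((b / 2) powr (- p)) * int_zeta p"

lemma decay_bound_finite: "p > 1 \<Longrightarrow> decay_bound p b < \<infinity>"
  using int_zeta_finite[of p] by (simp add: decay_bound_def ennreal_mult_less_top)

lemma decay_bound_antimono: "p > 1 \<Longrightarrow> 0 < b \<Longrightarrow> b \<le> c \<Longrightarrow> decay_bound p c \<le> decay_bound p b"
  unfolding decay_bound_def by (intro add_left_mono mult_right_mono ennreal_leI powr_mono2') auto

text \<open>Reindexing by the integer nearest to x/b moves the node of least modulus to index 0. It
  contributes at most 1, the first summand of \<open>decay_bound\<close>, and the other nodes are
  those of the punctured sum; hence the bound does not depend on x.\<close>

lemma decay_sum_le: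
  assumes p: "p > 1" and b: "b > 0"
  shows "(\<Sum>\<^sub>\<int>k. ennreal (decay p (x + of_int k * b))) \<le> decay_bound p b"
proof -
  define j where "j = round (x / b)"
  define y where "y = x - of_int j * b"
  have "\<bar>of_int j - x / b\<bar> \<le> 1 / 2" unfolding j_def by (rule of_int_round_abs_le)
  then have "\<bar>of_int j - x / b\<bar> * b \<le> 1 / 2 * b" using b by (intro mult_right_mono) auto
  moreover have "\<bar>of_int j - x / b\<bar> * b = \<bar>(of_int j - x / b) * b\<bar>" using b by (simp add: abs_mult)
  moreover have "(of_int j - x / b) * b = - y" using b by (simp add: y_def algebra_simps)
  ultimately have y: "\<bar>y\<bar> \<le> b / 2" by simp
  have "(\<Sum>\<^sub>\<int>k. ennreal (decay p (x + of_int k * b)))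
      = (\<Sum>\<^sub>\<int>k. ennreal (decay p (y + of_int (k + j) * b)))"
    by (intro nn_integral_cong) (simp add: y_def algebra_simps)
  also have "\<dots> = (\<Sum>\<^sub>\<int>k. ennreal (decay p (y + of_int k * b)))"
    by (rule nn_integral_int_shift)
  also have "\<dots> = ennreal (decay p y) + (\<Sum>\<^sub>\<int>k. ennreal (decay p (y + of_int k * b)) * indicator (- {0}) k)"
    using nn_integral_int_split_0[of "\<lambda>k. ennreal (decay p (y + of_int k * b))"] by simp
  also have "\<dots> \<le> decay_bound p b"
    unfolding decay_bound_def using decay_le_1[of p y] p
    by (intro add_mono decay_punctured_sum_le b y) (auto simp: ennreal_le_1)
  finally show ?thesis .
qed

lemma decay_sum_centers_le:
  assumes "p > 1"
  shows "(\<Sum>\<^sub>\<int>m. ennreal (decay p (t - of_int m))) \<le> decay_bound p 1"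
  using decay_sum_le[OF assms, of 1 t] nn_integral_int_uminus[of "\<lambda>k. ennreal (decay p (t + of_int k))"] by simp

text \<open>For |t - m| <= M the point x m lies within half a step of 0, so the punctured sum over k
  has the small factor (b0/2)^(-(1+\<epsilon>)). For the other m the sum over k is only bounded,
  uniformly because b0 >= 1, and the smallness comes from the factor in t - m. Each m is estimated
  by the sum of the two bounds, so that all sums over m run over every integer.\<close>

lemma off_diagonal_bound:
  fixes \<beta> :: "int \<Rightarrow> real" and \<gamma> :: "int \<Rightarrow> int \<Rightarrow> real"
  assumes \<epsilon>: "\<epsilon> > 0" and C: "C \<ge> 0" and M: "M \<ge> 0" and b0: "b0 \<ge> 1"
    and b: "\<And>m. b0 \<le> b m"
    and \<beta>: "\<And>m. \<beta> m \<le> C * decay (1 + \<epsilon>) (t - of_int m)"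
    and \<gamma>: "\<And>m k. \<gamma> m k \<le> C * decay (1 + \<epsilon>) (x m + of_int k * b m)"
    and x: "\<And>m. \<bar>t - of_int m\<bar> \<le> M \<Longrightarrow> \<bar>x m\<bar> \<le> b0 / 2"
  shows "(\<Sum>\<^sub>\<int>m. ennreal (\<beta> m) * (\<Sum>\<^sub>\<int>k. ennreal (\<gamma> m k) * indicator (- {0}) k))
    \<le> ennreal (C\<^sup>2) * (ennreal ((b0 / 2) powr (- (1 + \<epsilon>))) * (decay_bound (1 + \<epsilon>) 1 * int_zeta (1 + \<epsilon>))
       + ennreal ((1 + M) powr (- (\<epsilon> / 2))) * (decay_bound (1 + \<epsilon> / 2) 1 * decay_bound (1 + \<epsilon>) 1))"
    (is "?L \<le> _")
proof -
  let ?p = "1 + \<epsilon>" and ?q = "1 + \<epsilon> / 2"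
  let ?e = "\<lambda>p m. ennreal (decay p (t - of_int m))" and ?r = "\<lambda>m k. ennreal (decay (1 + \<epsilon>) (x m + of_int k * b m))"
  let ?X = "ennreal ((b0 / 2) powr (- ?p)) * int_zeta ?p" and ?Y = "ennreal ((1 + M) powr (- (\<epsilon> / 2)))"
  have p: "?p > 1" and q: "?q > 1" using \<epsilon> by auto
  have \<gamma>sum: "(\<Sum>\<^sub>\<int>k. ennreal (\<gamma> m k) * indicator (- {0}) k)
      \<le> ennreal C * (\<Sum>\<^sub>\<int>k. ?r m k * indicator (- {0}) k)" for m
  proof -
    have "(\<Sum>\<^sub>\<int>k. ennreal (\<gamma> m k) * indicator (- {0}) k)
      \<le> (\<Sum>\<^sub>\<int>k. ennreal C * (?r m k * indicator (- {0}) k))"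
      using \<gamma>[of m] C by (intro nn_integral_mono) (auto simp: indicator_def ennreal_mult[symmetric] intro!: ennreal_leI)
    then show ?thesis by (simp add: nn_integral_cmult)
  qed
  have pt: "ennreal (\<beta> m) * (\<Sum>\<^sub>\<int>k. ennreal (\<gamma> m k) * indicator (- {0}) k)
     \<le> ennreal (C\<^sup>2) * (?X * ?e ?p m + (?Y * decay_bound ?p 1) * ?e ?q m)" for m
  proof -
    have C2: "ennreal (C\<^sup>2) = ennreal C * ennreal C" using C by (simp add: power2_eq_square ennreal_mult)
    have \<beta>': "ennreal (\<beta> m) \<le> ennreal C * ?e ?p m"
      using \<beta>[of m] C by (simp add: ennreal_mult[symmetric] ennreal_leI)
    have "ennreal (\<beta> m) * (\<Sum>\<^sub>\<int>k. ennreal (\<gamma> m k) * indicator (- {0}) k)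
       \<le> (ennreal C * ?e ?p m) * (ennreal C * (\<Sum>\<^sub>\<int>k. ?r m k * indicator (- {0}) k))"
      (is "_ \<le> (_ * ?d) * (_ * ?s)") by (intro mult_mono \<beta>' \<gamma>sum) auto
    also have "\<dots> = ennreal (C\<^sup>2) * (?s * ?d)" unfolding C2 by (simp only: mult_ac)
    also have "?s * ?d \<le> ?X * ?e ?p m + (?Y * decay_bound ?p 1) * ?e ?q m"
    proof (cases "\<bar>t - of_int m\<bar> \<le> M")
      case True
      have bm: "0 < b m" "\<bar>x m\<bar> \<le> b m / 2" using b0 b[of m] x[OF True] by auto
      have "?s \<le> ennreal ((b m / 2) powr (- ?p)) * int_zeta ?p" by (rule decay_punctured_sum_le[OF p bm])
      also have "\<dots> \<le> ?X" using b0 b[of m] p by (intro mult_right_mono ennreal_leI powr_mono2') auto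
      finally have "?s * ?d \<le> ?X * ?d" by (intro mult_right_mono) auto
      then show ?thesis by (rule order_trans) simp
    next
      case False
      have "?s \<le> (\<Sum>\<^sub>\<int>k. ?r m k)"
        by (intro nn_integral_mono) (auto simp: indicator_def)
      also have "\<dots> \<le> decay_bound ?p (b m)" using b0 b[of m] by (intro decay_sum_le p) auto
      also have "\<dots> \<le> decay_bound ?p 1" using b0 b[of m] by (intro decay_bound_antimono p) auto
      finally have s: "?s \<le> decay_bound ?p 1" .
      \<comment> \<open>The exponent 1 + \<epsilon> is split: \<epsilon>/2 yields the small factor
        in M, and 1 + \<epsilon>/2 still exceeds 1 and leaves a convergent sum over m.\<close>
      have "decay ?p (t - of_int m) = (1 + \<bar>t - of_int m\<bar>) powr (- (\<epsilon> / 2)) * decay ?q (t - of_int m)"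
      proof -
        have "- ?p = - (\<epsilon> / 2) + - ?q" by simp
        then show ?thesis unfolding decay_def by (simp only: powr_add)
      qed
      also have "\<dots> \<le> (1 + M) powr (- (\<epsilon> / 2)) * decay ?q (t - of_int m)"
        using False M \<epsilon> by (intro mult_right_mono powr_mono2') auto
      finally have "?d \<le> ?Y * ?e ?q m"
        by (simp add: ennreal_mult[symmetric] ennreal_leI)
      then have "?s * ?d \<le> decay_bound ?p 1 * (?Y * ?e ?q m)"
        using s by (intro mult_mono) auto
      also have "\<dots> = (?Y * decay_bound ?p 1) * ?e ?q m" by (simp only: mult_ac)
      finally show ?thesis by (rule order_trans) simp
    qed
    then have "ennreal (C\<^sup>2) * (?s * ?d) \<le> ennreal (C\<^sup>2) * (?X * ?e ?p m + (?Y * decay_bound ?p 1) * ?e ?q m)"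
      by (intro mult_left_mono) auto
    finally show ?thesis .
  qed
  have "?L \<le> (\<Sum>\<^sub>\<int>m. ennreal (C\<^sup>2) * (?X * ?e ?p m + (?Y * decay_bound ?p 1) * ?e ?q m))"
    by (intro nn_integral_mono pt)
  also have "\<dots> = ennreal (C\<^sup>2) * (?X * (\<Sum>\<^sub>\<int>m. ?e ?p m)
      + (?Y * decay_bound ?p 1) * (\<Sum>\<^sub>\<int>m. ?e ?q m))"
    by (simp add: nn_integral_cmult nn_integral_add)
  also have "\<dots> \<le> ennreal (C\<^sup>2) * (?X * decay_bound ?p 1 + (?Y * decay_bound ?p 1) * decay_bound ?q 1)"
    by (intro mult_left_mono add_mono decay_sum_centers_le p q) auto
  finally show ?thesis by (simp only: mult_ac)
qed

text \<open>The version for the Bessel bound: the node k = 0 is kept and any positive spacing b0 is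
  allowed, so the result is finite but not small.\<close>

lemma full_sum_bound:
  fixes \<beta> :: "int \<Rightarrow> real" and \<gamma> :: "int \<Rightarrow> int \<Rightarrow> real"
  assumes p: "p > 1" and C: "C \<ge> 0" and b0: "b0 > 0" and b: "\<And>m. b0 \<le> b m"
    and \<beta>: "\<And>m. \<beta> m \<le> C * decay p (t - of_int m)"
    and \<gamma>: "\<And>m k. \<gamma> m k \<le> C * decay p (x m + of_int k * b m)"
  shows "(\<Sum>\<^sub>\<int>m. ennreal (\<beta> m) * (\<Sum>\<^sub>\<int>k. ennreal (\<gamma> m k)))
    \<le> ennreal (C\<^sup>2) * (decay_bound p 1 * decay_bound p b0)"
proof -
  have pt: "ennreal (\<beta> m) * (\<Sum>\<^sub>\<int>k. ennreal (\<gamma> m k))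
     \<le> (ennreal (C\<^sup>2) * decay_bound p b0) * ennreal (decay p (t - of_int m))" for m
  proof -
    have "(\<Sum>\<^sub>\<int>k. ennreal (\<gamma> m k))
      \<le> (\<Sum>\<^sub>\<int>k. ennreal C * ennreal (decay p (x m + of_int k * b m)))"
      using \<gamma>[of m] C by (intro nn_integral_mono) (auto simp: ennreal_mult[symmetric] intro!: ennreal_leI)
    also have "\<dots> = ennreal C * (\<Sum>\<^sub>\<int>k. ennreal (decay p (x m + of_int k * b m)))"
      by (simp add: nn_integral_cmult)
    also have "\<dots> \<le> ennreal C * decay_bound p (b m)"
      using b0 b[of m] by (intro mult_left_mono decay_sum_le p) auto
    also have "\<dots> \<le> ennreal C * decay_bound p b0"
      using b0 b[of m] by (intro mult_left_mono decay_bound_antimono p) auto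
    finally have "ennreal (\<beta> m) * (\<Sum>\<^sub>\<int>k. ennreal (\<gamma> m k))
       \<le> (ennreal C * ennreal (decay p (t - of_int m))) * (ennreal C * decay_bound p b0)"
      using \<beta>[of m] C by (intro mult_mono) (auto simp: ennreal_mult[symmetric] ennreal_leI)
    also have "\<dots> = (ennreal (C\<^sup>2) * decay_bound p b0) * ennreal (decay p (t - of_int m))"
      using C by (simp add: power2_eq_square ennreal_mult mult_ac)
    finally show ?thesis .
  qed
  have "(\<Sum>\<^sub>\<int>m. ennreal (\<beta> m) * (\<Sum>\<^sub>\<int>k. ennreal (\<gamma> m k)))
    \<le> (\<Sum>\<^sub>\<int>m. (ennreal (C\<^sup>2) * decay_bound p b0) * ennreal (decay p (t - of_int m)))"
    by (intro nn_integral_mono pt)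
  also have "\<dots> = (ennreal (C\<^sup>2) * decay_bound p b0) * (\<Sum>\<^sub>\<int>m. ennreal (decay p (t - of_int m)))"
    by (simp add: nn_integral_cmult)
  also have "\<dots> \<le> (ennreal (C\<^sup>2) * decay_bound p b0) * decay_bound p 1"
    by (intro mult_left_mono decay_sum_centers_le p) auto
  finally show ?thesis by (simp only: mult_ac)
qed

section \<open>Warping functions\<close>

text \<open>A differentiable map of the line sends null sets to null sets, so the image under g of
  the exceptional set of Q is null. Used with the inverse of the warping function to transport
  almost-everywhere statements to D, and with translations.\<close>

lemma AE_differentiable_preimage:
  fixes g :: "real \<Rightarrow> real"
  assumes Q: "AE y in lebesgue. Q y" and g: "g differentiable_on UNIV"
  shows "AE x in lebesgue. \<forall>y. g y = x \<longrightarrow> Q y"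
proof -
  obtain N where N: "{y \<in> space lebesgue. \<not> Q y} \<subseteq> N" "N \<in> null_sets lebesgue"
    using Q by (auto elim!: AE_E simp: null_sets_def)
  have "negligible (g ` N)"
    using N(2) differentiable_on_subset[OF g]
    by (intro negligible_differentiable_image_negligible) (auto simp: negligible_iff_null_sets)
  then have "AE x in lebesgue. x \<notin> g ` N"
    by (intro AE_not_in) (simp add: negligible_iff_null_sets)
  then show ?thesis
    by eventually_elim (use N(1) in auto)
qed

context
  fixes D :: "real set" and \<Phi> :: "real \<Rightarrow> real"
  assumes W: "warping_function D \<Phi>"
begin

lemma inv_warp_mem: "inv_into D \<Phi> y \<in> D" and warp_inv_warp: "\<Phi> (inv_into D \<Phi> y) = y"
  and inv_warp_warp: "\<xi> \<in> D \<Longrightarrow> inv_into D \<Phi> (\<Phi> \<xi>) = \<xi>"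
proof -
  have bij: "bij_betw \<Phi> D UNIV" using W by (simp add: warping_function_def C1_diffeo_onto_reals_def)
  then have "y \<in> \<Phi> ` D" by (simp add: bij_betw_def)
  then show "inv_into D \<Phi> y \<in> D" "\<Phi> (inv_into D \<Phi> y) = y" by (auto intro: inv_into_into f_inv_into_f)
  show "\<xi> \<in> D \<Longrightarrow> inv_into D \<Phi> (\<Phi> \<xi>) = \<xi>" using bij by (simp add: bij_betw_def)
qed

lemma inv_warp_derivative: "(inv_into D \<Phi> has_real_derivative warp_weight D \<Phi> x) (at x)"
  using W unfolding warping_function_def C1_diffeo_onto_reals_def C1_on_def warp_weight_def
  by (simp add: DERIV_deriv_iff_real_differentiable)

lemma inv_warp_differentiable_on: "inv_into D \<Phi> differentiable_on S"
  using inv_warp_derivative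
  by (auto simp: differentiable_on_def has_field_derivative_def differentiable_def intro: has_derivative_at_withinI)

lemma AE_warp:
  assumes "AE y in lebesgue. Q y"
  shows "AE \<xi> in lebesgue. \<xi> \<in> D \<longrightarrow> Q (\<Phi> \<xi>)"
  using AE_differentiable_preimage[OF assms inv_warp_differentiable_on] by eventually_elim (auto simp: inv_warp_warp)

text \<open>Preimages of Lebesgue sets under a continuous map need not be Lebesgue sets, so
  composition alone does not suffice. Here the preimage under \<Phi> is the image under its
  differentiable inverse, and differentiable maps of the line preserve Lebesgue measurability of
  sets.\<close>

lemma measurable_warp:
  fixes \<theta> :: "real \<Rightarrow> complex"
  assumes [measurable]: "\<theta> \<in> borel_measurable lebesgue"
  shows "(\<lambda>\<xi>. if \<xi> \<in> D then \<theta> (\<Phi> \<xi>) else 0) \<in> borel_measurable lebesgue"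
proof (rule measurableI)
  fix A :: "complex set" assume [measurable]: "A \<in> sets borel"
  have D [measurable]: "D \<in> sets lebesgue"
    using W by (auto simp: warping_function_def)
  have "\<theta> -` A \<inter> space lebesgue \<in> sets lebesgue" by measurable
  then have "inv_into D \<Phi> ` (\<theta> -` A) \<in> sets lebesgue"
    by (intro differentiable_image_in_sets_lebesgue inv_warp_differentiable_on) auto
  moreover have "inv_into D \<Phi> ` (\<theta> -` A) = {\<xi> \<in> D. \<theta> (\<Phi> \<xi>) \<in> A}"
  proof (intro set_eqI iffI)
    fix \<xi> assume "\<xi> \<in> {\<xi> \<in> D. \<theta> (\<Phi> \<xi>) \<in> A}"
    then have "\<xi> = inv_into D \<Phi> (\<Phi> \<xi>)" "\<Phi> \<xi> \<in> \<theta> -` A" using inv_warp_warp by auto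
    then show "\<xi> \<in> inv_into D \<Phi> ` (\<theta> -` A)" by blast
  qed (auto simp: inv_warp_mem warp_inv_warp)
  ultimately have 1: "{\<xi> \<in> D. \<theta> (\<Phi> \<xi>) \<in> A} \<in> sets lebesgue" by simp
  have "(\<lambda>\<xi>. if \<xi> \<in> D then \<theta> (\<Phi> \<xi>) else 0) -` A \<inter> space lebesgue
      = {\<xi> \<in> D. \<theta> (\<Phi> \<xi>) \<in> A} \<union> (if 0 \<in> A then - D else {})"
    by (auto split: if_splits)
  also have "\<dots> \<in> sets lebesgue" using 1 D by (auto simp: Compl_in_sets_lebesgue)
  finally show "(\<lambda>\<xi>. if \<xi> \<in> D then \<theta> (\<Phi> \<xi>) else 0) -` A \<inter> space lebesgue \<in> sets lebesgue" .
qed simp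

end

section \<open>The integral of the weight and distances after unwarping\<close>

lemma weight_integral_derivative:
  assumes "weight v"
  shows "(weight_integral v 0 has_real_derivative v y) (at y)"
proof -
  \<comment> \<open>The interval contains the base point 0 and has y in its interior, so the
    one-sided form of the fundamental theorem gives a full derivative for either sign of y.\<close>
  define a b where "a = min 0 y - 1" and "b = max 0 y + 1"
  have ab: "a \<le> 0" "0 \<le> b" "a < y" "y < b" by (auto simp: a_def b_def)
  have cont: "continuous_on {a..b} v"
    using assms unfolding weight_def by (blast intro: continuous_on_subset)
  have "((\<lambda>u. LBINT \<tau>=ereal 0..ereal u. v \<tau>) has_vector_derivative v y) (at y within {a..b})"
    by (rule interval_integral_FTC2[OF ab(1,2) cont]) (use ab in linarith)+
  moreover have "at y within {a..b} = at y"
    by (rule at_within_interior) (use ab in simp)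
  moreover have "weight_integral v 0 = (\<lambda>u. LBINT \<tau>=ereal 0..ereal u. v \<tau>)"
    by (rule ext) (rule weight_integral_def)
  ultimately show ?thesis
    by (simp only: has_real_derivative_iff_has_vector_derivative)
qed

lemma weight_integral_0 [simp]: "weight_integral v 0 0 = 0"
  unfolding weight_integral_def by (rule interval_integral_endpoints_same)

lemma weight_integral_mono:
  assumes "weight v" "x \<le> y"
  shows "weight_integral v 0 x \<le> weight_integral v 0 y"
  by (rule DERIV_nonneg_imp_nondecreasing[OF assms(2)])
     (use weight_integral_derivative[OF assms(1)] assms(1) in \<open>auto simp: weight_def intro: less_imp_le\<close>)

text \<open>As functions of s, the derivative w(c + s) of the inverse warp at c + s is at most v(s)
  w(c), the derivative of w(c) V(0, s). So both the inverse warp and the difference of the two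
  functions are nondecreasing, which compares the increments on either side of 0.\<close>

lemma inv_warp_distance_le:
  assumes W: "warping_function D \<Phi>" and v: "weight v" and mod: "moderate_weight v (warp_weight D \<Phi>)"
  shows "\<bar>inv_into D \<Phi> (c + y) - inv_into D \<Phi> c\<bar> \<le> warp_weight D \<Phi> c * \<bar>weight_integral v 0 y\<bar>"
proof -
  let ?\<Psi> = "inv_into D \<Phi>" and ?w = "warp_weight D \<Phi>" and ?V = "weight_integral v 0"
  have w: "?w x > 0" for x using mod by (simp add: moderate_weight_def weight_def)
  have wv: "?w (c + s) \<le> v s * ?w c" for s
    using mod unfolding moderate_weight_def by (metis add.commute)
  have dV: "((\<lambda>s. ?w c * ?V s) has_real_derivative ?w c * v s) (at s)" for s
    by (intro DERIV_cmult weight_integral_derivative v)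
  have d\<Psi>: "((\<lambda>s. ?\<Psi> (c + s)) has_real_derivative ?w (c + s)) (at s)" for s
  proof -
    have "((\<lambda>s. c + s) has_real_derivative 1) (at s)" by (auto intro!: derivative_eq_intros)
    from DERIV_chain2[OF inv_warp_derivative[OF W] this] show ?thesis by simp
  qed
  have mono: "?w c * ?V s - ?\<Psi> (c + s) \<le> ?w c * ?V t - ?\<Psi> (c + t)" if "s \<le> t" for s t
  proof (rule DERIV_nonneg_imp_nondecreasing[OF that])
    fix x
    have "((\<lambda>s. ?w c * ?V s - ?\<Psi> (c + s)) has_real_derivative ?w c * v x - ?w (c + x)) (at x)"
      by (intro DERIV_diff dV d\<Psi>)
    then show "\<exists>y. ((\<lambda>s. ?w c * ?V s - ?\<Psi> (c + s)) has_real_derivative y) (at x) \<and> 0 \<le> y"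
      using wv[of x] by (intro exI[of _ "?w c * v x - ?w (c + x)"]) (simp add: mult.commute)
  qed
  have \<Psi>mono: "?\<Psi> (c + s) \<le> ?\<Psi> (c + t)" if "s \<le> t" for s t
    by (rule DERIV_nonneg_imp_nondecreasing[OF that]) (use d\<Psi> w in \<open>blast intro: less_imp_le\<close>)
  show ?thesis
  proof (cases "0 \<le> y")
    case True
    then show ?thesis using mono[OF True] \<Psi>mono[OF True] weight_integral_mono[OF v True] by simp
  next
    case False
    then have "y \<le> 0" by simp
    then show ?thesis using mono[of y 0] \<Psi>mono[of y 0] weight_integral_mono[OF v, of y 0] by simp
  qed
qed

lemma AE_lebesgue_shift:
  assumes "AE x in lebesgue. Q x"
  shows "AE x in lebesgue. Q (x + c :: real)"
proof -
  have "AE x in lebesgue. \<forall>y. y - c = x \<longrightarrow> Q y"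
    by (rule AE_differentiable_preimage[OF assms]) (auto intro!: derivative_intros)
  then show ?thesis by eventually_elim simp
qed

text \<open>Instantiated with u the identity for \<open>w1\<close> and with u =
  \<open>weight_integral v 0\<close> for \<open>w2\<close>.\<close>

lemma weighted_Linf_decay:
  assumes \<theta>: "\<theta> \<in> weighted Linf_space (\<lambda>x. (1 + \<bar>u x\<bar>) powr p)" and u [measurable]: "u \<in> borel_measurable borel"
  shows "\<theta> \<in> borel_measurable lebesgue" "\<exists>C\<ge>0. AE x in lebesgue. norm (\<theta> x) \<le> C * decay p (u x)"
proof -
  define w where "w x = (1 + \<bar>u x\<bar>) powr p" for x
  have w: "w x > 0" for x by (simp add: w_def add_pos_nonneg less_imp_neq[THEN not_sym] powr_gt_zero)
  have [measurable]: "w \<in> borel_measurable borel" unfolding w_def by measurable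
  obtain C where m: "(\<lambda>x. complex_of_real (w x) * \<theta> x) \<in> borel_measurable lebesgue"
    and C: "AE x in lebesgue. norm (complex_of_real (w x) * \<theta> x) \<le> C"
    using \<theta> by (auto simp: weighted_def Linf_space_def w_def)
  have "(\<lambda>x. complex_of_real (1 / w x) * (complex_of_real (w x) * \<theta> x)) \<in> borel_measurable lebesgue"
    using m by measurable
  moreover have "complex_of_real (1 / w x) * (complex_of_real (w x) * \<theta> x) = \<theta> x" for x
    using w[of x] by simp
  ultimately show "\<theta> \<in> borel_measurable lebesgue" by simp
  have "AE x in lebesgue. norm (\<theta> x) \<le> max C 0 * decay p (u x)"
    using C
  proof eventually_elim
    case (elim x)
    then have "w x * norm (\<theta> x) \<le> max C 0" using w[of x] by (simp add: norm_mult)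
    then have "norm (\<theta> x) \<le> max C 0 / w x" using w[of x] by (simp add: field_simps)
    then show ?case by (simp add: decay_def w_def powr_minus_divide)
  qed
  then show "\<exists>C\<ge>0. AE x in lebesgue. norm (\<theta> x) \<le> C * decay p (u x)"
    by (intro exI[of _ "max C 0"]) auto
qed

lemma decay_measurable [measurable]: "decay p \<in> borel_measurable borel"
  unfolding decay_def by measurable

text \<open>Folding the integral onto [0, 1) produces lattice sums of spacing 1, which
  \<open>decay_sum_le\<close> bounds uniformly.\<close>

lemma nn_integral_decay_finite:
  assumes "p > 1"
  shows "(\<integral>\<^sub>\<lambda>x. ennreal (decay p x)) < \<infinity>"
proof -
  have "(\<integral>\<^sub>\<lambda>x. ennreal (decay p x))
     = (\<integral>\<^sub>\<lambda>x. (\<Sum>\<^sub>\<int>k. ennreal (decay p (x + of_int k))) * indicator {0..<1::real} x)"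
    by (rule nn_integral_split_unit_intervals) measurable
  also have "\<dots> \<le> (\<integral>\<^sub>\<lambda>x. decay_bound p 1 * indicator {0..<1::real} x)"
    using decay_sum_le[OF assms, of 1] by (intro nn_integral_mono mult_right_mono) auto
  also have "\<dots> = decay_bound p 1" by (simp add: nn_integral_cmult)
  also have "\<dots> < \<infinity>" by (rule decay_bound_finite[OF assms])
  finally show ?thesis .
qed

text \<open>Since 0 <= \<open>decay\<close> <= 1, its square is at most itself, and an integrable
  bound on the square of h results.\<close>

lemma L2_decay:
  assumes p: "p > 1" and h: "h \<in> borel_measurable lebesgue" and c: "c > 0" and C: "C \<ge> 0"
    and bd: "AE x in lebesgue. norm (h x) \<le> C * decay p ((x - x0) / c)"
  shows "h \<in> L2_space"
proof -
  have "(\<integral>\<^sub>\<lambda>x. enorm2 (h x)) \<le> (\<integral>\<^sub>\<lambda>x. ennreal (C\<^sup>2) * ennreal (decay p ((x - x0) / c)))"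
  proof (rule nn_integral_mono_AE)
    show "AE x in lebesgue. enorm2 (h x) \<le> ennreal (C\<^sup>2) * ennreal (decay p ((x - x0) / c))"
      using bd
    proof eventually_elim
      case (elim x)
      let ?d = "decay p ((x - x0) / c)"
      have "(norm (h x))\<^sup>2 \<le> (C * ?d)\<^sup>2" using elim by (intro power_mono) auto
      also have "\<dots> = C\<^sup>2 * (?d * ?d)" by (simp add: power2_eq_square)
      also have "\<dots> \<le> C\<^sup>2 * (?d * 1)" using p by (intro mult_left_mono decay_le_1) auto
      finally show ?case by (simp add: ennreal_mult[symmetric] ennreal_leI)
    qed
  qed
  also have "\<dots> = ennreal (C\<^sup>2) * (ennreal c * (\<integral>\<^sub>\<lambda>x. ennreal (decay p x)))"
    using c by (subst nn_integral_cmult, measurable, subst nn_integral_real_affine_lebesgue[of _ c x0]) auto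
  also have "\<dots> < \<infinity>" using nn_integral_decay_finite[OF p] by (simp add: ennreal_mult_less_top)
  finally show ?thesis using h by (simp add: L2_space_iff_nn_integral)
qed

lemma powr_mult_ennreal_small:
  assumes X: "X < \<infinity>" and e: "e > 0" and s: "s > 0"
  shows "\<exists>r0. \<forall>r\<ge>r0. ennreal (r powr (- s)) * X \<le> ennreal e"
proof -
  obtain x where x: "X = ennreal x" "x \<ge> 0" using X by (cases X) auto
  have "((\<lambda>r. r powr (- s) * x) \<longlongrightarrow> 0 * x) at_top"
    using s by (intro tendsto_mult tendsto_const tendsto_neg_powr filterlim_ident) auto
  then have "eventually (\<lambda>r. r powr (- s) * x < e) at_top"
    using e by (intro order_tendstoD(2)[of _ 0]) auto
  then obtain r0 where "\<And>r. r \<ge> r0 \<Longrightarrow> r powr (- s) * x < e" by (auto simp: eventually_at_top_linorder)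
  then have "ennreal (r powr (- s) * x) \<le> ennreal e" if "r \<ge> r0" for r
    using that by (intro ennreal_leI less_imp_le) auto
  then show ?thesis
    using x by (auto simp: ennreal_mult)
qed

section \<open>Warped filter banks\<close>

text \<open>The filter without the factor \<open>sqrt (a m)\<close>. It does not involve a, so its
  decay estimates hold for all choices of a at once.\<close>

definition warped_prototype :: "real set \<Rightarrow> (real \<Rightarrow> real) \<Rightarrow> (real \<Rightarrow> complex) \<Rightarrow> int \<Rightarrow> real \<Rightarrow> complex" where
  "warped_prototype D \<Phi> \<theta> m \<xi> = (if \<xi> \<in> D then \<theta> (\<Phi> \<xi> - real_of_int m) else 0)"

lemma warped_filter_eq_prototype:
  "warped_filter D \<Phi> \<theta> a m \<xi> = complex_of_real (sqrt (a m)) * warped_prototype D \<Phi> \<theta> m \<xi>"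
  by (simp add: warped_filter_def warped_prototype_def)

context
  fixes D :: "real set" and \<Phi> v :: "real \<Rightarrow> real" and \<theta> :: "real \<Rightarrow> complex" and \<epsilon> C :: real
  assumes W: "warping_function D \<Phi>" and v: "weight v" and mod: "moderate_weight v (warp_weight D \<Phi>)"
    and \<epsilon>: "\<epsilon> > 0" and C: "C \<ge> 0" and \<theta>: "\<theta> \<in> borel_measurable lebesgue"
    and \<theta>1: "AE y in lebesgue. norm (\<theta> y) \<le> C * decay (1 + \<epsilon>) y"
    and \<theta>2: "AE y in lebesgue. norm (\<theta> y) \<le> C * decay (1 + \<epsilon>) (weight_integral v 0 y)"
begin

abbreviation prototype :: "int \<Rightarrow> real \<Rightarrow> complex" where
  "prototype \<equiv> warped_prototype D \<Phi> \<theta>"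

abbreviation scale :: "int \<Rightarrow> real" where
  "scale m \<equiv> warp_weight D \<Phi> (of_int m)"

text \<open>The displacement of \<xi> from the centre of the m-th filter, measured in units of w(m).
  Moving \<xi> by k/a m moves the offset by k/(a m w(m)), a step bounded below uniformly in
  m.\<close>

abbreviation offset :: "int \<Rightarrow> real \<Rightarrow> real" where
  "offset m \<xi> \<equiv> (\<xi> - inv_into D \<Phi> (of_int m)) / scale m"

lemma warp_weight_pos: "warp_weight D \<Phi> x > 0"
  using mod by (simp add: moderate_weight_def weight_def)

text \<open>Used in two ways: decay in V(0, .) becomes decay in the offset, and a filter index close
  to \<Phi>(\<xi>) forces a small offset.\<close>

lemma offset_le:
  assumes "\<xi> \<in> D"
  shows "\<bar>offset m \<xi>\<bar> \<le> \<bar>weight_integral v 0 (\<Phi> \<xi> - of_int m)\<bar>"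
  using inv_warp_distance_le[OF W v mod, of "of_int m" "\<Phi> \<xi> - of_int m"] warp_weight_pos[of "of_int m"] inv_warp_warp[OF W assms]
  by (simp add: pos_divide_le_eq mult.commute)

lemma AE_prototype_decay:
  "AE \<xi> in lebesgue. \<xi> \<in> D \<longrightarrow> (\<forall>m. norm (prototype m \<xi>) \<le> C * decay (1 + \<epsilon>) (\<Phi> \<xi> - of_int m))"
proof -
  have "AE y in lebesgue. \<forall>m. norm (\<theta> (y + of_int (- m))) \<le> C * decay (1 + \<epsilon>) (y + of_int (- m))"
    unfolding AE_all_countable using AE_lebesgue_shift[OF \<theta>1] by blast
  from AE_warp[OF W this] show ?thesis
    by eventually_elim (auto simp: warped_prototype_def)
qed

text \<open>Unlike the decay in \<Phi>(\<xi>) - m, this bound is meaningful on the whole line and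
  holds outside D because the prototype vanishes there. That matters because the shifted points
  \<xi> + k/a m may leave D.\<close>

lemma AE_prototype_offset_decay:
  "AE \<xi> in lebesgue. \<forall>m. norm (prototype m \<xi>) \<le> C * decay (1 + \<epsilon>) (offset m \<xi>)"
proof -
  have "AE y in lebesgue. \<forall>m. norm (\<theta> (y + of_int (- m))) \<le> C * decay (1 + \<epsilon>) (weight_integral v 0 (y + of_int (- m)))"
    unfolding AE_all_countable using AE_lebesgue_shift[OF \<theta>2] by blast
  from AE_warp[OF W this] show ?thesis
  proof eventually_elim
    case (elim \<xi>)
    show ?case
    proof
      fix m
      show "norm (prototype m \<xi>) \<le> C * decay (1 + \<epsilon>) (offset m \<xi>)"
      proof (cases "\<xi> \<in> D")
        case True
        have "norm (prototype m \<xi>) \<le> C * decay (1 + \<epsilon>) (weight_integral v 0 (\<Phi> \<xi> - of_int m))"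
          using elim True by (simp add: warped_prototype_def)
        also have "\<dots> \<le> C * decay (1 + \<epsilon>) (offset m \<xi>)"
          using \<epsilon> by (intro mult_left_mono decay_antimono C offset_le[OF True]) auto
        finally show ?thesis .
      qed (use C in \<open>simp add: warped_prototype_def\<close>)
    qed
  qed
qed

lemma AE_prototype_shift_decay:
  "AE \<xi> in lebesgue. \<forall>m k. norm (prototype m (\<xi> + of_int k * (1 / a m)))
    \<le> C * decay (1 + \<epsilon>) (offset m \<xi> + of_int k * (1 / (a m * scale m)))"
proof -
  have "AE \<xi> in lebesgue. \<forall>k m. norm (prototype m (\<xi> + of_int k * (1 / a m)))
    \<le> C * decay (1 + \<epsilon>) (offset m (\<xi> + of_int k * (1 / a m)))"
    unfolding AE_all_countable
  proof (intro allI)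
    fix k m
    from AE_lebesgue_shift[OF AE_prototype_offset_decay, of "of_int k * (1 / a m)"]
    show "AE \<xi> in lebesgue. norm (prototype m (\<xi> + of_int k * (1 / a m)))
      \<le> C * decay (1 + \<epsilon>) (offset m (\<xi> + of_int k * (1 / a m)))"
      by eventually_elim blast
  qed
  then show ?thesis
    by eventually_elim (simp add: add_divide_distrib diff_divide_distrib algebra_simps)
qed

lemma step_ge:
  assumes "0 < am" "am \<le> a0 / warp_weight D \<Phi> x" "a0 > 0"
  shows "1 / a0 \<le> 1 / (am * warp_weight D \<Phi> x)"
  using assms warp_weight_pos[of x] by (intro divide_left_mono) (auto simp: field_simps)

lemma warped_prototype_measurable: "prototype m \<in> borel_measurable lebesgue"
  using measurable_warp[OF W lebesgue_measurable_shift[OF \<theta>, of "- of_int m"]]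
  by (simp only: warped_prototype_def[abs_def] diff_conv_add_uminus)

text \<open>The offset is affine in \<xi>, so its decay bound gives square integrability directly,
  without a change of variables through \<Phi>.\<close>

lemma warped_filter_L2: "warped_filter D \<Phi> \<theta> a m \<in> L2_space"
proof -
  have "prototype m \<in> L2_space"
  proof (rule L2_decay[OF _ warped_prototype_measurable warp_weight_pos C])
    show "AE \<xi> in lebesgue. norm (prototype m \<xi>) \<le> C * decay (1 + \<epsilon>) (offset m \<xi>)"
      using AE_prototype_offset_decay by eventually_elim blast
  qed (use \<epsilon> in simp)
  from L2_space_cmult[OF this] show ?thesis
    unfolding warped_filter_eq_prototype[abs_def] .
qed

section \<open>Overlap function, Bessel bound and frame bounds\<close>

abbreviation overlap :: "(int \<Rightarrow> real) \<Rightarrow> real \<Rightarrow> ennreal" where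
  "overlap a \<xi> \<equiv> (\<Sum>\<^sub>\<int>m. enorm (prototype m \<xi>)
     * (\<Sum>\<^sub>\<int>k. enorm (prototype m (\<xi> + of_int k * (1 / a m)))))"

abbreviation coefficient_energy :: "(int \<Rightarrow> real) \<Rightarrow> (real \<Rightarrow> complex) \<Rightarrow> ennreal" where
  "coefficient_energy a f \<equiv> (\<Sum>\<^sub>\<infinity>i. enorm2 (L2_inner f (warped_filter_bank D \<Phi> \<theta> a i)))"

lemma coefficient_energy_bounds:
  assumes f: "f \<in> inv_fourier_space D" and a: "\<And>m. 0 < a m"
  shows "coefficient_energy a f \<le> (\<integral>\<^sub>\<lambda>\<xi>. enorm2 (fourier_L2 f \<xi>) * overlap a \<xi>)"
    "2 * (\<integral>\<^sub>\<lambda>\<xi>. enorm2 (fourier_L2 f \<xi>) * (\<Sum>\<^sub>\<int>m. enorm2 (prototype m \<xi>)))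
      \<le> coefficient_energy a f + (\<integral>\<^sub>\<lambda>\<xi>. enorm2 (fourier_L2 f \<xi>) * overlap a \<xi>)"
  unfolding warped_coefficients_sum[OF f warped_filter_L2] warped_filter_eq_prototype
  by (rule filter_bank_sampling_bounds[OF inv_fourier_space_norm(1)[OF f] warped_prototype_measurable a],
      rule warped_filter_L2[unfolded warped_filter_eq_prototype[abs_def]])+

lemma AE_overlap_le:
  assumes a: "\<And>m. 0 < a m" "\<And>m. a m \<le> a0 / scale m" and a0: "a0 > 0"
  shows "AE \<xi> in lebesgue. \<xi> \<in> D \<longrightarrow> overlap a \<xi> \<le> ennreal (C\<^sup>2) * (decay_bound (1 + \<epsilon>) 1 * decay_bound (1 + \<epsilon>) (1 / a0))"
  using AE_prototype_decay AE_prototype_shift_decay[of a]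
proof eventually_elim
  case (elim \<xi>)
  show ?case
    by (rule impI, rule full_sum_bound[where t = "\<Phi> \<xi>" and b = "\<lambda>m. 1 / (a m * scale m)" and x = "\<lambda>m. offset m \<xi>"])
       (use elim \<epsilon> C a0 a in \<open>auto intro: step_ge\<close>)
qed

text \<open>The kernels need to be compared only on D because the transform of f vanishes almost
  everywhere outside it.\<close>

lemma fourier_weighted_integral_le:
  assumes f: "f \<in> inv_fourier_space D" and K: "AE \<xi> in lebesgue. \<xi> \<in> D \<longrightarrow> G \<xi> \<le> H \<xi>"
  shows "(\<integral>\<^sub>\<lambda>\<xi>. enorm2 (fourier_L2 f \<xi>) * G \<xi>) \<le> (\<integral>\<^sub>\<lambda>\<xi>. enorm2 (fourier_L2 f \<xi>) * H \<xi>)"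
proof (rule nn_integral_mono_AE)
  show "AE \<xi> in lebesgue. enorm2 (fourier_L2 f \<xi>) * G \<xi> \<le> enorm2 (fourier_L2 f \<xi>) * H \<xi>"
    using K inv_fourier_space_norm(3)[OF f]
    by eventually_elim (auto intro: mult_left_mono)
qed

lemma fourier_constant_integral:
  assumes f: "f \<in> inv_fourier_space D"
  shows "(\<integral>\<^sub>\<lambda>\<xi>. enorm2 (fourier_L2 f \<xi>) * K) = K * ennreal ((L2_norm f)\<^sup>2)"
proof -
  note F = inv_fourier_space_norm[OF f]
  note [measurable] = L2_space_measurable[OF F(1)]
  show ?thesis
    unfolding F(2)[symmetric] ennreal_L2_norm_power2[OF F(1)]
    by (subst nn_integral_multc) (auto simp: mult.commute)
qed

text \<open>This supplies the upper bound in both conclusions, and also the finiteness that permits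
  cancellation in the proof of the lower frame bound.\<close>

lemma overlap_energy_le:
  assumes a0: "a0 > 0"
  shows "\<exists>B\<ge>0. \<forall>a f. (\<forall>m. 0 < a m) \<longrightarrow> (\<forall>m. a m \<le> a0 / scale m) \<longrightarrow> f \<in> inv_fourier_space D
    \<longrightarrow> (\<integral>\<^sub>\<lambda>\<xi>. enorm2 (fourier_L2 f \<xi>) * overlap a \<xi>) \<le> ennreal (B * (L2_norm f)\<^sup>2)"
proof -
  define K where "K = ennreal (C\<^sup>2) * (decay_bound (1 + \<epsilon>) 1 * decay_bound (1 + \<epsilon>) (1 / a0))"
  have "K < \<infinity>"
    using \<epsilon> by (simp add: K_def ennreal_mult_less_top decay_bound_finite[unfolded infinity_ennreal_def])
  then obtain B where B: "K = ennreal B" "B \<ge> 0" by (cases K) auto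
  show ?thesis
  proof (intro exI[of _ B] conjI[OF B(2)] allI impI)
    fix a f assume a: "\<forall>m. 0 < a m" "\<forall>m. a m \<le> a0 / scale m" and f: "f \<in> inv_fourier_space D"
    have "(\<integral>\<^sub>\<lambda>\<xi>. enorm2 (fourier_L2 f \<xi>) * overlap a \<xi>) \<le> (\<integral>\<^sub>\<lambda>\<xi>. enorm2 (fourier_L2 f \<xi>) * K)"
      unfolding K_def by (rule fourier_weighted_integral_le[OF f AE_overlap_le]) (use a a0 in auto)
    also have "\<dots> = ennreal (B * (L2_norm f)\<^sup>2)"
      unfolding fourier_constant_integral[OF f] B(1) using B(2) by (subst ennreal_mult) auto
    finally show "(\<integral>\<^sub>\<lambda>\<xi>. enorm2 (fourier_L2 f \<xi>) * overlap a \<xi>) \<le> ennreal (B * (L2_norm f)\<^sup>2)" .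
  qed
qed

lemma warped_bessel:
  assumes a: "\<And>m. 0 < a m" and "a0 > 0" "\<And>m. a m \<le> a0 / scale m"
  shows "bessel_for (inv_fourier_space D) (warped_filter_bank D \<Phi> \<theta> a)"
proof -
  obtain B where "\<forall>f. f \<in> inv_fourier_space D \<longrightarrow>
      (\<integral>\<^sub>\<lambda>\<xi>. enorm2 (fourier_L2 f \<xi>) * overlap a \<xi>) \<le> ennreal (B * (L2_norm f)\<^sup>2)"
    using overlap_energy_le[OF assms(2)] assms(1,3) by blast
  then show ?thesis
    unfolding bessel_for_def using order_trans[OF coefficient_energy_bounds(1)] a by blast
qed

lemma overlap_split:
  "overlap a \<xi> = (\<Sum>\<^sub>\<int>m. enorm2 (prototype m \<xi>))
    + (\<Sum>\<^sub>\<int>m. enorm (prototype m \<xi>)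
       * (\<Sum>\<^sub>\<int>k. enorm (prototype m (\<xi> + of_int k * (1 / a m))) * indicator (- {0}) k))"
  by (subst nn_integral_int_split_0) (simp add: distrib_left nn_integral_add power2_eq_square ennreal_mult)

text \<open>The order of choices gives uniformity: \<delta> determines M so that far indices
  contribute at most \<delta>/2, then M determines the spacing b0 so that near indices contribute at
  most \<delta>/2, and a0 = 1/b0 forces every rescaled step 1/(a m w(m)) to be at least b0. Nothing
  depends on a or \<xi>.\<close>

lemma AE_overlap_le_diagonal:
  assumes \<delta>: "\<delta> > 0"
  obtains a0 :: real where "a0 > 0"
    "\<And>a. (\<And>m. 0 < a m) \<Longrightarrow> (\<And>m. a m \<le> a0 / scale m) \<Longrightarrow>
      AE \<xi> in lebesgue. \<xi> \<in> D \<longrightarrow> overlap a \<xi> \<le> (\<Sum>\<^sub>\<int>m. enorm2 (prototype m \<xi>)) + ennreal \<delta>"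
proof -
  let ?V = "weight_integral v 0"
  let ?p = "1 + \<epsilon>" and ?q = "1 + \<epsilon> / 2"
  have p: "?p > 1" and q: "?q > 1" using \<epsilon> by auto
  define X where "X = ennreal (C\<^sup>2) * (decay_bound ?p 1 * int_zeta ?p)"
  define Y where "Y = ennreal (C\<^sup>2) * (decay_bound ?q 1 * decay_bound ?p 1)"
  have X: "X < \<infinity>" and Y: "Y < \<infinity>"
    using p q by (simp_all add: X_def Y_def ennreal_mult_less_top decay_bound_finite[unfolded infinity_ennreal_def]
        int_zeta_finite[unfolded infinity_ennreal_def])
  obtain r where r: "\<And>s. s \<ge> r \<Longrightarrow> ennreal (s powr (- (\<epsilon> / 2))) * Y \<le> ennreal (\<delta> / 2)"
    using powr_mult_ennreal_small[OF Y, of "\<delta> / 2" "\<epsilon> / 2"] \<delta> \<epsilon> by auto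
  define M where "M = max r 0"
  \<comment> \<open>V(0, .) is monotone, so its values at the two endpoints bound it on
    [-M, M].\<close>
  define VM where "VM = max \<bar>?V M\<bar> \<bar>?V (- M)\<bar>"
  have VM: "\<bar>?V y\<bar> \<le> VM" if "\<bar>y\<bar> \<le> M" for y
    using weight_integral_mono[OF v, of y M] weight_integral_mono[OF v, of "- M" y] that unfolding VM_def by linarith
  obtain s where s: "\<And>t. t \<ge> s \<Longrightarrow> ennreal (t powr (- ?p)) * X \<le> ennreal (\<delta> / 2)"
    using powr_mult_ennreal_small[OF X, of "\<delta> / 2" ?p] \<delta> \<epsilon> by auto
  \<comment> \<open>Three demands: b0 >= 1 for a bound on the lattice sums that does not involve b0,
    \<open>VM \<le> b0 / 2\<close> so that near offsets stay within half a step, and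
    \<open>s \<le> b0 / 2\<close> so that the near part is small.\<close>
  define b0 where "b0 = max 1 (max (2 * VM) (2 * s))"
  have b0: "b0 \<ge> 1" "VM \<le> b0 / 2" "s \<le> b0 / 2" by (auto simp: b0_def)
  show ?thesis
  proof (rule that[of "1 / b0"])
    show "1 / b0 > 0" using b0 by simp
    fix a assume a: "\<And>m. 0 < a m" "\<And>m. a m \<le> 1 / b0 / scale m"
    show "AE \<xi> in lebesgue. \<xi> \<in> D \<longrightarrow> overlap a \<xi> \<le> (\<Sum>\<^sub>\<int>m. enorm2 (prototype m \<xi>)) + ennreal \<delta>"
      using AE_prototype_decay AE_prototype_shift_decay[of a]
    proof eventually_elim
      case (elim \<xi>)
      show ?case
      proof
        assume \<xi>: "\<xi> \<in> D"
        have x: "\<bar>offset m \<xi>\<bar> \<le> b0 / 2" if "\<bar>\<Phi> \<xi> - of_int m\<bar> \<le> M" for m :: int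
          using offset_le[OF \<xi>, of m] VM[OF that] b0(2) by linarith
        have bstep: "b0 \<le> 1 / (a m * scale m)" for m
          using step_ge[OF a(1) a(2), of m] b0(1) by simp
        have "(\<Sum>\<^sub>\<int>m. enorm (prototype m \<xi>) * (\<Sum>\<^sub>\<int>k. enorm (prototype m (\<xi> + of_int k * (1 / a m))) * indicator (- {0}) k))
          \<le> ennreal (C\<^sup>2) * (ennreal ((b0 / 2) powr (- ?p)) * (decay_bound ?p 1 * int_zeta ?p)
             + ennreal ((1 + M) powr (- (\<epsilon> / 2))) * (decay_bound ?q 1 * decay_bound ?p 1))"
          by (rule off_diagonal_bound[where t = "\<Phi> \<xi>" and b = "\<lambda>m. 1 / (a m * scale m)" and x = "\<lambda>m. offset m \<xi>"])
             (use \<xi> elim \<epsilon> C b0 bstep x in \<open>auto simp: M_def\<close>)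
        also have "\<dots> = ennreal ((b0 / 2) powr (- ?p)) * X + ennreal ((1 + M) powr (- (\<epsilon> / 2))) * Y"
          unfolding X_def Y_def by (simp only: distrib_left mult_ac)
        also have "\<dots> \<le> ennreal (\<delta> / 2) + ennreal (\<delta> / 2)"
          using b0 by (intro add_mono s r) (auto simp: M_def)
        also have "\<dots> = ennreal \<delta>" using \<delta> by (subst ennreal_plus[symmetric]) auto
        finally show "overlap a \<xi> \<le> (\<Sum>\<^sub>\<int>m. enorm2 (prototype m \<xi>)) + ennreal \<delta>"
          unfolding overlap_split by (rule add_left_mono)
      qed
    qed
  qed
qed

text \<open>Take \<delta> = A1/2 in the overlap bound. Writing n for the squared norm of f, 2 X <= S
  + T <= S + X + A1 n/2, hence X <= S + A1 n/2. The covering condition, transported to D, gives A1 n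
  <= X, so A1 n/2 <= S.\<close>

lemma warped_frame:
  assumes A1: "A1 > 0" and cover: "AE x in lebesgue. ennreal A1 \<le> (\<Sum>\<^sub>\<infinity>m::int. enorm2 (\<theta> (x - real_of_int m)))"
  shows "\<exists>a0>0. \<forall>a. (\<forall>m. 0 < a m) \<and> (\<forall>m. a m \<le> a0 / warp_weight D \<Phi> (real_of_int m))
    \<longrightarrow> frame_for (inv_fourier_space D) (warped_filter_bank D \<Phi> \<theta> a)"
proof -
  define diag where "diag \<xi> = (\<Sum>\<^sub>\<int>m. enorm2 (prototype m \<xi>))" for \<xi>
  have [measurable]: "prototype m \<in> borel_measurable lebesgue" for m by (rule warped_prototype_measurable)
  have diag_meas [measurable]: "diag \<in> borel_measurable lebesgue"
    unfolding diag_def by (intro borel_measurable_nn_integral_int) measurable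
  have diag_ge: "AE \<xi> in lebesgue. \<xi> \<in> D \<longrightarrow> ennreal A1 \<le> diag \<xi>"
    using AE_warp[OF W cover]
  proof eventually_elim
    case (elim \<xi>)
    then show ?case
      unfolding diag_def by (subst nn_integral_count_space_eq_infsum) (auto simp: infinite_UNIV_int warped_prototype_def)
  qed
  have "A1 / 2 > 0" using A1 by simp
  then obtain a0 :: real where a0: "a0 > 0" and off: "\<And>a. (\<And>m. 0 < a m) \<Longrightarrow> (\<And>m. a m \<le> a0 / scale m) \<Longrightarrow>
      AE \<xi> in lebesgue. \<xi> \<in> D \<longrightarrow> overlap a \<xi> \<le> diag \<xi> + ennreal (A1 / 2)"
    unfolding diag_def by (rule AE_overlap_le_diagonal) blast
  obtain B where Bo: "\<forall>a f. (\<forall>m. 0 < a m) \<longrightarrow> (\<forall>m. a m \<le> a0 / scale m) \<longrightarrow> f \<in> inv_fourier_space D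
    \<longrightarrow> (\<integral>\<^sub>\<lambda>\<xi>. enorm2 (fourier_L2 f \<xi>) * overlap a \<xi>) \<le> ennreal (B * (L2_norm f)\<^sup>2)"
    using overlap_energy_le[OF a0] by blast
  have "frame_for (inv_fourier_space D) (warped_filter_bank D \<Phi> \<theta> a)"
    if a: "\<And>m. 0 < a m" "\<And>m. a m \<le> a0 / scale m" for a
    unfolding frame_for_def
  \<comment> \<open>The maximum ensures that the upper frame constant is at least the lower
    one.\<close>
  proof (rule exI[of _ "A1 / 2"], rule exI[of _ "max (A1 / 2) B"], intro conjI ballI)
    fix f assume f: "f \<in> inv_fourier_space D"
    let ?n = "(L2_norm f)\<^sup>2" and ?S = "coefficient_energy a f"
    note [measurable] = L2_space_measurable[OF inv_fourier_space_norm(1)[OF f]]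
    define X where "X = (\<integral>\<^sub>\<lambda>\<xi>. enorm2 (fourier_L2 f \<xi>) * diag \<xi>)"
    let ?T = "\<integral>\<^sub>\<lambda>\<xi>. enorm2 (fourier_L2 f \<xi>) * overlap a \<xi>"
    have TB: "?T \<le> ennreal (B * ?n)" using Bo a f by blast
    note coefficient_energy_bounds(1)[OF f a(1)]
    also note TB
    also have "ennreal (B * ?n) \<le> ennreal (max (A1 / 2) B * ?n)" by (intro ennreal_leI mult_right_mono) auto
    finally show "?S \<le> ennreal (max (A1 / 2) B * ?n)" .
    have AX: "ennreal (A1 * ?n) \<le> X"
      using fourier_weighted_integral_le[OF f diag_ge] A1
      unfolding X_def fourier_constant_integral[OF f] by (simp add: ennreal_mult)
    have "X \<le> ?T"
      unfolding X_def diag_def overlap_split by (intro nn_integral_mono mult_left_mono) auto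
    also note TB
    \<comment> \<open>Finiteness of X is what allows it to be cancelled from 2 X <= S + X + A1 n/2
      in the extended nonnegative reals.\<close>
    finally have Xfin: "X < \<infinity>" using le_less_trans by fastforce
    have "?T \<le> (\<integral>\<^sub>\<lambda>\<xi>. enorm2 (fourier_L2 f \<xi>) * (diag \<xi> + ennreal (A1 / 2)))"
      by (rule fourier_weighted_integral_le[OF f off[OF a]])
    also have "\<dots> = X + (\<integral>\<^sub>\<lambda>\<xi>. enorm2 (fourier_L2 f \<xi>) * ennreal (A1 / 2))"
      unfolding X_def distrib_left by (rule nn_integral_add) auto
    also have "\<dots> = X + ennreal (A1 / 2 * ?n)"
      unfolding fourier_constant_integral[OF f] using A1 by (subst ennreal_mult) auto
    finally have "2 * X \<le> ?S + (X + ennreal (A1 / 2 * ?n))"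
      using coefficient_energy_bounds(2)[OF f a(1)] unfolding diag_def[symmetric] X_def[symmetric]
      by (meson add_left_mono order_trans)
    then have "X + X \<le> X + (?S + ennreal (A1 / 2 * ?n))" by (simp add: mult_2 add_ac)
    then have "X \<le> ?S + ennreal (A1 / 2 * ?n)"
      using Xfin by (auto simp: ennreal_add_left_cancel_le)
    with AX have *: "ennreal (A1 * ?n) \<le> ?S + ennreal (A1 / 2 * ?n)" by (rule order_trans)
    show "ennreal (A1 / 2 * ?n) \<le> ?S"
    proof (cases "?S")
      case (real s)
      have "ennreal (A1 * ?n) \<le> ennreal (s + A1 / 2 * ?n)"
        using * real A1 by (simp add: ennreal_plus)
      then have "A1 * ?n \<le> s + A1 / 2 * ?n"
        using real A1 by (subst (asm) ennreal_le_iff) auto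
      then have "A1 / 2 * ?n \<le> s" by simp
      then show ?thesis unfolding real by (rule ennreal_leI)
    qed simp
  qed (use A1 in auto)
  then show ?thesis using a0 by blast
qed

end

theorem theorem4p11:
  fixes D :: "real set" and \<Phi> v w1 w2 :: "real \<Rightarrow> real" and \<theta> :: "real \<Rightarrow> complex" and \<epsilon> :: real
  assumes "warping_function D \<Phi>"
    and "submultiplicative_weight v"
    and "moderate_weight v (warp_weight D \<Phi>)"
    and "\<theta> \<in> weighted L2_space (\<lambda>x. sqrt (v x))"
    and "\<epsilon> > 0"
    and "w1 = (\<lambda>x. (1 + \<bar>x\<bar>) powr (1 + \<epsilon>))"
    and "w2 = (\<lambda>x. (1 + \<bar>weight_integral v 0 x\<bar>) powr (1 + \<epsilon>))"
    and "\<theta> \<in> weighted Linf_space w1 \<inter> weighted Linf_space w2"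
  shows "(\<forall>a :: int \<Rightarrow> real.
            (\<forall>m. 0 < a m) \<and> (\<exists>a'>0. \<forall>m. a m \<le> a' / warp_weight D \<Phi> (real_of_int m)) \<longrightarrow>
            bessel_for (inv_fourier_space D) (warped_filter_bank D \<Phi> \<theta> a))
       \<and> (\<forall>A1 :: real.
            0 < A1 \<and>
            (AE x in lebesgue.
               ennreal A1 \<le> (\<Sum>\<^sub>\<infinity>m::int. ennreal ((norm (\<theta> (x - real_of_int m)))\<^sup>2))) \<longrightarrow>
            (\<exists>a0>0. \<forall>a :: int \<Rightarrow> real.
               (\<forall>m. 0 < a m) \<and> (\<forall>m. a m \<le> a0 / warp_weight D \<Phi> (real_of_int m)) \<longrightarrow>
               frame_for (inv_fourier_space D) (warped_filter_bank D \<Phi> \<theta> a)))"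
proof -
  have v: "weight v" using assms(2) by (simp add: submultiplicative_weight_def)
  have "continuous_on UNIV (weight_integral v 0)"
    by (intro continuous_at_imp_continuous_on ballI DERIV_isCont) (rule weight_integral_derivative[OF v])
  then have Vm: "weight_integral v 0 \<in> borel_measurable borel" by (rule borel_measurable_continuous_onI)
  have \<theta>w: "\<theta> \<in> weighted Linf_space (\<lambda>x. (1 + \<bar>x\<bar>) powr (1 + \<epsilon>))"
    "\<theta> \<in> weighted Linf_space (\<lambda>x. (1 + \<bar>weight_integral v 0 x\<bar>) powr (1 + \<epsilon>))"
    using assms(6-8) by auto
  have \<theta>: "\<theta> \<in> borel_measurable lebesgue" by (rule weighted_Linf_decay(1)[OF \<theta>w(1)]) simp
  obtain C1 where C1: "C1 \<ge> 0" "AE x in lebesgue. norm (\<theta> x) \<le> C1 * decay (1 + \<epsilon>) x"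
    using weighted_Linf_decay(2)[OF \<theta>w(1)] by auto
  obtain C2 where C2: "C2 \<ge> 0" "AE x in lebesgue. norm (\<theta> x) \<le> C2 * decay (1 + \<epsilon>) (weight_integral v 0 x)"
    using weighted_Linf_decay(2)[OF \<theta>w(2) Vm] by auto
  define C where "C = max C1 C2"
  have C: "C \<ge> 0" using C1 by (simp add: C_def)
  have 1: "AE x in lebesgue. norm (\<theta> x) \<le> C * decay (1 + \<epsilon>) x"
    using C1(2) by eventually_elim (erule order_trans, auto simp: C_def intro: mult_right_mono)
  have 2: "AE x in lebesgue. norm (\<theta> x) \<le> C * decay (1 + \<epsilon>) (weight_integral v 0 x)"
    using C2(2) by eventually_elim (erule order_trans, auto simp: C_def intro: mult_right_mono)
  note ctxt = assms(1) v assms(3,5) C \<theta> 1 2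
  show ?thesis using warped_bessel[OF ctxt] warped_frame[OF ctxt] by blast
qed

end
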